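(* Let $\sigma\ge 1$, $\Upsilon\ge 1$, $l>1$ and $0<\varepsilon<1$. Let $H:\mathbb{T}^n\times B_1\times\mathbb{R}\to\mathbb{R}$ be a Hamiltonian of the form $$H(q,p,t)=h(p)+f(q,p,t)$$ such that: (i) $f,\ \partial_p f\in\bar{\mathcal{B}}_{\sigma,2}$ (with $B=B_1$); (ii) $|f|_{\sigma+2,0}+\|\partial_q f\|_{\sigma,1,l+2}+\|\partial_p f\|_{\sigma,2,l+1}<\varepsilon$; (iii) $\partial_p^2H^t\in C^{\sigma+2}(\mathbb{T}^n\times B_1)$ for every fixed $t\in\mathbb{R}$, and all partial derivatives $\partial^i_{qp}(\partial_p^2H)$ of order $i$ with respect to $(q,p)$, $0\le i\le 3$, belong to $C(\mathbb{T}^n\times B_1\times\mathbb{R})$; (iv) $\sup_{t\in\mathbb{R}}|\partial_p^2H^t|_{C^{\sigma+2}}\le\Upsilon$. For $p\in B_1$ let $\varphi_{0,p}:\mathbb{T}^n\to\mathbb{T}^n\times B_1$, $\varphi_{0,p}(q)=(q,p)$. Then there exists a time-dependent Hamiltonian $\tilde h$ on $\mathbb{T}^n\times B_1\times\mathbb{R}$ such that, if $\varepsilon$ is small enough with respect to $n$, $l$, $\Upsilon$ and $|\partial_p h|_{C^1}$, then for all $(q,p)\in\mathbb{T}^n\times B_{1/2}$ there exist $p_-,p_+\in B_1$ and a biasymptotically quasiperiodic solution $g(t)$ associated to $(X_H,X_{\tilde h},\varphi_{0,p_\pm})$ such that $g(0)=(q,p)$.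
   Context: Notation. $\mathbb{T}^n$ is the $n$-dimensional torus and $B_r\subset\mathbb{R}^n$ is the ball of radius $r$ centred at the origin. For a function $f$ on $\mathbb{T}^n\times B\times\mathbb{R}$ ($B$ a ball centred at the origin), $f^t(q,p)=f(q,p,t)$ and $f^t_p(q)=f(q,p,t)$. For a time-dependent Hamiltonian $H(q,p,t)$, $X_H=(\partial_pH,-\partial_qH)$ is its Hamiltonian vector field. Hölder norms. For an integer $k\ge0$, $|f|_{C^k}=\sup_{|\alpha|\le k}|\partial^\alpha f|_{C^0}$, where $|\cdot|_{C^0}$ is the sup norm. For $\sigma=k+\mu$ with $0<\mu<1$, $|f|_{C^\sigma}=\sup_{|\alpha|\le k}|\partial^\alpha f|_{C^0}+\sup_{|\alpha|=k}\sup_{x\ne y}\frac{|\partial^\alpha f(x)-\partial^\alpha f(y)|}{|x-y|^\mu}$, and $C^\sigma$ is the space of $C^k$ functions with $|f|_{C^\sigma}<\infty$. Function spaces. For $\sigma\ge1$, $\mathcal{B}_\sigma$ is the space of functions $f$ on $\mathbb{T}^n\times B\times\mathbb{R}$ such that $f,\partial_pf\in C(\mathbb{T}^n\times B\times\mathbb{R})$ and $f^t_p\in C^\sigma(\mathbb{T}^n)$ for all $(p,t)\in B\times\mathbb{R}$. For $l\ge1$, $$|f|_{\sigma,l}=\sup_{(p,t)\in B\times\mathbb{R}}|f^t_p|_{C^\sigma}(1+|t|^l)+\sup_{(p,t)\in B\times\mathbb{R}}|(\partial_pf)^t_p|_{C^0}(1+|t|^{l-1}),$$ $$|f|_{\sigma,0}=\sup_{(p,t)\in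 B\times\mathbb{R}}|f^t_p|_{C^\sigma}+\sup_{(p,t)\in B\times\mathbb{R}}|(\partial_pf)^t_p|_{C^0}.$$ For an integer $k\ge0$, $\bar{\mathcal{B}}_{\sigma,k}$ is the space of $f$ with $\partial_q^if\in\mathcal{B}_{\sigma+k-i}$ for all $0\le i\le k$ ($\partial_q^i$ denotes all partial derivatives of order $i$ in $q$, $\partial_q^0f=f$), and for $l>1$, $\|f\|_{\sigma,k,l}=\max_{0\le i\le k}|\partial_q^if|_{\sigma+k-i,l}$. For vector-valued functions these are understood componentwise. Biasymptotically quasiperiodic solutions. Let $X^t,X^t_{0,+},X^t_{0,-}$ be time-dependent vector fields of class $C^{\sigma+k}$ on $\mathbb{T}^n\times B$ ($\sigma\ge0$ real, $k\ge0$ integer) for all $t\in\mathbb{R}$, and $\varphi_{0,\pm}:\mathbb{T}^n\to\mathbb{T}^n\times B$ embeddings of class $C^\sigma$ such that, for some $\omega_\pm\in\mathbb{R}^n$, $$\lim_{t\to\pm\infty}|X^t-X^t_{0,\pm}|_{C^{\sigma+k}}=0,\qquad X_{0,\pm}(\varphi_{0,\pm}(q),t)=\partial_q\varphi_{0,\pm}(q)\,\omega_\pm\ \text{ for all }(q,t)\in\mathbb{T}^n\times\mathbb{R}.$$ An integral curve $g(t)$ of $X$ is a biasymptotically quasiperiodic solution associated to $(X,X_{0,\pm},\varphi_{0,\pm})$ if there exist $q_-,q_+\in\mathbb{T}^n$ such that $\lim_{t\to\pm\infty}|g(t)-\varphi_{0,\pm}(q_\pm+\omega_\pm t)|=0$.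 In the claim, $X=X_H$, $X_{0,+}=X_{0,-}=X_{\tilde h}$, $\varphi_{0,\pm}=\varphi_{0,p_\pm}$ (with the given $\sigma$ and some integer $k\ge0$); being associated to this triple includes that the two displayed conditions hold for some $\omega_\pm$. "Small enough with respect to" the listed quantities means $\varepsilon\le\varepsilon_0$ for some threshold $\varepsilon_0>0$ depending on them, the regularity $\sigma$ being fixed from the outset. *)

theory Defs
  imports "HOL-Analysis.Analysis"
begin

text \<open>
  The torus is the quotient of \<open>\<real>\<^sup>n\<close> by the integer lattice. Functions on it are represented by
  their lattice-periodic lifts, and points, curves and torus-valued maps by arbitrary lifts. Balls
  are open. A point of \<open>T\<^sup>n \<times> \<real>\<^sup>n\<close> is a pair \<open>(q, p)\<close>; a time-dependent function \<open>f\<close> is applied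
  as \<open>f (q, p) t\<close>. All norms take values in \<^typ>\<open>ennreal\<close>, so that suprema always exist.
\<close>

type_synonym 'n phase = "(real ^ 'n) \<times> (real ^ 'n)"

definition lattice :: "(real ^ 'n::finite) set" where
  "lattice = {z. \<forall>i. z $ i \<in> \<int>}"

definition periodic_in_q :: "(real ^ 'n::finite) set \<Rightarrow> ('n phase \<Rightarrow> 'b) \<Rightarrow> bool" where
  "periodic_in_q B f \<longleftrightarrow> (\<forall>q. \<forall>p\<in>B. \<forall>z\<in>lattice. f (q + z, p) = f (q, p))"

definition phase_dist :: "'n::finite phase \<Rightarrow> 'n phase \<Rightarrow> real" where
  "phase_dist x y = (INF z\<in>lattice. dist (x + (z, 0)) y)"

definition has_partial_at :: "'a::euclidean_space \<Rightarrow> ('a \<Rightarrow> real) \<Rightarrow> 'a \<Rightarrow> bool" where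
  "has_partial_at b f x \<longleftrightarrow> (\<lambda>s::real. f (x + s *\<^sub>R b)) differentiable (at 0)"

definition partial :: "'a::euclidean_space \<Rightarrow> ('a \<Rightarrow> real) \<Rightarrow> 'a \<Rightarrow> real" where
  "partial b f x = vector_derivative (\<lambda>s::real. f (x + s *\<^sub>R b)) (at 0)"

text \<open>
  Partial derivatives of order \<open>k\<close> are indexed by lists of \<open>k\<close> basis vectors instead of
  multi-indices; on \<open>C\<^sup>k\<close> functions the order of the list is irrelevant.
\<close>

definition partials :: "'a::euclidean_space list \<Rightarrow> ('a \<Rightarrow> real) \<Rightarrow> 'a \<Rightarrow> real" where
  "partials bs f = foldr partial bs f"

definition Ck_on :: "nat \<Rightarrow> 'a::euclidean_space set \<Rightarrow> ('a \<Rightarrow> real) \<Rightarrow> bool" where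
  "Ck_on k S f \<longleftrightarrow>
     (\<forall>bs \<in> lists Basis. length bs \<le> k \<longrightarrow> continuous_on S (partials bs f)) \<and>
     (\<forall>bs \<in> lists Basis. length bs < k \<longrightarrow>
        (\<forall>b\<in>Basis. \<forall>x\<in>S. has_partial_at b (partials bs f) x))"

definition sup_norm :: "'a set \<Rightarrow> ('a \<Rightarrow> real) \<Rightarrow> ennreal" where
  "sup_norm S f = (SUP x\<in>S. ennreal \<bar>f x\<bar>)"

definition holder_seminorm :: "real \<Rightarrow> 'a::metric_space set \<Rightarrow> ('a \<Rightarrow> real) \<Rightarrow> ennreal" where
  "holder_seminorm \<mu> S f =
     (SUP (x, y) \<in> {(x, y). x \<in> S \<and> y \<in> S \<and> x \<noteq> y}. ennreal (\<bar>f x - f y\<bar> / dist x y powr \<mu>))"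

text \<open>
  For a periodic lift, the quotients in \<^const>\<open>holder_seminorm\<close> have the same supremum as those
  formed with the distance of the torus, because the latter is attained by suitable lifts.
\<close>

definition holder_norm :: "real \<Rightarrow> 'a::euclidean_space set \<Rightarrow> ('a \<Rightarrow> real) \<Rightarrow> ennreal" where
  "holder_norm \<sigma> S f =
     (SUP bs \<in> {bs \<in> lists Basis. length bs \<le> nat \<lfloor>\<sigma>\<rfloor>}. sup_norm S (partials bs f)) +
     (if frac \<sigma> = 0 then 0
      else SUP bs \<in> {bs \<in> lists Basis. length bs = nat \<lfloor>\<sigma>\<rfloor>}.
             holder_seminorm (frac \<sigma>) S (partials bs f))"

definition holder_class :: "real \<Rightarrow> 'a::euclidean_space set \<Rightarrow> ('a \<Rightarrow> real) \<Rightarrow> bool" where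
  "holder_class \<sigma> S f \<longleftrightarrow> Ck_on (nat \<lfloor>\<sigma>\<rfloor>) S f \<and> holder_norm \<sigma> S f < \<infinity>"

definition holder_norm_vec ::
  "real \<Rightarrow> 'a::euclidean_space set \<Rightarrow> ('a \<Rightarrow> 'b::euclidean_space) \<Rightarrow> ennreal" where
  "holder_norm_vec \<sigma> S F = (SUP b\<in>Basis. holder_norm \<sigma> S (\<lambda>x. F x \<bullet> b))"

definition holder_class_vec ::
  "real \<Rightarrow> 'a::euclidean_space set \<Rightarrow> ('a \<Rightarrow> 'b::euclidean_space) \<Rightarrow> bool" where
  "holder_class_vec \<sigma> S F \<longleftrightarrow> (\<forall>b\<in>Basis. holder_class \<sigma> S (\<lambda>x. F x \<bullet> b))"

definition dq :: "'n::finite \<Rightarrow> ('n phase \<Rightarrow> real \<Rightarrow> real) \<Rightarrow> 'n phase \<Rightarrow> real \<Rightarrow> real" where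
  "dq i f x t = partial (axis i 1, 0) (\<lambda>y. f y t) x"

definition dp :: "'n::finite \<Rightarrow> ('n phase \<Rightarrow> real \<Rightarrow> real) \<Rightarrow> 'n phase \<Rightarrow> real \<Rightarrow> real" where
  "dp i f x t = partial (0, axis i 1) (\<lambda>y. f y t) x"

definition dqs :: "'n::finite list \<Rightarrow> ('n phase \<Rightarrow> real \<Rightarrow> real) \<Rightarrow> 'n phase \<Rightarrow> real \<Rightarrow> real" where
  "dqs is f = foldr dq is f"

definition p_differentiable ::
  "(real ^ 'n::finite) set \<Rightarrow> ('n phase \<Rightarrow> real \<Rightarrow> real) \<Rightarrow> bool" where
  "p_differentiable B f \<longleftrightarrow>
     (\<forall>i. \<forall>x \<in> UNIV \<times> B. \<forall>t. has_partial_at (0, axis i 1) (\<lambda>y. f y t) x)"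

definition jointly_continuous ::
  "(real ^ 'n::finite) set \<Rightarrow> ('n phase \<Rightarrow> real \<Rightarrow> real) \<Rightarrow> bool" where
  "jointly_continuous B f \<longleftrightarrow> continuous_on ((UNIV \<times> B) \<times> UNIV) (\<lambda>(x, t). f x t)"

definition B_space ::
  "(real ^ 'n::finite) set \<Rightarrow> real \<Rightarrow> ('n phase \<Rightarrow> real \<Rightarrow> real) set" where
  "B_space B \<sigma> = {f. (\<forall>t. periodic_in_q B (\<lambda>x. f x t)) \<and>
     p_differentiable B f \<and> jointly_continuous B f \<and> (\<forall>i. jointly_continuous B (dp i f)) \<and>
     (\<forall>p\<in>B. \<forall>t. holder_class \<sigma> UNIV (\<lambda>q. f (q, p) t))}"

text \<open>The case distinction restores \<open>0\<^sup>0 = 1\<close>, which fails for \<^const>\<open>powr\<close>.\<close>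

definition weight :: "real \<Rightarrow> real \<Rightarrow> ennreal" where
  "weight a t = ennreal (1 + (if a = 0 then 1 else \<bar>t\<bar> powr a))"

definition B_norm ::
  "(real ^ 'n::finite) set \<Rightarrow> real \<Rightarrow> real \<Rightarrow> ('n phase \<Rightarrow> real \<Rightarrow> real) \<Rightarrow> ennreal" where
  "B_norm B \<sigma> l f =
     (SUP (p, t) \<in> B \<times> UNIV. holder_norm \<sigma> UNIV (\<lambda>q. f (q, p) t) * weight l t) +
     (SUP (p, t) \<in> B \<times> UNIV. (SUP i. sup_norm UNIV (\<lambda>q. dp i f (q, p) t)) * weight (l - 1) t)"

text \<open>The norm with \<open>l = 0\<close> carries no weights; it is not an instance of \<^const>\<open>B_norm\<close>.\<close>

definition B_norm0 ::
  "(real ^ 'n::finite) set \<Rightarrow> real \<Rightarrow> ('n phase \<Rightarrow> real \<Rightarrow> real) \<Rightarrow> ennreal" where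
  "B_norm0 B \<sigma> f =
     (SUP (p, t) \<in> B \<times> UNIV. holder_norm \<sigma> UNIV (\<lambda>q. f (q, p) t)) +
     (SUP (p, t) \<in> B \<times> UNIV. SUP i. sup_norm UNIV (\<lambda>q. dp i f (q, p) t))"

definition Bbar_space ::
  "(real ^ 'n::finite) set \<Rightarrow> real \<Rightarrow> nat \<Rightarrow> ('n phase \<Rightarrow> real \<Rightarrow> real) set" where
  "Bbar_space B \<sigma> k =
     {f. \<forall>is. length is \<le> k \<longrightarrow> dqs is f \<in> B_space B (\<sigma> + real k - real (length is))}"

definition Bbar_norm ::
  "(real ^ 'n::finite) set \<Rightarrow> real \<Rightarrow> nat \<Rightarrow> real \<Rightarrow> ('n phase \<Rightarrow> real \<Rightarrow> real) \<Rightarrow> ennreal" where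
  "Bbar_norm B \<sigma> k l f =
     (SUP is \<in> {is. length is \<le> k}. B_norm B (\<sigma> + real k - real (length is)) l (dqs is f))"

text \<open>\<open>C\<^sup>1\<close> regularity at every time is what makes the Hamiltonian vector field meaningful.\<close>

definition td_hamiltonian ::
  "(real ^ 'n::finite) set \<Rightarrow> ('n phase \<Rightarrow> real \<Rightarrow> real) \<Rightarrow> bool" where
  "td_hamiltonian B H \<longleftrightarrow>
     (\<forall>t. periodic_in_q B (\<lambda>x. H x t) \<and> Ck_on 1 (UNIV \<times> B) (\<lambda>x. H x t))"

definition ham_vf :: "('n::finite phase \<Rightarrow> real \<Rightarrow> real) \<Rightarrow> 'n phase \<Rightarrow> real \<Rightarrow> 'n phase" where
  "ham_vf H x t = ((\<chi> i. dp i H x t), (\<chi> i. - dq i H x t))"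

definition td_vector_field ::
  "(real ^ 'n::finite) set \<Rightarrow> real \<Rightarrow> ('n phase \<Rightarrow> real \<Rightarrow> 'n phase) \<Rightarrow> bool" where
  "td_vector_field B s X \<longleftrightarrow>
     (\<forall>t. periodic_in_q B (\<lambda>x. X x t) \<and> holder_class_vec s (UNIV \<times> B) (\<lambda>x. X x t))"

text \<open>
  An embedding of the torus into \<open>T\<^sup>n \<times> B\<close>, given by a lift: it descends to the quotients, is
  injective there and is an immersion (compactness makes it a homeomorphism onto its image). The
  angle component of the lift is unbounded, hence \<open>C\<^sup>\<sigma>\<close> regularity is required on bounded sets only.
\<close>

definition torus_embedding ::
  "(real ^ 'n::finite) set \<Rightarrow> real \<Rightarrow> (real ^ 'n \<Rightarrow> 'n phase) \<Rightarrow> bool" where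
  "torus_embedding B \<sigma> \<phi> \<longleftrightarrow>
     (\<forall>q. snd (\<phi> q) \<in> B) \<and>
     (\<forall>q. \<forall>z\<in>lattice. \<exists>w\<in>lattice. \<phi> (q + z) = \<phi> q + (w, 0)) \<and>
     (\<forall>q q'. \<forall>w\<in>lattice. \<phi> q' = \<phi> q + (w, 0) \<longrightarrow> q' - q \<in> lattice) \<and>
     (\<forall>r>0. holder_class_vec \<sigma> (ball 0 r) \<phi>) \<and>
     (\<forall>q. \<phi> differentiable (at q) \<and> inj (frechet_derivative \<phi> (at q)))"

definition biasymptotic_setting ::
  "(real ^ 'n::finite) set \<Rightarrow> real \<Rightarrow> nat \<Rightarrow> ('n phase \<Rightarrow> real \<Rightarrow> 'n phase) \<Rightarrow>
   ('n phase \<Rightarrow> real \<Rightarrow> 'n phase) \<Rightarrow> ('n phase \<Rightarrow> real \<Rightarrow> 'n phase) \<Rightarrow>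
   (real ^ 'n \<Rightarrow> 'n phase) \<Rightarrow> (real ^ 'n \<Rightarrow> 'n phase) \<Rightarrow> real ^ 'n \<Rightarrow> real ^ 'n \<Rightarrow> bool" where
  "biasymptotic_setting B \<sigma> k X Xp Xm \<phi>p \<phi>m \<omega>p \<omega>m \<longleftrightarrow>
     td_vector_field B (\<sigma> + real k) X \<and>
     td_vector_field B (\<sigma> + real k) Xp \<and> td_vector_field B (\<sigma> + real k) Xm \<and>
     torus_embedding B \<sigma> \<phi>p \<and> torus_embedding B \<sigma> \<phi>m \<and>
     ((\<lambda>t. holder_norm_vec (\<sigma> + real k) (UNIV \<times> B) (\<lambda>x. X x t - Xp x t)) \<longlongrightarrow> 0) at_top \<and>
     ((\<lambda>t. holder_norm_vec (\<sigma> + real k) (UNIV \<times> B) (\<lambda>x. X x t - Xm x t)) \<longlongrightarrow> 0) at_bot \<and>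
     (\<forall>q t. Xp (\<phi>p q) t = frechet_derivative \<phi>p (at q) \<omega>p) \<and>
     (\<forall>q t. Xm (\<phi>m q) t = frechet_derivative \<phi>m (at q) \<omega>m)"

definition integral_curve ::
  "(real ^ 'n::finite) set \<Rightarrow> ('n phase \<Rightarrow> real \<Rightarrow> 'n phase) \<Rightarrow> (real \<Rightarrow> 'n phase) \<Rightarrow> bool" where
  "integral_curve B X g \<longleftrightarrow>
     (\<forall>t. g t \<in> UNIV \<times> B \<and> (g has_vector_derivative X (g t) t) (at t))"

definition biasymptotically_quasiperiodic ::
  "(real ^ 'n::finite) set \<Rightarrow> real \<Rightarrow> nat \<Rightarrow> ('n phase \<Rightarrow> real \<Rightarrow> 'n phase) \<Rightarrow>
   ('n phase \<Rightarrow> real \<Rightarrow> 'n phase) \<Rightarrow> ('n phase \<Rightarrow> real \<Rightarrow> 'n phase) \<Rightarrow>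
   (real ^ 'n \<Rightarrow> 'n phase) \<Rightarrow> (real ^ 'n \<Rightarrow> 'n phase) \<Rightarrow> (real \<Rightarrow> 'n phase) \<Rightarrow> bool" where
  "biasymptotically_quasiperiodic B \<sigma> k X Xp Xm \<phi>p \<phi>m g \<longleftrightarrow>
     (\<exists>\<omega>p \<omega>m. biasymptotic_setting B \<sigma> k X Xp Xm \<phi>p \<phi>m \<omega>p \<omega>m \<and> integral_curve B X g \<and>
        (\<exists>qp qm.
           ((\<lambda>t. phase_dist (g t) (\<phi>p (qp + t *\<^sub>R \<omega>p))) \<longlongrightarrow> 0) at_top \<and>
           ((\<lambda>t. phase_dist (g t) (\<phi>m (qm + t *\<^sub>R \<omega>m))) \<longlongrightarrow> 0) at_bot))"

definition trivial_embedding :: "real ^ 'n::finite \<Rightarrow> real ^ 'n \<Rightarrow> 'n phase" where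
  "trivial_embedding p q = (q, p)"

definition grad_C1_norm :: "(real ^ 'n::finite \<Rightarrow> real) \<Rightarrow> ennreal" where
  "grad_C1_norm h = (SUP i. holder_norm 1 (ball 0 1) (partial (axis i 1) h))"

definition hess_regular :: "real \<Rightarrow> ('n::finite phase \<Rightarrow> real \<Rightarrow> real) \<Rightarrow> bool" where
  "hess_regular \<sigma> H \<longleftrightarrow>
     p_differentiable (ball 0 1) H \<and> (\<forall>i. p_differentiable (ball 0 1) (dp i H)) \<and>
     (\<forall>i j t. holder_class (\<sigma> + 2) (UNIV \<times> ball 0 1) (\<lambda>x. dp i (dp j H) x t)) \<and>
     (\<forall>i j. \<forall>bs \<in> lists Basis. length bs \<le> 3 \<longrightarrow>
        jointly_continuous (ball 0 1) (\<lambda>x t. partials bs (\<lambda>y. dp i (dp j H) y t) x))"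

definition admissible ::
  "real \<Rightarrow> real \<Rightarrow> real \<Rightarrow> real \<Rightarrow> (real ^ 'n::finite \<Rightarrow> real) \<Rightarrow>
   ('n phase \<Rightarrow> real \<Rightarrow> real) \<Rightarrow> ('n phase \<Rightarrow> real \<Rightarrow> real) \<Rightarrow> bool" where
  "admissible \<sigma> \<Upsilon> l \<epsilon> h f H \<longleftrightarrow>
     (\<forall>q. \<forall>p \<in> ball 0 1. \<forall>t. H (q, p) t = h p + f (q, p) t) \<and>
     f \<in> Bbar_space (ball 0 1) \<sigma> 2 \<and> (\<forall>i. dp i f \<in> Bbar_space (ball 0 1) \<sigma> 2) \<and>
     B_norm0 (ball 0 1) (\<sigma> + 2) f +
       (SUP i. Bbar_norm (ball 0 1) \<sigma> 1 (l + 2) (dq i f)) +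
       (SUP i. Bbar_norm (ball 0 1) \<sigma> 2 (l + 1) (dp i f)) < ennreal \<epsilon> \<and>
     hess_regular \<sigma> H \<and>
     (SUP t. SUP (i, j) \<in> UNIV.
        holder_norm (\<sigma> + 2) (UNIV \<times> ball 0 1) (\<lambda>x. dp i (dp j H) x t)) \<le> ennreal \<Upsilon>"

end

theory Submission
  imports Defs
begin

text \<open>
  The Hamiltonian \<open>h'\<close> can be taken to be \<open>h\<close> itself, and every orbit that starts in \<open>\<bar>p\<bar> < 1/2\<close>
  scatters: it is asymptotic to an orbit of \<open>h\<close> in the past and to one in the future. No invariant
  tori have to be constructed, because each torus \<open>p = const\<close> is invariant for \<open>h\<close>.

  The dynamical half is elementary. The force \<open>- \<partial>\<^sub>q f\<close> is at most \<open>\<epsilon> / (1 + \<bar>t\<bar>\<^sup>l\<^sup>+\<^sup>2)\<close> in each component,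
  so for small \<open>\<epsilon>\<close> the momentum never departs from its initial value by more than \<open>1/4\<close>. The orbit stays in
  \<open>\<bar>p\<bar> \<le> 3/4\<close>, where the field is Lipschitz, hence it is global (\<open>integral_curve_exists\<close>), and \<open>p\<close>
  converges to limits \<open>p\<^sub>\<plusminus>\<close> at the rate \<open>t\<^sup>-\<^sup>2\<close>. The velocity is \<open>\<partial>\<^sub>p h(p) + \<partial>\<^sub>p f\<close>, which differs from
  \<open>\<omega>\<^sub>\<plusminus> = \<partial>\<^sub>p h(p\<^sub>\<plusminus>)\<close> by an integrable function, so that \<open>q - t \<omega>\<^sub>\<plusminus>\<close> converges too
  (\<open>asymptotic_line\<close>).

  The other half is to show that both vector fields are of class \<open>C\<^sup>\<sigma>\<close> in \<open>(q, p)\<close> and that their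
  difference \<open>(\<partial>\<^sub>p f, - \<partial>\<^sub>q f)\<close> tends to \<open>0\<close> in \<open>C\<^sup>\<sigma>\<close>. The weighted norms only control \<open>q\<close>-derivatives, at
  most one \<open>p\<close>-derivative of these, and the supremum of \<open>\<partial>\<^sub>p\<^sup>2 f\<close>. The missing derivatives are found by
  interpolation (\<open>uniform_limit_Ck_bounded\<close>): as \<open>t \<rightarrow> \<plusminus>\<infinity>\<close>, the functions \<open>\<partial>\<^sub>p\<^sup>2 H\<^sup>t\<close>, bounded in \<open>C\<^sup>\<sigma>\<^sup>+\<^sup>2\<close>,
  converge uniformly to \<open>\<partial>\<^sub>p\<^sup>2 h\<close>; therefore \<open>h\<close> is smooth enough and \<open>\<partial>\<^sub>p\<^sup>2 f\<^sup>t\<close> tends to \<open>0\<close> together with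
  all derivatives of order up to \<open>\<lfloor>\<sigma>\<rfloor> + 1\<close>. Interchanging mixed derivatives (\<open>mixed_partials\<close>) turns
  regularity in \<open>q\<close> for fixed \<open>p\<close> and regularity of the \<open>p\<close>-derivatives into joint regularity
  (\<open>Ck_on_of_slices\<close>, \<open>Ck_bounded_of_slices\<close>), and a function with \<open>\<lfloor>\<sigma>\<rfloor> + 1\<close> small derivatives is
  small in \<open>C\<^sup>\<sigma>\<close> (\<open>holder_norm_le_Ck_bounded\<close>).
\<close>

section \<open>Partial derivatives\<close>

lemma has_partial_at_iff:
  "has_partial_at b f x \<longleftrightarrow>
     ((\<lambda>s. f (x + s *\<^sub>R b)) has_real_derivative partial b f x) (at 0)"
  unfolding has_partial_at_def partial_def has_real_derivative_iff_has_vector_derivative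
  by (rule vector_derivative_works)

lemma partial_eqI:
  assumes "((\<lambda>s. f (x + s *\<^sub>R b)) has_real_derivative D) (at 0)"
  shows "has_partial_at b f x" "partial b f x = D"
proof -
  show "partial b f x = D"
    using assms unfolding partial_def has_real_derivative_iff_has_vector_derivative
    by (rule vector_derivative_at)
  then show "has_partial_at b f x"
    using assms by (simp add: has_partial_at_iff)
qed

lemma has_partial_at_line:
  assumes "has_partial_at b f (x + r *\<^sub>R b)"
  shows "((\<lambda>s. f (x + s *\<^sub>R b)) has_real_derivative partial b f (x + r *\<^sub>R b)) (at r)"
proof -
  have "((\<lambda>s. f (x + (s + r) *\<^sub>R b)) has_real_derivative partial b f (x + r *\<^sub>R b)) (at 0)"
    using assms by (simp add: has_partial_at_iff algebra_simps)
  then show ?thesis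
    using DERIV_shift[of "\<lambda>s. f (x + s *\<^sub>R b)" _ 0 r] by simp
qed

lemma eventually_line_in_open:
  fixes S :: "'a::real_normed_vector set"
  assumes "open S" "x \<in> S"
  shows "\<forall>\<^sub>F s in nhds 0. x + s *\<^sub>R b \<in> S"
proof -
  have "((\<lambda>s::real. x + s *\<^sub>R b) \<longlongrightarrow> x + 0 *\<^sub>R b) (nhds 0)"
    by (intro tendsto_intros filterlim_ident)
  then show ?thesis
    using topological_tendstoD[of _ x "nhds 0" S] assms by simp
qed

lemma partial_cong_open:
  assumes "open S" "x \<in> S" "\<And>y. y \<in> S \<Longrightarrow> f y = g y"
  shows "has_partial_at b f x \<longleftrightarrow> has_partial_at b g x" "partial b f x = partial b g x"
proof -
  have ev: "\<forall>\<^sub>F s in nhds 0. f (x + s *\<^sub>R b) = g (x + s *\<^sub>R b)"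
    using eventually_line_in_open[OF assms(1,2)] by eventually_elim (rule assms(3))
  have *: "((\<lambda>s. f (x + s *\<^sub>R b)) has_real_derivative D) (at 0) \<longleftrightarrow>
      ((\<lambda>s. g (x + s *\<^sub>R b)) has_real_derivative D) (at 0)" for D
    using DERIV_cong_ev[OF refl ev refl] .
  show "partial b f x = partial b g x"
    using * by (simp add: partial_def vector_derivative_def
        has_real_derivative_iff_has_vector_derivative)
  then show "has_partial_at b f x \<longleftrightarrow> has_partial_at b g x"
    using * by (simp add: has_partial_at_iff)
qed

lemma partial_lincomb:
  assumes "has_partial_at b f x" "has_partial_at b g x"
  shows "has_partial_at b (\<lambda>y. f y + c * g y) x"
    "partial b (\<lambda>y. f y + c * g y) x = partial b f x + c * partial b g x"
proof -
  have "((\<lambda>s. f (x + s *\<^sub>R b) + c * g (x + s *\<^sub>R b)) has_real_derivative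
      partial b f x + c * partial b g x) (at 0)"
    using assms unfolding has_partial_at_iff by (intro DERIV_add DERIV_cmult)
  from partial_eqI[of "\<lambda>y. f y + c * g y", OF this]
  show "has_partial_at b (\<lambda>y. f y + c * g y) x"
    "partial b (\<lambda>y. f y + c * g y) x = partial b f x + c * partial b g x" by auto
qed

lemma partial_diff:
  assumes "has_partial_at b f x" "has_partial_at b g x"
  shows "has_partial_at b (\<lambda>y. f y - g y) x"
    "partial b (\<lambda>y. f y - g y) x = partial b f x - partial b g x"
proof -
  have "((\<lambda>s. f (x + s *\<^sub>R b) - g (x + s *\<^sub>R b)) has_real_derivative
      partial b f x - partial b g x) (at 0)"
    using assms unfolding has_partial_at_iff by (rule DERIV_diff)
  from partial_eqI[of "\<lambda>y. f y - g y", OF this]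
  show "has_partial_at b (\<lambda>y. f y - g y) x"
    "partial b (\<lambda>y. f y - g y) x = partial b f x - partial b g x" by auto
qed

lemma partial_const: "has_partial_at b (\<lambda>y. c) x" "partial b (\<lambda>y. c) x = 0"
  using partial_eqI[of "\<lambda>y. c" x b 0] by auto

lemma partial_mvt:
  assumes "\<And>\<theta>. \<bar>\<theta>\<bar> \<le> \<bar>s\<bar> \<Longrightarrow> has_partial_at b f (x + \<theta> *\<^sub>R b)"
  obtains \<theta> where "\<bar>\<theta>\<bar> \<le> \<bar>s\<bar>" "f (x + s *\<^sub>R b) - f x = s * partial b f (x + \<theta> *\<^sub>R b)"
proof -
  consider "s = 0" | "s > 0" | "s < 0" by linarith
  then show ?thesis
  proof cases
    case 1
    then show ?thesis using that[of 0] by simp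
  next
    case 2
    obtain \<theta> where "0 < \<theta>" "\<theta> < s"
      "f (x + s *\<^sub>R b) - f (x + 0 *\<^sub>R b) = (s - 0) * partial b f (x + \<theta> *\<^sub>R b)"
      using MVT2[of 0 s "\<lambda>r. f (x + r *\<^sub>R b)" "\<lambda>r. partial b f (x + r *\<^sub>R b)"] 2 assms
        has_partial_at_line[of b f x] by auto
    then show ?thesis using that[of \<theta>] by auto
  next
    case 3
    obtain \<theta> where "s < \<theta>" "\<theta> < 0"
      "f (x + 0 *\<^sub>R b) - f (x + s *\<^sub>R b) = (0 - s) * partial b f (x + \<theta> *\<^sub>R b)"
      using MVT2[of s 0 "\<lambda>r. f (x + r *\<^sub>R b)" "\<lambda>r. partial b f (x + r *\<^sub>R b)"] 3 assms
        has_partial_at_line[of b f x] by auto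
    then show ?thesis using that[of \<theta>] by auto
  qed
qed

text \<open>
  The increment is split into moves along one coordinate at a time, to each of which the mean value
  theorem applies; all intermediate points stay within the \<open>l\<^sup>1\<close>-length of the path. Taking for \<open>c\<close>
  the gradient at a point yields differentiability there, and \<open>c = 0\<close> yields a Lipschitz bound.
\<close>

lemma increment_along_coordinates:
  fixes f :: "'a::euclidean_space \<Rightarrow> real"
  assumes "finite B" "B \<subseteq> Basis"
    and "\<And>b z. b \<in> B \<Longrightarrow> norm (z - y) \<le> (\<Sum>b\<in>B. \<bar>v b\<bar>) \<Longrightarrow>
           has_partial_at b f z \<and> \<bar>partial b f z - c b\<bar> \<le> e"
  shows "\<bar>f (y + (\<Sum>b\<in>B. v b *\<^sub>R b)) - f y - (\<Sum>b\<in>B. v b * c b)\<bar> \<le> e * (\<Sum>b\<in>B. \<bar>v b\<bar>)"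
  using assms
proof (induction B arbitrary: y rule: finite_induct)
  case empty
  then show ?case by simp
next
  case (insert b B)
  have nb: "norm b = 1" using insert.prems(1) by simp
  define y' where "y' = y + v b *\<^sub>R b"
  have IH: "\<bar>f (y' + (\<Sum>b\<in>B. v b *\<^sub>R b)) - f y' - (\<Sum>b\<in>B. v b * c b)\<bar> \<le> e * (\<Sum>b\<in>B. \<bar>v b\<bar>)"
  proof (rule insert.IH)
    show "B \<subseteq> Basis" using insert.prems by simp
    fix d z assume "d \<in> B" and z: "norm (z - y') \<le> (\<Sum>b\<in>B. \<bar>v b\<bar>)"
    have "norm (z - y) \<le> norm (z - y') + norm (v b *\<^sub>R b)"
      unfolding y'_def using norm_triangle_ineq[of "z - (y + v b *\<^sub>R b)" "v b *\<^sub>R b"] by simp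
    also have "\<dots> \<le> (\<Sum>b\<in>insert b B. \<bar>v b\<bar>)"
      using z nb insert.hyps by simp
    finally show "has_partial_at d f z \<and> \<bar>partial d f z - c d\<bar> \<le> e"
      using insert.prems(2) \<open>d \<in> B\<close> by blast
  qed
  have near: "norm (y + \<theta> *\<^sub>R b - y) \<le> (\<Sum>b\<in>insert b B. \<bar>v b\<bar>)" if "\<bar>\<theta>\<bar> \<le> \<bar>v b\<bar>" for \<theta>
  proof -
    have "norm (y + \<theta> *\<^sub>R b - y) \<le> \<bar>v b\<bar>" using that nb by simp
    also have "\<dots> \<le> (\<Sum>b\<in>insert b B. \<bar>v b\<bar>)"
      using insert.hyps by (simp add: sum_nonneg)
    finally show ?thesis .
  qed
  obtain \<theta> where \<theta>: "\<bar>\<theta>\<bar> \<le> \<bar>v b\<bar>" "f y' - f y = v b * partial b f (y + \<theta> *\<^sub>R b)"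
    unfolding y'_def using partial_mvt[of "v b" b f y] near insert.prems(2)[of b] by blast
  have "\<bar>f y' - f y - v b * c b\<bar> = \<bar>v b\<bar> * \<bar>partial b f (y + \<theta> *\<^sub>R b) - c b\<bar>"
    using \<theta>(2) by (simp add: abs_mult[symmetric] algebra_simps)
  also have "\<dots> \<le> \<bar>v b\<bar> * e"
    using insert.prems(2)[of b] near[OF \<theta>(1)] by (intro mult_left_mono) auto
  finally have "\<bar>f y' - f y - v b * c b\<bar> \<le> e * \<bar>v b\<bar>" by (simp add: mult.commute)
  moreover have "y' + (\<Sum>b\<in>B. v b *\<^sub>R b) = y + (\<Sum>b\<in>insert b B. v b *\<^sub>R b)"
    using insert.hyps by (simp add: y'_def)
  ultimately show ?case
    using IH insert.hyps by (simp add: algebra_simps)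
qed

lemma has_derivative_of_continuous_partials:
  fixes f :: "'a::euclidean_space \<Rightarrow> real"
  assumes S: "open S" "x \<in> S"
    and ex: "\<And>b y. b \<in> Basis \<Longrightarrow> y \<in> S \<Longrightarrow> has_partial_at b f y"
    and cont: "\<And>b. b \<in> Basis \<Longrightarrow> continuous_on S (partial b f)"
  shows "(f has_derivative (\<lambda>v. \<Sum>b\<in>Basis. (v \<bullet> b) * partial b f x)) (at x)"
  unfolding has_derivative_at_within
proof (intro conjI)
  show "bounded_linear (\<lambda>v. \<Sum>b\<in>Basis. (v \<bullet> b) * partial b f x)"
    by (intro bounded_linear_intros bounded_linear_inner_left)
  define n where "n = real DIM('a)"
  have n: "n > 0" by (simp add: n_def)
  have "((\<lambda>y. norm (f y - f x - (\<Sum>b\<in>Basis. ((y - x) \<bullet> b) * partial b f x)) / norm (y - x)) \<longlongrightarrow> 0) (at x)"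
  proof (rule tendstoI)
    fix e :: real assume e: "e > 0"
    define e' where "e' = e / (2 * n)"
    have e': "e' > 0" using e n by (simp add: e'_def)
    have "\<forall>b\<in>Basis. \<forall>\<^sub>F z in nhds x. z \<in> S \<and> \<bar>partial b f z - partial b f x\<bar> < e'"
    proof
      fix b :: 'a assume b: "b \<in> Basis"
      have "isCont (partial b f) x"
        using cont[OF b] S continuous_on_eq_continuous_at by blast
      then have "\<forall>\<^sub>F z in nhds x. dist (partial b f z) (partial b f x) < e'"
        using e' by (auto simp: isCont_def tendsto_at_iff_tendsto_nhds dest: tendstoD)
      then show "\<forall>\<^sub>F z in nhds x. z \<in> S \<and> \<bar>partial b f z - partial b f x\<bar> < e'"
        using eventually_nhds_in_open[OF S] by eventually_elim (simp add: dist_real_def)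
    qed
    then have "\<forall>\<^sub>F z in nhds x. \<forall>b\<in>Basis. z \<in> S \<and> \<bar>partial b f z - partial b f x\<bar> < e'"
      by (simp add: eventually_ball_finite_distrib)
    then obtain d where d: "d > 0"
      and near: "\<And>z b. b \<in> Basis \<Longrightarrow> dist z x < d \<Longrightarrow> z \<in> S \<and> \<bar>partial b f z - partial b f x\<bar> < e'"
      unfolding eventually_nhds_metric by blast
    have "\<forall>\<^sub>F y in at x. dist y x < d / n"
      using d n by (intro eventually_at_ball[unfolded mem_ball, THEN eventually_mono])
        (auto simp: dist_commute)
    moreover have "\<forall>\<^sub>F y in at x. y \<noteq> x" by (simp add: eventually_neq_at_within)
    ultimately show "\<forall>\<^sub>F y in at x.
        dist (norm (f y - f x - (\<Sum>b\<in>Basis. ((y - x) \<bullet> b) * partial b f x)) / norm (y - x)) 0 < e"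
    proof eventually_elim
      case (elim y)
      have l1: "(\<Sum>b\<in>Basis. \<bar>(y - x) \<bullet> b\<bar>) \<le> n * norm (y - x)"
        using sum_bounded_above[of Basis "\<lambda>b. \<bar>(y - x) \<bullet> b\<bar>" "norm (y - x)"]
        by (simp add: n_def Basis_le_norm)
      have "\<bar>f (x + (\<Sum>b\<in>Basis. ((y - x) \<bullet> b) *\<^sub>R b)) - f x -
          (\<Sum>b\<in>Basis. ((y - x) \<bullet> b) * partial b f x)\<bar> \<le> e' * (\<Sum>b\<in>Basis. \<bar>(y - x) \<bullet> b\<bar>)"
      proof (rule increment_along_coordinates)
        fix b z :: 'a
        assume b: "b \<in> Basis" and "norm (z - x) \<le> (\<Sum>b\<in>Basis. \<bar>(y - x) \<bullet> b\<bar>)"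
        then have "norm (z - x) \<le> n * norm (y - x)" using l1 by linarith
        also have "\<dots> < d" using elim(1) n by (simp add: dist_norm field_simps)
        finally have "dist z x < d" by (simp add: dist_norm)
        then show "has_partial_at b f z \<and> \<bar>partial b f z - partial b f x\<bar> \<le> e'"
          using near[OF b] ex[OF b] by (simp add: less_imp_le)
      qed auto
      then have "\<bar>f y - f x - (\<Sum>b\<in>Basis. ((y - x) \<bullet> b) * partial b f x)\<bar> \<le> e' * (n * norm (y - x))"
        using l1 e' by (simp add: euclidean_representation)
          (meson dual_order.trans l1 mult_left_mono less_imp_le)
      also have "\<dots> = (e / 2) * norm (y - x)" using n by (simp add: e'_def)
      finally have "\<bar>f y - f x - (\<Sum>b\<in>Basis. ((y - x) \<bullet> b) * partial b f x)\<bar> / norm (y - x) \<le> e / 2"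
        using elim(2) by (simp add: field_simps)
      moreover have *: "dist (norm u / norm v) 0 = \<bar>u\<bar> / norm v" for u :: real and v :: 'a
        by simp
      ultimately show ?case unfolding * using e by linarith
    qed
  qed
  then show "((\<lambda>y. (f y - f x - (\<Sum>b\<in>Basis. ((y - x) \<bullet> b) * partial b f x)) /\<^sub>R norm (y - x)) \<longlongrightarrow> 0) (at x)"
    by (subst tendsto_norm_zero_iff[symmetric]) (simp add: divide_inverse abs_mult mult.commute)
qed

lemma lipschitz_of_bounded_partials:
  fixes f :: "'a::euclidean_space \<Rightarrow> real"
  assumes S: "open S" "convex S" "x \<in> S" "y \<in> S"
    and ex: "\<And>b y. b \<in> Basis \<Longrightarrow> y \<in> S \<Longrightarrow> has_partial_at b f y"
    and cont: "\<And>b. b \<in> Basis \<Longrightarrow> continuous_on S (partial b f)"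
    and bd: "\<And>b y. b \<in> Basis \<Longrightarrow> y \<in> S \<Longrightarrow> \<bar>partial b f y\<bar> \<le> A"
  shows "\<bar>f x - f y\<bar> \<le> real DIM('a) * A * dist x y"
proof -
  have "norm (f x - f y) \<le> (real DIM('a) * A) * norm (x - y)"
  proof (rule differentiable_bound[where S = S and f = f])
    fix z assume z: "z \<in> S"
    show "(f has_derivative (\<lambda>v. \<Sum>b\<in>Basis. (v \<bullet> b) * partial b f z)) (at z within S)"
      by (rule has_derivative_at_withinI,
          rule has_derivative_of_continuous_partials[OF S(1) z ex cont])
    show "onorm (\<lambda>v. \<Sum>b\<in>Basis. (v \<bullet> b) * partial b f z) \<le> real DIM('a) * A"
    proof (rule onorm_le)
      fix v :: 'a
      have "norm (\<Sum>b\<in>Basis. (v \<bullet> b) * partial b f z) \<le> (\<Sum>b\<in>Basis. norm ((v \<bullet> b) * partial b f z))"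
        by (rule norm_sum)
      also have "\<dots> \<le> of_nat (card (Basis :: 'a set)) * (norm v * A)"
      proof (rule sum_bounded_above)
        fix b :: 'a assume "b \<in> Basis"
        then have "\<bar>v \<bullet> b\<bar> * \<bar>partial b f z\<bar> \<le> norm v * A"
          using bd[OF _ z] by (intro mult_mono Basis_le_norm) auto
        then show "norm ((v \<bullet> b) * partial b f z) \<le> norm v * A" by (simp add: abs_mult)
      qed
      finally show "norm (\<Sum>b\<in>Basis. (v \<bullet> b) * partial b f z) \<le> real DIM('a) * A * norm v"
        by (simp add: mult_ac)
    qed
  qed (use S in auto)
  then show ?thesis by (simp add: dist_norm)
qed

text \<open>
  Only one of the two mixed derivatives is assumed to exist: the second difference of \<open>g\<close> over a
  small parallelogram is, by two applications of the mean value theorem, a value of that derivative,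
  and letting one side of the parallelogram shrink produces the difference quotients of the other.
\<close>

lemma mixed_partials:
  fixes g :: "'a::euclidean_space \<Rightarrow> real"
  assumes S: "open S" "x \<in> S"
    and a: "\<And>y. y \<in> S \<Longrightarrow> has_partial_at a g y"
    and b: "\<And>y. y \<in> S \<Longrightarrow> has_partial_at b g y"
    and ba: "\<And>y. y \<in> S \<Longrightarrow> has_partial_at b (partial a g) y"
    and cont: "continuous_on S (partial b (partial a g))"
  shows "has_partial_at a (partial b g) x" "partial a (partial b g) x = partial b (partial a g) x"
proof -
  define W where "W = partial b (partial a g)"
  have "((\<lambda>s. partial b g (x + s *\<^sub>R a)) has_real_derivative W x) (at 0)"
    unfolding DERIV_def
  proof (rule tendstoI)
    fix e :: real assume e: "e > 0"
    have "isCont W x" using cont S continuous_on_eq_continuous_at unfolding W_def by blast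
    moreover have "((\<lambda>u. x + fst u *\<^sub>R a + snd u *\<^sub>R b) \<longlongrightarrow> x + fst (0::real \<times> real) *\<^sub>R a + snd (0::real\<times>real) *\<^sub>R b) (nhds 0)"
      by (intro tendsto_intros filterlim_ident)
    ultimately have lim: "((\<lambda>u::real \<times> real. W (x + fst u *\<^sub>R a + snd u *\<^sub>R b)) \<longlongrightarrow> W x) (nhds 0)"
      and lim': "((\<lambda>u::real \<times> real. x + fst u *\<^sub>R a + snd u *\<^sub>R b) \<longlongrightarrow> x) (nhds 0)"
      by (auto intro: isCont_tendsto_compose)
    have "\<forall>\<^sub>F u in nhds (0::real \<times> real). dist (W (x + fst u *\<^sub>R a + snd u *\<^sub>R b)) (W x) < e / 2 \<and>
        x + fst u *\<^sub>R a + snd u *\<^sub>R b \<in> S"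
      using tendstoD[OF lim, of "e/2"] topological_tendstoD[OF lim' S] e
      by (simp add: eventually_conj)
    then obtain d where d: "d > 0" and near: "\<And>u :: real \<times> real. dist u 0 < d \<Longrightarrow>
        dist (W (x + fst u *\<^sub>R a + snd u *\<^sub>R b)) (W x) < e / 2 \<and> x + fst u *\<^sub>R a + snd u *\<^sub>R b \<in> S"
      unfolding eventually_nhds_metric by blast
    have box: "\<bar>W (x + s *\<^sub>R a + r *\<^sub>R b) - W x\<bar> < e / 2" "x + s *\<^sub>R a + r *\<^sub>R b \<in> S"
      if "\<bar>s\<bar> < d/2" "\<bar>r\<bar> < d/2" for s r
    proof -
      have "dist (s, r) 0 < d"
        using norm_Pair_le[of s r] that by (simp add: dist_norm)
      from near[OF this] show "\<bar>W (x + s *\<^sub>R a + r *\<^sub>R b) - W x\<bar> < e / 2" "x + s *\<^sub>R a + r *\<^sub>R b \<in> S"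
        by (auto simp: dist_real_def)
    qed
    have quot: "\<bar>(g (x + s *\<^sub>R a + r *\<^sub>R b) - g (x + s *\<^sub>R a) - (g (x + r *\<^sub>R b) - g x)) / r / s - W x\<bar> \<le> e / 2"
      if sr: "\<bar>s\<bar> < d/2" "\<bar>r\<bar> < d/2" "s \<noteq> 0" "r \<noteq> 0" for s r
    proof -
      have shift: "x + r *\<^sub>R b + \<theta> *\<^sub>R a = x + \<theta> *\<^sub>R a + r *\<^sub>R b" for \<theta> by simp
      have diffa: "has_partial_at a (\<lambda>y. g (y + r *\<^sub>R b)) (x + \<theta> *\<^sub>R a)"
        "partial a (\<lambda>y. g (y + r *\<^sub>R b)) (x + \<theta> *\<^sub>R a) = partial a g (x + \<theta> *\<^sub>R a + r *\<^sub>R b)"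
        if "\<bar>\<theta>\<bar> \<le> \<bar>s\<bar>" for \<theta>
      proof -
        have "has_partial_at a g (x + \<theta> *\<^sub>R a + r *\<^sub>R b)"
          using a box(2)[of \<theta> r] that sr by simp
        then have "((\<lambda>u. g (x + \<theta> *\<^sub>R a + u *\<^sub>R a + r *\<^sub>R b)) has_real_derivative
           partial a g (x + \<theta> *\<^sub>R a + r *\<^sub>R b)) (at 0)"
          by (simp add: has_partial_at_iff add_ac)
        from partial_eqI[of "\<lambda>y. g (y + r *\<^sub>R b)", OF this]
        show "has_partial_at a (\<lambda>y. g (y + r *\<^sub>R b)) (x + \<theta> *\<^sub>R a)"
        "partial a (\<lambda>y. g (y + r *\<^sub>R b)) (x + \<theta> *\<^sub>R a) = partial a g (x + \<theta> *\<^sub>R a + r *\<^sub>R b)"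
          by auto
      qed
      have diffa0: "has_partial_at a g (x + \<theta> *\<^sub>R a)" if "\<bar>\<theta>\<bar> \<le> \<bar>s\<bar>" for \<theta>
        using a box(2)[of \<theta> 0] that sr d by simp
      define G where "G = (\<lambda>y. g (y + r *\<^sub>R b) - g y)"
      have G: "has_partial_at a G (x + \<theta> *\<^sub>R a)"
        "partial a G (x + \<theta> *\<^sub>R a) = partial a g (x + \<theta> *\<^sub>R a + r *\<^sub>R b) - partial a g (x + \<theta> *\<^sub>R a)"
        if "\<bar>\<theta>\<bar> \<le> \<bar>s\<bar>" for \<theta>
        unfolding G_def
        using partial_diff[OF diffa(1)[OF that] diffa0[OF that]] diffa(2)[OF that] by auto
      obtain \<theta> where \<theta>: "\<bar>\<theta>\<bar> \<le> \<bar>s\<bar>" "G (x + s *\<^sub>R a) - G x = s * partial a G (x + \<theta> *\<^sub>R a)"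
        using partial_mvt[of s a G x, OF G(1)] by blast
      have "partial a G (x + \<theta> *\<^sub>R a) =
          partial a g (x + \<theta> *\<^sub>R a + r *\<^sub>R b) - partial a g (x + \<theta> *\<^sub>R a)"
        by (rule G(2)[OF \<theta>(1)])
      moreover obtain \<tau> where "\<bar>\<tau>\<bar> \<le> \<bar>r\<bar>"
        "partial a g (x + \<theta> *\<^sub>R a + r *\<^sub>R b) - partial a g (x + \<theta> *\<^sub>R a) =
          r * W (x + \<theta> *\<^sub>R a + \<tau> *\<^sub>R b)"
      proof -
        have "has_partial_at b (partial a g) (x + \<theta> *\<^sub>R a + \<tau> *\<^sub>R b)" if "\<bar>\<tau>\<bar> \<le> \<bar>r\<bar>" for \<tau>
          using ba box(2)[of \<theta> \<tau>] \<theta>(1) sr that by simp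
        from partial_mvt[of r b "partial a g" "x + \<theta> *\<^sub>R a", OF this] show ?thesis
          using that unfolding W_def by blast
      qed
      ultimately have \<tau>: "\<bar>\<tau>\<bar> \<le> \<bar>r\<bar>"
        "G (x + s *\<^sub>R a) - G x = s * (r * W (x + \<theta> *\<^sub>R a + \<tau> *\<^sub>R b))" using \<theta>(2) by auto
      then have eq: "(g (x + s *\<^sub>R a + r *\<^sub>R b) - g (x + s *\<^sub>R a) - (g (x + r *\<^sub>R b) - g x)) / r / s =
          W (x + \<theta> *\<^sub>R a + \<tau> *\<^sub>R b)"
        using sr(3,4) by (simp add: G_def)
      show ?thesis
        unfolding eq using \<theta>(1) \<tau>(1) sr(1,2) by (intro less_imp_le box(1)) linarith+
    qed
    have "\<bar>(partial b g (x + s *\<^sub>R a) - partial b g x) / s - W x\<bar> \<le> e / 2"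
      if s: "\<bar>s\<bar> < d/2" "s \<noteq> 0" for s
    proof (rule tendsto_upperbound)
      have "has_partial_at b g (x + s *\<^sub>R a)" "has_partial_at b g x"
        using b box(2)[of s 0] S s d by auto
      then have "((\<lambda>r. (g (x + s *\<^sub>R a + r *\<^sub>R b) - g (x + s *\<^sub>R a)) / r) \<longlongrightarrow> partial b g (x + s *\<^sub>R a)) (at 0)"
        "((\<lambda>r. (g (x + r *\<^sub>R b) - g x) / r) \<longlongrightarrow> partial b g x) (at 0)"
        by (simp_all add: has_partial_at_iff DERIV_def)
      then show "((\<lambda>r. \<bar>((g (x + s *\<^sub>R a + r *\<^sub>R b) - g (x + s *\<^sub>R a)) / r - (g (x + r *\<^sub>R b) - g x) / r) / s - W x\<bar>)
          \<longlongrightarrow> \<bar>(partial b g (x + s *\<^sub>R a) - partial b g x) / s - W x\<bar>) (at 0)"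
        using s by (intro tendsto_intros)
      show "\<forall>\<^sub>F r in at 0. \<bar>((g (x + s *\<^sub>R a + r *\<^sub>R b) - g (x + s *\<^sub>R a)) / r -
          (g (x + r *\<^sub>R b) - g x) / r) / s - W x\<bar> \<le> e / 2"
        unfolding eventually_at diff_divide_distrib[symmetric]
        using d quot[OF s(1) _ s(2)] by (intro exI[of _ "d/2"]) simp
    qed auto
    then show "\<forall>\<^sub>F s in at 0. dist ((partial b g (x + (0 + s) *\<^sub>R a) - partial b g (x + 0 *\<^sub>R a)) / s) (W x) < e"
      unfolding eventually_at dist_real_def using d e
      by (intro exI[of _ "d/2"]) (simp add: le_less_trans[of _ "e/2" e])
  qed
  from partial_eqI[OF this] show "has_partial_at a (partial b g) x"
    "partial a (partial b g) x = partial b (partial a g) x"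
    by (auto simp: W_def)
qed

section \<open>Functions with bounded derivatives\<close>

lemma partials_simps:
  "partials [] f = f"
  "partials (b # bs) f = partial b (partials bs f)"
  "partials (bs @ [b]) f = partials bs (partial b f)"
  by (simp_all add: partials_def)

lemma Ck_on_0 [simp]: "Ck_on 0 S f \<longleftrightarrow> continuous_on S f"
  by (simp add: Ck_on_def partials_def)

lemma Ck_on_continuous: "Ck_on k S f \<Longrightarrow> continuous_on S f"
  unfolding Ck_on_def by (metis lists.Nil list.size(3) partials_simps(1) zero_le)

lemma Ck_on_mono: "Ck_on k S f \<Longrightarrow> j \<le> k \<Longrightarrow> Ck_on j S f"
  by (auto simp: Ck_on_def)

lemma Ck_on_Suc:
  "Ck_on (Suc k) S f \<longleftrightarrow> continuous_on S f \<and>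
     (\<forall>b\<in>Basis. (\<forall>x\<in>S. has_partial_at b f x) \<and> Ck_on k S (partial b f))" (is "?L \<longleftrightarrow> ?R")
proof
  assume L: ?L
  have "has_partial_at b f x" if "b \<in> Basis" "x \<in> S" for b x
    using L that unfolding Ck_on_def by (metis lists.Nil list.size(3) partials_simps(1) zero_less_Suc)
  moreover have "Ck_on k S (partial b f)" if b: "b \<in> Basis" for b
    unfolding Ck_on_def
  proof (intro conjI ballI impI)
    fix bs :: "'a list" assume bs: "bs \<in> lists Basis"
    then have in_l: "bs @ [b] \<in> lists Basis" using b by auto
    show "continuous_on S (partials bs (partial b f))" if "length bs \<le> k"
      using L in_l that unfolding Ck_on_def partials_simps(3)[symmetric] by simp
    show "has_partial_at c (partials bs (partial b f)) x" if "length bs < k" "c \<in> Basis" "x \<in> S" for c x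
      using L in_l that unfolding Ck_on_def partials_simps(3)[symmetric] by simp
  qed
  ultimately show ?R using Ck_on_continuous[OF L] by blast
next
  assume R: ?R
  show ?L
    unfolding Ck_on_def
  proof (intro conjI ballI impI)
    fix bs :: "'a list" assume bs: "bs \<in> lists Basis"
    show "continuous_on S (partials bs f)" if "length bs \<le> Suc k"
      using bs that R by (cases bs rule: rev_cases) (auto simp: partials_simps Ck_on_def)
    show "has_partial_at c (partials bs f) x" if "length bs < Suc k" "c \<in> Basis" "x \<in> S" for c x
      using bs that R by (cases bs rule: rev_cases) (auto simp: partials_simps Ck_on_def)
  qed
qed

lemma partials_cong_open:
  assumes "open S" "\<And>y. y \<in> S \<Longrightarrow> f y = g y" "x \<in> S"
  shows "partials bs f x = partials bs g x"
  using assms(3)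
proof (induction bs arbitrary: x)
  case Nil
  then show ?case using assms by (simp add: partials_simps)
next
  case (Cons b bs)
  show ?case unfolding partials_simps
    by (rule partial_cong_open(2)[OF assms(1) Cons.prems]) (rule Cons.IH)
qed

lemma Ck_on_cong_open:
  assumes "open S" "\<And>y. y \<in> S \<Longrightarrow> f y = g y"
  shows "Ck_on k S f \<longleftrightarrow> Ck_on k S g"
proof -
  have eq: "partials bs f y = partials bs g y" if "y \<in> S" for bs y
    using partials_cong_open[OF assms that] .
  have "continuous_on S (partials bs f) \<longleftrightarrow> continuous_on S (partials bs g)" for bs
    using eq by (intro continuous_on_cong) auto
  moreover have "has_partial_at b (partials bs f) x \<longleftrightarrow> has_partial_at b (partials bs g) x"
    if "x \<in> S" for b bs x
    using partial_cong_open(1)[OF assms(1) that eq] .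
  ultimately show ?thesis unfolding Ck_on_def by simp
qed

lemma Ck_on_lincomb:
  assumes "open S" "Ck_on k S f" "Ck_on k S g"
  shows "Ck_on k S (\<lambda>x. f x + c * g x)"
    "\<And>bs x. bs \<in> lists Basis \<Longrightarrow> length bs \<le> k \<Longrightarrow> x \<in> S \<Longrightarrow>
       partials bs (\<lambda>x. f x + c * g x) x = partials bs f x + c * partials bs g x"
proof -
  have "Ck_on k S (\<lambda>x. f x + c * g x) \<and> (\<forall>bs \<in> lists Basis. length bs \<le> k \<longrightarrow> (\<forall>x\<in>S.
       partials bs (\<lambda>x. f x + c * g x) x = partials bs f x + c * partials bs g x))"
    using assms(2,3)
  proof (induction k arbitrary: f g)
    case 0
    then show ?case by (auto intro!: continuous_intros simp: partials_simps)
  next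
    case (Suc k)
    have lin: "has_partial_at b (\<lambda>x. f x + c * g x) x"
      "partial b (\<lambda>x. f x + c * g x) x = partial b f x + c * partial b g x"
      if "b \<in> Basis" "x \<in> S" for b x
      using partial_lincomb Suc.prems that unfolding Ck_on_Suc by metis+
    have IH: "Ck_on k S (\<lambda>x. partial b f x + c * partial b g x)"
       "bs \<in> lists Basis \<Longrightarrow> length bs \<le> k \<Longrightarrow> x \<in> S \<Longrightarrow>
       partials bs (\<lambda>x. partial b f x + c * partial b g x) x =
         partials bs (partial b f) x + c * partials bs (partial b g) x"
      if "b \<in> Basis" for b bs x
      using Suc.IH[of "partial b f" "partial b g"] Suc.prems that unfolding Ck_on_Suc by auto
    have C: "Ck_on k S (partial b (\<lambda>x. f x + c * g x))" if b: "b \<in> Basis" for b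
      by (rule iffD2[OF Ck_on_cong_open[OF assms(1)] IH(1)[OF b]]) (rule lin(2)[OF b])
    have P: "partials bs (partial b (\<lambda>x. f x + c * g x)) x =
         partials bs (partial b f) x + c * partials bs (partial b g) x"
      if "b \<in> Basis" "bs \<in> lists Basis" "length bs \<le> k" "x \<in> S" for b bs x
      using IH(2)[OF that] partials_cong_open[OF assms(1) lin(2)[OF that(1)] that(4)] by simp
    show ?case
    proof (intro conjI ballI impI)
      show "Ck_on (Suc k) S (\<lambda>x. f x + c * g x)"
        unfolding Ck_on_Suc using lin(1) C Ck_on_continuous[OF Suc.prems(1)]
          Ck_on_continuous[OF Suc.prems(2)] by (auto intro!: continuous_intros)
      fix bs :: "'a list" and x
      assume "bs \<in> lists Basis" "length bs \<le> Suc k" "x \<in> S"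
      then show "partials bs (\<lambda>x. f x + c * g x) x = partials bs f x + c * partials bs g x"
        using P by (cases bs rule: rev_cases) (auto simp: partials_simps)
    qed
  qed
  then show "Ck_on k S (\<lambda>x. f x + c * g x)"
    "\<And>bs x. bs \<in> lists Basis \<Longrightarrow> length bs \<le> k \<Longrightarrow> x \<in> S \<Longrightarrow>
       partials bs (\<lambda>x. f x + c * g x) x = partials bs f x + c * partials bs g x"
    by auto
qed

text \<open>
  One constant bounds all derivatives up to order \<open>k\<close>. Decay of a time-dependent function in \<open>C\<^sup>k\<close>
  then means that the constant can eventually be taken arbitrarily small.
\<close>

definition Ck_bounded :: "nat \<Rightarrow> 'a::euclidean_space set \<Rightarrow> real \<Rightarrow> ('a \<Rightarrow> real) \<Rightarrow> bool" where
  "Ck_bounded k S A f \<longleftrightarrow> Ck_on k S f \<and>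
     (\<forall>bs \<in> lists Basis. length bs \<le> k \<longrightarrow> (\<forall>x\<in>S. \<bar>partials bs f x\<bar> \<le> A))"

lemma Ck_bounded_mono:
  "Ck_bounded k S A f \<Longrightarrow> j \<le> k \<Longrightarrow> A \<le> A' \<Longrightarrow> Ck_bounded j S A' f"
  unfolding Ck_bounded_def by (meson Ck_on_mono order.trans)

lemma Ck_bounded_cong_open:
  assumes "open S" "\<And>y. y \<in> S \<Longrightarrow> f y = g y"
  shows "Ck_bounded k S A f \<longleftrightarrow> Ck_bounded k S A g"
  unfolding Ck_bounded_def
  using Ck_on_cong_open[OF assms] partials_cong_open[OF assms] by simp

lemma Ck_bounded_lincomb:
  assumes "open S" "Ck_bounded k S A f" "Ck_bounded k S B g"
  shows "Ck_bounded k S (A + \<bar>c\<bar> * B) (\<lambda>x. f x + c * g x)"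
  unfolding Ck_bounded_def
proof (intro conjI ballI impI)
  show "Ck_on k S (\<lambda>x. f x + c * g x)"
    using Ck_on_lincomb(1) assms unfolding Ck_bounded_def by blast
  fix bs :: "'a list" and x assume bs: "bs \<in> lists Basis" "length bs \<le> k" "x \<in> S"
  have "partials bs (\<lambda>x. f x + c * g x) x = partials bs f x + c * partials bs g x"
    using Ck_on_lincomb(2)[OF assms(1) _ _ bs] assms unfolding Ck_bounded_def by blast
  also have "\<bar>\<dots>\<bar> \<le> \<bar>partials bs f x\<bar> + \<bar>c\<bar> * \<bar>partials bs g x\<bar>"
    by (metis abs_mult abs_triangle_ineq)
  also have "\<dots> \<le> A + \<bar>c\<bar> * B"
    using assms(2,3) bs unfolding Ck_bounded_def by (intro add_mono mult_left_mono) auto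
  finally show "\<bar>partials bs (\<lambda>x. f x + c * g x) x\<bar> \<le> A + \<bar>c\<bar> * B" .
qed

lemma Ck_bounded_0: "Ck_bounded 0 S A f \<longleftrightarrow> continuous_on S f \<and> (\<forall>x\<in>S. \<bar>f x\<bar> \<le> A)"
  by (auto simp: Ck_bounded_def partials_simps)

lemma Ck_bounded_Suc:
  "Ck_bounded (Suc k) S A f \<longleftrightarrow> continuous_on S f \<and> (\<forall>x\<in>S. \<bar>f x\<bar> \<le> A) \<and>
     (\<forall>b\<in>Basis. (\<forall>x\<in>S. has_partial_at b f x) \<and> Ck_bounded k S A (partial b f))" (is "?L \<longleftrightarrow> ?R")
proof
  assume L: ?L
  have "\<bar>f x\<bar> \<le> A" if "x \<in> S" for x
    using L that unfolding Ck_bounded_def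
    by (metis lists.Nil list.size(3) partials_simps(1) zero_le)
  moreover have "\<bar>partials bs (partial b f) x\<bar> \<le> A"
    if "b \<in> Basis" "bs \<in> lists Basis" "length bs \<le> k" "x \<in> S" for b bs x
  proof -
    have "bs @ [b] \<in> lists Basis" "length (bs @ [b]) \<le> Suc k" using that by auto
    then show ?thesis using L that(4) unfolding Ck_bounded_def by (metis partials_simps(3))
  qed
  ultimately show ?R using L by (auto simp: Ck_bounded_def Ck_on_Suc)
next
  assume R: ?R
  show ?L
    unfolding Ck_bounded_def
  proof (intro conjI ballI impI)
    show "Ck_on (Suc k) S f" using R by (auto simp: Ck_bounded_def Ck_on_Suc)
    fix bs :: "'a list" and x assume "bs \<in> lists Basis" "length bs \<le> Suc k" "x \<in> S"
    then show "\<bar>partials bs f x\<bar> \<le> A"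
      using R by (cases bs rule: rev_cases) (auto simp: Ck_bounded_def partials_simps)
  qed
qed

lemma Ck_bounded_const: "\<bar>c\<bar> \<le> A \<Longrightarrow> Ck_bounded k S A (\<lambda>x::'a::euclidean_space. c)"
proof (induction k arbitrary: c)
  case (Suc k)
  have "partial b (\<lambda>x. c) = (\<lambda>x. 0)" for b :: 'a by (simp add: fun_eq_iff partial_const)
  then show ?case using Suc by (auto simp: Ck_bounded_Suc partial_const)
qed (simp add: Ck_bounded_0)

lemma Ck_on_const: "Ck_on k S (\<lambda>x. c)"
  using Ck_bounded_const[OF order.refl, where c = c] unfolding Ck_bounded_def by blast

lemma Ck_bounded_lipschitz:
  fixes f :: "'a::euclidean_space \<Rightarrow> real"
  assumes "open S" "convex S" "Ck_bounded (Suc k) S A f" "x \<in> S" "y \<in> S"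
  shows "\<bar>f x - f y\<bar> \<le> real DIM('a) * A * dist x y"
proof (rule lipschitz_of_bounded_partials[OF assms(1,2,4,5)])
  fix b :: 'a assume b: "b \<in> Basis"
  have "Ck_bounded 0 S A (partial b f)"
    using assms(3) b Ck_bounded_mono[of k S A _ 0 A] unfolding Ck_bounded_Suc by simp
  then show "continuous_on S (partial b f)" "\<And>y. y \<in> S \<Longrightarrow> \<bar>partial b f y\<bar> \<le> A"
    unfolding Ck_bounded_0 by auto
  show "has_partial_at b f y" if "y \<in> S" for y
    using assms(3) b that unfolding Ck_bounded_Suc by simp
qed

section \<open>Regularity in a product of two spaces\<close>

lemma partial_slice:
  "has_partial_at (b, 0) u (q, p) \<longleftrightarrow> has_partial_at b (\<lambda>q. u (q, p)) q"
  "partial (b, 0) u (q, p) = partial b (\<lambda>q. u (q, p)) q"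
  by (simp_all add: has_partial_at_def partial_def)

text \<open>
  Continuity in each variable separately is not enough. Continuous derivatives in \<open>p\<close> are locally
  bounded, and this makes \<open>u\<close> Lipschitz in \<open>p\<close>, locally uniformly in \<open>q\<close>.
\<close>

lemma continuous_on_of_slices:
  fixes u :: "'a::euclidean_space \<times> 'b::euclidean_space \<Rightarrow> real"
  assumes B: "open B"
    and sl: "\<And>p. p \<in> B \<Longrightarrow> continuous_on UNIV (\<lambda>q. u (q, p))"
    and ex: "\<And>c x. c \<in> Basis \<Longrightarrow> x \<in> UNIV \<times> B \<Longrightarrow> has_partial_at (0, c) u x"
    and cont: "\<And>c. c \<in> Basis \<Longrightarrow> continuous_on (UNIV \<times> B) (partial (0, c) u)"
  shows "continuous_on (UNIV \<times> B) u"
proof -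
  have S: "open (UNIV \<times> B :: ('a \<times> 'b) set)" using B by (simp add: open_Times)
  have "isCont u (q0, p0)" if p0: "p0 \<in> B" for q0 p0
  proof -
    define x0 where "x0 = (q0, p0)"
    have x0: "x0 \<in> UNIV \<times> B" using p0 by (simp add: x0_def)
    define A where "A = (\<Sum>c\<in>Basis. \<bar>partial (0, c) u x0\<bar>) + 1"
    have "\<forall>c\<in>Basis. \<forall>\<^sub>F z in nhds x0. z \<in> UNIV \<times> B \<and> \<bar>partial (0, c) u z\<bar> \<le> A"
    proof
      fix c :: 'b assume c: "c \<in> Basis"
      have "isCont (partial (0, c) u) x0"
        using cont[OF c] S x0 continuous_on_eq_continuous_at by blast
      then have "(partial (0, c) u \<longlongrightarrow> partial (0, c) u x0) (nhds x0)"
        by (simp add: isCont_def tendsto_at_iff_tendsto_nhds)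
      then have "\<forall>\<^sub>F z in nhds x0. dist (partial (0, c) u z) (partial (0, c) u x0) < 1"
        by (rule tendstoD) simp
      then show "\<forall>\<^sub>F z in nhds x0. z \<in> UNIV \<times> B \<and> \<bar>partial (0, c) u z\<bar> \<le> A"
        using eventually_nhds_in_open[OF S x0]
      proof eventually_elim
        case (elim z)
        have "\<bar>partial (0, c) u x0\<bar> \<le> (\<Sum>c\<in>Basis. \<bar>partial (0, c) u x0\<bar>)"
          using c by (intro member_le_sum) auto
        then show ?case using elim unfolding dist_real_def A_def by linarith
      qed
    qed
    then have "\<forall>\<^sub>F z in nhds x0. \<forall>c\<in>Basis. z \<in> UNIV \<times> B \<and> \<bar>partial (0, c) u z\<bar> \<le> A"
      by (simp add: eventually_ball_finite_distrib)
    then obtain r where r: "r > 0"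
      and near: "\<And>z c. c \<in> Basis \<Longrightarrow> dist z x0 < r \<Longrightarrow> z \<in> UNIV \<times> B \<and> \<bar>partial (0, c) u z\<bar> \<le> A"
      unfolding eventually_nhds_metric by blast
    have "((\<lambda>x. dist (fst x) q0 + (\<Sum>c\<in>Basis. \<bar>(snd x - p0) \<bullet> c\<bar>)) \<longlongrightarrow>
        dist (fst x0) q0 + (\<Sum>c\<in>Basis. \<bar>(snd x0 - p0) \<bullet> c\<bar>)) (at x0)"
      by (intro tendsto_intros)
    then have lim0: "((\<lambda>x. dist (fst x) q0 + (\<Sum>c\<in>Basis. \<bar>(snd x - p0) \<bullet> c\<bar>)) \<longlongrightarrow> 0) (at x0)"
      by (simp add: x0_def)
    have "\<forall>\<^sub>F x in at x0. dist (fst x) q0 + (\<Sum>c\<in>Basis. \<bar>(snd x - p0) \<bullet> c\<bar>) < r"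
      using order_tendstoD(2)[OF lim0 r] .
    then have est: "\<forall>\<^sub>F x in at x0. \<bar>u x - u (fst x, p0)\<bar> \<le> A * (\<Sum>c\<in>Basis. \<bar>(snd x - p0) \<bullet> c\<bar>)"
    proof eventually_elim
      case (elim x)
      define v where "v = (\<lambda>d::'a \<times> 'b. (snd x - p0) \<bullet> snd d)"
      define D where "D = Pair (0::'a) ` (Basis :: 'b set)"
      have inj: "inj_on (Pair (0::'a)) (Basis :: 'b set)" by (simp add: inj_on_def)
      have sums: "(\<Sum>d\<in>D. \<bar>v d\<bar>) = (\<Sum>c\<in>Basis. \<bar>(snd x - p0) \<bullet> c\<bar>)"
        "(\<Sum>d\<in>D. v d *\<^sub>R d) = (0, snd x - p0)"
      proof -
        show "(\<Sum>d\<in>D. \<bar>v d\<bar>) = (\<Sum>c\<in>Basis. \<bar>(snd x - p0) \<bullet> c\<bar>)"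
          unfolding D_def sum.reindex[OF inj] by (simp add: v_def)
        have "(\<Sum>d\<in>D. v d *\<^sub>R d) = (\<Sum>c\<in>Basis. (0, ((snd x - p0) \<bullet> c) *\<^sub>R c))"
          unfolding D_def sum.reindex[OF inj] by (simp add: v_def)
        also have "\<dots> = (0, snd x - p0)"
          by (simp add: prod_eq_iff fst_sum snd_sum euclidean_representation)
        finally show "(\<Sum>d\<in>D. v d *\<^sub>R d) = (0, snd x - p0)" .
      qed
      have "\<bar>u ((fst x, p0) + (\<Sum>d\<in>D. v d *\<^sub>R d)) - u (fst x, p0) - (\<Sum>d\<in>D. v d * 0)\<bar> \<le>
          A * (\<Sum>d\<in>D. \<bar>v d\<bar>)"
      proof (rule increment_along_coordinates)
        show "finite D" "D \<subseteq> Basis" by (auto simp: D_def Basis_prod_def)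
        fix d z assume d: "d \<in> D" and z: "norm (z - (fst x, p0)) \<le> (\<Sum>d\<in>D. \<bar>v d\<bar>)"
        have "dist z x0 \<le> dist z (fst x, p0) + dist (fst x, p0) x0" by (rule dist_triangle)
        also have "dist (fst x, p0) x0 = dist (fst x) q0" by (simp add: x0_def dist_Pair_Pair)
        finally have "dist z x0 < r" using z elim sums(1) by (simp add: dist_norm)
        moreover obtain c where "c \<in> Basis" "d = (0, c)" using d by (auto simp: D_def)
        ultimately show "has_partial_at d u z \<and> \<bar>partial d u z - 0\<bar> \<le> A"
          using near[of c z] ex[of c z] by simp
      qed
      then show ?case by (simp add: sums)
    qed
    have "((\<lambda>x. A * (\<Sum>c\<in>Basis. \<bar>(snd x - p0) \<bullet> c\<bar>)) \<longlongrightarrow>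
        A * (\<Sum>c\<in>Basis. \<bar>(snd x0 - p0) \<bullet> c\<bar>)) (at x0)"
      by (intro tendsto_intros)
    then have lim1: "((\<lambda>x. A * (\<Sum>c\<in>Basis. \<bar>(snd x - p0) \<bullet> c\<bar>)) \<longlongrightarrow> 0) (at x0)"
      by (simp add: x0_def)
    have "((\<lambda>x. u x - u (fst x, p0)) \<longlongrightarrow> 0) (at x0)"
      using est by (intro Lim_null_comparison[OF _ lim1]) simp
    moreover have "((\<lambda>x. u (fst x, p0)) \<longlongrightarrow> u (q0, p0)) (at x0)"
    proof -
      have "isCont (\<lambda>q. u (q, p0)) q0" using sl[OF p0] by (simp add: continuous_on_eq_continuous_at)
      moreover have "((\<lambda>x. fst x) \<longlongrightarrow> q0) (at x0)"
        using tendsto_fst[OF tendsto_ident_at, of x0 UNIV] by (simp add: x0_def)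
      ultimately show ?thesis by (rule isCont_tendsto_compose)
    qed
    ultimately have "((\<lambda>x. (u x - u (fst x, p0)) + u (fst x, p0)) \<longlongrightarrow> 0 + u (q0, p0)) (at x0)"
      by (rule tendsto_add)
    then show ?thesis by (simp add: isCont_def x0_def)
  qed
  then show ?thesis by (intro continuous_at_imp_continuous_on) auto
qed

lemma mixed_partials_slices:
  fixes u :: "'a::euclidean_space \<times> 'b::euclidean_space \<Rightarrow> real"
  assumes B: "open B"
    and sl: "\<And>p. p \<in> B \<Longrightarrow> Ck_on (Suc k) UNIV (\<lambda>q. u (q, p))"
    and ex: "\<And>c x. c \<in> Basis \<Longrightarrow> x \<in> UNIV \<times> B \<Longrightarrow> has_partial_at (0, c) u x"
    and C: "\<And>c. c \<in> Basis \<Longrightarrow> Ck_on (Suc j) (UNIV \<times> B) (partial (0, c) u)"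
    and b: "b \<in> Basis" "c \<in> Basis" "x \<in> UNIV \<times> B"
  shows "has_partial_at (0, c) (partial (b, 0) u) x"
    "partial (0, c) (partial (b, 0) u) x = partial (b, 0) (partial (0, c) u) x"
proof -
  have S: "open (UNIV \<times> B :: ('a \<times> 'b) set)" using B by (simp add: open_Times)
  have bB: "(b, 0) \<in> (Basis :: ('a \<times> 'b) set)" using b by (auto simp: Basis_prod_def)
  have "has_partial_at (b, 0) u y" if "y \<in> UNIV \<times> B" for y
    using sl that b(1) by (cases y) (auto simp: partial_slice Ck_on_Suc)
  moreover have "has_partial_at (b, 0) (partial (0, c) u) y" if "y \<in> UNIV \<times> B" for y
    using C[OF b(2)] bB that by (auto simp: Ck_on_Suc)
  moreover have "continuous_on (UNIV \<times> B) (partial (b, 0) (partial (0, c) u))"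
    using C[OF b(2)] bB Ck_on_continuous by (auto simp: Ck_on_Suc)
  ultimately show "has_partial_at (0, c) (partial (b, 0) u) x"
    "partial (0, c) (partial (b, 0) u) x = partial (b, 0) (partial (0, c) u) x"
    using mixed_partials[OF S b(3), of "(0, c)" u "(b, 0)"] ex[OF b(2)] by blast+
qed

text \<open>
  The \<open>q\<close>-derivatives of \<open>u\<close> are only known to exist for each fixed \<open>p\<close>. Their derivatives in \<open>p\<close> are
  the \<open>q\<close>-derivatives of \<open>\<partial>\<^sub>p u\<close>, which are continuous in both variables; so they inherit the
  hypotheses on \<open>u\<close> with one order less.
\<close>

lemma Ck_on_of_slices:
  fixes u :: "'a::euclidean_space \<times> 'b::euclidean_space \<Rightarrow> real"
  assumes B: "open B"
    and "\<And>p. p \<in> B \<Longrightarrow> Ck_on k UNIV (\<lambda>q. u (q, p))"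
    and "\<And>c x. c \<in> Basis \<Longrightarrow> x \<in> UNIV \<times> B \<Longrightarrow> has_partial_at (0, c) u x"
    and "\<And>c. c \<in> Basis \<Longrightarrow> Ck_on k (UNIV \<times> B) (partial (0, c) u)"
  shows "Ck_on k (UNIV \<times> B) u"
  using assms(2-)
proof (induction k arbitrary: u)
  case 0
  have "continuous_on (UNIV \<times> B) u"
    by (rule continuous_on_of_slices[OF B]) (use 0 in simp_all)
  then show ?case by simp
next
  case (Suc k)
  have S: "open (UNIV \<times> B :: ('a \<times> 'b) set)" using B by (simp add: open_Times)
  have "continuous_on (UNIV \<times> B) u"
  proof (rule continuous_on_of_slices[OF B])
    show "continuous_on UNIV (\<lambda>q. u (q, p))" if "p \<in> B" for p
      using Suc.prems(1)[OF that] by (rule Ck_on_continuous)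
    show "continuous_on (UNIV \<times> B) (partial (0, c) u)" if "c \<in> Basis" for c
      using Suc.prems(3)[OF that] by (rule Ck_on_continuous)
  qed (rule Suc.prems(2))
  moreover have "(\<forall>x\<in>UNIV \<times> B. has_partial_at d u x) \<and> Ck_on k (UNIV \<times> B) (partial d u)"
    if d: "d \<in> Basis" for d
  proof -
    consider b where "b \<in> Basis" "d = (b, 0)" | c where "c \<in> Basis" "d = (0, c)"
      using d by (auto simp: Basis_prod_def)
    then show ?thesis
    proof cases
      case 1
      have "Ck_on k (UNIV \<times> B) (partial (b, 0) u)"
      proof (rule Suc.IH)
        fix p assume "p \<in> B"
        then show "Ck_on k UNIV (\<lambda>q. partial (b, 0) u (q, p))"
          using Suc.prems(1) 1(1) by (simp add: partial_slice Ck_on_Suc)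
      next
        fix c :: 'b assume c: "c \<in> Basis"
        note mixed = mixed_partials_slices[OF B Suc.prems 1(1) c]
        show "has_partial_at (0, c) (partial (b, 0) u) x" if "x \<in> UNIV \<times> B" for x
          using mixed(1) that by blast
        have "(b, 0) \<in> (Basis :: ('a \<times> 'b) set)" using 1 d by simp
        then have "Ck_on k (UNIV \<times> B) (partial (b, 0) (partial (0, c) u))"
          using Suc.prems(3)[OF c] by (simp add: Ck_on_Suc)
        then show "Ck_on k (UNIV \<times> B) (partial (0, c) (partial (b, 0) u))"
          using Ck_on_cong_open[OF S, of "partial (0, c) (partial (b, 0) u)"
              "partial (b, 0) (partial (0, c) u)" k] mixed(2) by simp
      qed
      then show ?thesis
        using Suc.prems(1) 1 by (auto simp: partial_slice Ck_on_Suc)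
    next
      case 2
      have "Ck_on k (UNIV \<times> B) (partial (0, c) u)"
        using Suc.prems(3)[OF 2(1)] by (rule Ck_on_mono) simp
      then show ?thesis using Suc.prems(2) 2 by simp
    qed
  qed
  ultimately show ?case by (simp add: Ck_on_Suc)
qed

text \<open>
  Any derivative of \<open>u\<close> is, up to the order of differentiation, either a pure \<open>q\<close>-derivative or a
  derivative of some \<open>\<partial>\<^sub>p u\<close>, so that bounds on these two kinds suffice.
\<close>

lemma Ck_bounded_of_slices:
  fixes u :: "'a::euclidean_space \<times> 'b::euclidean_space \<Rightarrow> real"
  assumes B: "open B"
    and "Ck_on k (UNIV \<times> B) u"
    and "\<And>cs p q. cs \<in> lists Basis \<Longrightarrow> length cs \<le> k \<Longrightarrow> p \<in> B \<Longrightarrow>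
           \<bar>partials cs (\<lambda>q. u (q, p)) q\<bar> \<le> A"
    and "\<And>bs c x. bs \<in> lists Basis \<Longrightarrow> length bs < k \<Longrightarrow> c \<in> Basis \<Longrightarrow> x \<in> UNIV \<times> B \<Longrightarrow>
           \<bar>partials bs (partial (0, c) u) x\<bar> \<le> A"
  shows "Ck_bounded k (UNIV \<times> B) A u"
  using assms(2-)
proof (induction k arbitrary: u)
  case 0
  show ?case using 0(1) 0(2)[of "[]"] by (auto simp: Ck_bounded_0 partials_simps)
next
  case (Suc k)
  have S: "open (UNIV \<times> B :: ('a \<times> 'b) set)" using B by (simp add: open_Times)
  have "\<bar>u x\<bar> \<le> A" if "x \<in> UNIV \<times> B" for x
    using Suc.prems(2)[of "[]" "snd x" "fst x"] that by (auto simp: partials_simps)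
  moreover have "Ck_bounded k (UNIV \<times> B) A (partial d u)" if d: "d \<in> Basis" for d
  proof -
    have Ckd: "Ck_on k (UNIV \<times> B) (partial d u)" using Suc.prems(1) d by (simp add: Ck_on_Suc)
    consider b where "b \<in> Basis" "d = (b, 0)" | c where "c \<in> Basis" "d = (0, c)"
      using d by (auto simp: Basis_prod_def)
    then show ?thesis
    proof cases
      case 1
      have "Ck_bounded k (UNIV \<times> B) A (partial (b, 0) u)"
      proof (rule Suc.IH)
        show "Ck_on k (UNIV \<times> B) (partial (b, 0) u)" using Ckd 1 by simp
      next
        fix cs :: "'a list" and p q assume "cs \<in> lists Basis" "length cs \<le> k" "p \<in> B"
        then show "\<bar>partials cs (\<lambda>q. partial (b, 0) u (q, p)) q\<bar> \<le> A"
          using Suc.prems(2)[of "cs @ [b]" p q] 1(1) by (simp add: partial_slice partials_simps)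
      next
        fix bs :: "('a \<times> 'b) list" and c :: 'b and x :: "'a \<times> 'b"
        assume bs: "bs \<in> lists Basis" "length bs < k" and c: "c \<in> Basis" and x: "x \<in> UNIV \<times> B"
        from bs obtain j where k: "k = Suc j" by (cases k) auto
        have cB: "(0, c) \<in> (Basis :: ('a \<times> 'b) set)" using c by (auto simp: Basis_prod_def)
        have eq: "partial (0, c) (partial (b, 0) u) y = partial (b, 0) (partial (0, c) u) y"
          if "y \<in> UNIV \<times> B" for y
        proof (rule mixed_partials(2)[OF S that])
          show "has_partial_at (0, c) u y" "has_partial_at (b, 0) u y"
            "has_partial_at (b, 0) (partial (0, c) u) y" if "y \<in> UNIV \<times> B" for y
            using Suc.prems(1) cB d that unfolding 1(2) k Ck_on_Suc by auto
          show "continuous_on (UNIV \<times> B) (partial (b, 0) (partial (0, c) u))"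
            using Suc.prems(1) cB d unfolding 1(2) k Ck_on_Suc by (blast intro: Ck_on_continuous)
        qed
        have "partials bs (partial (0, c) (partial (b, 0) u)) x =
            partials (bs @ [(b, 0)]) (partial (0, c) u) x"
          unfolding partials_simps by (rule partials_cong_open[OF S eq x])
        then show "\<bar>partials bs (partial (0, c) (partial (b, 0) u)) x\<bar> \<le> A"
          using Suc.prems(3)[of "bs @ [(b, 0)]" c x] bs c x d 1(2) by simp
      qed
      then show ?thesis using 1 by simp
    next
      case 2
      then show ?thesis using Ckd Suc.prems(3) by (auto simp: Ck_bounded_def)
    qed
  qed
  ultimately show ?case
    using Suc.prems(1) by (simp add: Ck_bounded_Suc Ck_on_Suc)
qed

section \<open>Uniform limits of functions with bounded derivatives\<close>

text \<open>
  In a ball, segments parallel to the coordinate axes that start close to the boundary may be too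
  short to compare a derivative with difference quotients. A small step inwards creates the room.
\<close>

definition uniformly_thick :: "'a::metric_space set \<Rightarrow> bool" where
  "uniformly_thick S \<longleftrightarrow> (\<forall>\<delta>. 0 < \<delta> \<and> \<delta> < 1 \<longrightarrow> (\<forall>x\<in>S. \<exists>y. dist x y \<le> \<delta> \<and> ball y \<delta> \<subseteq> S))"

lemma uniformly_thick_cylinder:
  "uniformly_thick (UNIV \<times> ball 0 1 :: ('a::euclidean_space \<times> 'b::euclidean_space) set)"
  unfolding uniformly_thick_def
proof (intro allI impI ballI)
  fix \<delta> :: real and x :: "'a \<times> 'b" assume \<delta>: "0 < \<delta> \<and> \<delta> < 1" and x: "x \<in> UNIV \<times> ball 0 1"
  obtain q p where qp: "x = (q, p)" "norm p < 1" using x by auto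
  define y where "y = (q, (1 - \<delta>) *\<^sub>R p)"
  have "p - (1 - \<delta>) *\<^sub>R p = \<delta> *\<^sub>R p" by (simp add: algebra_simps)
  then have "dist x y = \<delta> * norm p"
    using \<delta> by (simp add: qp y_def dist_Pair_Pair) (simp add: dist_norm)
  then have "dist x y \<le> \<delta>" using \<delta> qp(2) by (simp add: mult_left_le)
  moreover have "ball y \<delta> \<subseteq> UNIV \<times> ball 0 1"
  proof
    fix z assume "z \<in> ball y \<delta>"
    then have "dist (snd y) (snd z) < \<delta>" using dist_snd_le[of y z] by simp
    then have "norm (snd z) < norm (snd y) + \<delta>"
      using norm_triangle_ineq2[of "snd z" "snd y"] by (simp add: dist_norm norm_minus_commute)
    also have "norm (snd y) \<le> 1 - \<delta>" using \<delta> qp(2) by (simp add: y_def mult_left_le)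
    finally show "z \<in> UNIV \<times> ball 0 1" by (simp add: mem_Times_iff)
  qed
  ultimately show "\<exists>y. dist x y \<le> \<delta> \<and> ball y \<delta> \<subseteq> UNIV \<times> ball 0 1" by blast
qed

text \<open>
  Difference quotients with a fixed increment \<open>s\<close> converge, and they differ from the derivatives by
  at most a constant multiple of \<open>s\<close>, because second derivatives are bounded. Hence the quotients of
  the limit function form a Cauchy family as \<open>s \<rightarrow> 0\<close>, and the derivatives converge uniformly.
\<close>

lemma uniform_limit_partial:
  fixes v :: "'i \<Rightarrow> 'a::euclidean_space \<Rightarrow> real"
  assumes S: "open S" "convex S" "uniformly_thick S"
    and bd: "\<And>t. Ck_bounded (Suc (Suc 0)) S C (v t)"
    and lim: "uniform_limit S v w F" and F: "F \<noteq> bot" and b: "b \<in> Basis"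
  shows "\<forall>x\<in>S. has_partial_at b w x" "uniform_limit S (\<lambda>t. partial b (v t)) (partial b w) F"
proof -
  define L where "L = real DIM('a) * \<bar>C\<bar>"
  have L0: "L \<ge> 0" by (simp add: L_def)
  have nb: "norm b = 1" using b by simp
  have lip: "\<bar>partial b (v t) x - partial b (v t) y\<bar> \<le> L * dist x y" if "x \<in> S" "y \<in> S" for t x y
  proof -
    have "Ck_bounded (Suc 0) S \<bar>C\<bar> (partial b (v t))"
      using bd[of t] b Ck_bounded_mono[of "Suc 0" S C _ "Suc 0" "\<bar>C\<bar>"] unfolding Ck_bounded_Suc[of "Suc 0"] by simp
    from Ck_bounded_lipschitz[OF S(1,2) this that] show ?thesis by (simp add: L_def)
  qed
  define Q where "Q = (\<lambda>f x s. (f (x + s *\<^sub>R b) - f x) / s)"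
  have quot: "\<bar>Q (v t) x s - partial b (v t) x\<bar> \<le> L * \<bar>s\<bar>"
    if r: "ball x r \<subseteq> S" and s: "s \<noteq> 0" "\<bar>s\<bar> < r" for t x r s
  proof -
    have inS: "x + \<theta> *\<^sub>R b \<in> S" if "\<bar>\<theta>\<bar> \<le> \<bar>s\<bar>" for \<theta>
      using that s r nb by (intro subsetD[OF r]) (simp add: dist_norm)
    have "has_partial_at b (v t) (x + \<theta> *\<^sub>R b)" if "\<bar>\<theta>\<bar> \<le> \<bar>s\<bar>" for \<theta>
      using bd[of t] b inS[OF that] unfolding Ck_bounded_Suc by simp
    then obtain \<theta> where \<theta>: "\<bar>\<theta>\<bar> \<le> \<bar>s\<bar>" "v t (x + s *\<^sub>R b) - v t x = s * partial b (v t) (x + \<theta> *\<^sub>R b)"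
      using partial_mvt[of s b "v t" x] by blast
    have "Q (v t) x s = partial b (v t) (x + \<theta> *\<^sub>R b)" using \<theta>(2) s by (simp add: Q_def)
    also have "\<bar>\<dots> - partial b (v t) x\<bar> \<le> L * dist (x + \<theta> *\<^sub>R b) x"
      using inS[OF \<theta>(1)] inS[of 0] by (intro lip) auto
    also have "\<dots> \<le> L * \<bar>s\<bar>" using \<theta>(1) nb L0 by (intro mult_left_mono) (auto simp: dist_norm)
    finally show ?thesis .
  qed
  have Qlim: "((\<lambda>t. Q (v t) x s) \<longlongrightarrow> Q w x s) F" if r: "ball x r \<subseteq> S" "\<bar>s\<bar> < r" for x r s
  proof -
    have "x + s *\<^sub>R b \<in> S" "x \<in> S" using r nb by (auto intro!: subsetD[OF r(1)] simp: dist_norm)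
    then show ?thesis
      unfolding Q_def divide_inverse
      by (intro tendsto_mult_right tendsto_diff tendsto_uniform_limitI[OF lim])
  qed
  have Qw: "\<bar>Q w x s - Q w x s'\<bar> \<le> L * \<bar>s\<bar> + L * \<bar>s'\<bar>"
    if r: "ball x r \<subseteq> S" "s \<noteq> 0" "\<bar>s\<bar> < r" "s' \<noteq> 0" "\<bar>s'\<bar> < r" for x r s s'
  proof (rule tendsto_upperbound[OF _ _ F])
    show "((\<lambda>t. \<bar>Q (v t) x s - Q (v t) x s'\<bar>) \<longlongrightarrow> \<bar>Q w x s - Q w x s'\<bar>) F"
      using r by (intro tendsto_intros Qlim[of x r])
    show "\<forall>\<^sub>F t in F. \<bar>Q (v t) x s - Q (v t) x s'\<bar> \<le> L * \<bar>s\<bar> + L * \<bar>s'\<bar>"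
    proof (rule always_eventually, rule allI)
      fix t
      show "\<bar>Q (v t) x s - Q (v t) x s'\<bar> \<le> L * \<bar>s\<bar> + L * \<bar>s'\<bar>"
        using quot[OF r(1,2,3), of t] quot[OF r(1,4,5), of t] by linarith
    qed
  qed
  have deriv: "has_partial_at b w x \<and> \<bar>Q w x s - partial b w x\<bar> \<le> L * \<bar>s\<bar>"
    if r: "ball x r \<subseteq> S" and s: "s \<noteq> 0" "\<bar>s\<bar> < r" for x r s
  proof -
    have r0: "r > 0" using s by linarith
    define X where "X = (\<lambda>n. r * inverse (real (n + 2)))"
    have X: "0 < X n" "\<bar>X n\<bar> < r" for n
      using r0 by (simp_all add: X_def abs_mult field_simps add_pos_nonneg)
    have X0: "X \<longlonglongrightarrow> 0"
      unfolding X_def using LIMSEQ_ignore_initial_segment[OF lim_inverse_n', of 2]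
      by (intro tendsto_mult_right_zero) (simp add: inverse_eq_divide)
    then have LX0: "(\<lambda>n. L * \<bar>X n\<bar>) \<longlonglongrightarrow> L * \<bar>0\<bar>"
      by (intro tendsto_intros)
    have "Cauchy (\<lambda>n. Q w x (X n))"
    proof (rule metric_CauchyI)
      fix e :: real assume "e > 0"
      then obtain N where N: "\<And>n. n \<ge> N \<Longrightarrow> L * \<bar>X n\<bar> < e / 2"
        using order_tendstoD(2)[OF LX0, of "e / 2"] by (auto simp: eventually_sequentially)
      have "dist (Q w x (X m)) (Q w x (X n)) < e" if "m \<ge> N" "n \<ge> N" for m n
        using Qw[OF r, of "X m" "X n"] X[of m] X[of n] N[OF that(1)] N[OF that(2)]
        unfolding dist_real_def by linarith
      then show "\<exists>N. \<forall>m\<ge>N. \<forall>n\<ge>N. dist (Q w x (X m)) (Q w x (X n)) < e" by blast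
    qed
    then obtain D where D: "(\<lambda>n. Q w x (X n)) \<longlonglongrightarrow> D"
      using Cauchy_convergent convergent_def by blast
    have QD: "\<bar>Q w x s - D\<bar> \<le> L * \<bar>s\<bar>" if s: "s \<noteq> 0" "\<bar>s\<bar> < r" for s
    proof (rule LIMSEQ_le)
      show "(\<lambda>n. \<bar>Q w x s - Q w x (X n)\<bar>) \<longlonglongrightarrow> \<bar>Q w x s - D\<bar>"
        by (intro tendsto_intros D)
      show "(\<lambda>n. L * \<bar>s\<bar> + L * \<bar>X n\<bar>) \<longlonglongrightarrow> L * \<bar>s\<bar>"
        using tendsto_add[OF tendsto_const LX0] by simp
      show "\<exists>N. \<forall>n\<ge>N. \<bar>Q w x s - Q w x (X n)\<bar> \<le> L * \<bar>s\<bar> + L * \<bar>X n\<bar>"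
        using Qw[OF r s] X by (metis less_irrefl)
    qed
    have "((\<lambda>s. Q w x s - D) \<longlongrightarrow> 0) (at 0)"
    proof (rule Lim_null_comparison)
      show "\<forall>\<^sub>F s in at 0. norm (Q w x s - D) \<le> L * \<bar>s\<bar>"
        unfolding eventually_at using r0 QD by (intro exI[of _ r]) simp
      show "((\<lambda>s. L * \<bar>s\<bar>) \<longlongrightarrow> 0) (at 0)"
        by (rule tendsto_mult_right_zero) (simp add: tendsto_rabs_zero)
    qed
    then have "((\<lambda>s. w (x + s *\<^sub>R b)) has_real_derivative D) (at 0)"
      by (simp add: DERIV_def Q_def LIM_zero_iff)
    from partial_eqI[of w, OF this] show ?thesis using QD[OF s] by simp
  qed
  have ballS: "\<exists>r>0. ball x r \<subseteq> S" if "x \<in> S" for x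
    using S(1) that by (auto simp: open_contains_ball)
  show "\<forall>x\<in>S. has_partial_at b w x"
  proof
    fix x assume "x \<in> S"
    then obtain r where "r > 0" "ball x r \<subseteq> S" using ballS by blast
    then show "has_partial_at b w x" using deriv[of x r "r / 2"] by simp
  qed
  have near: "\<bar>partial b (v t) x - partial b w x\<bar> \<le> 2 * L * \<bar>s\<bar> + \<bar>Q (v t) x s - Q w x s\<bar>"
    if "ball x r \<subseteq> S" "s \<noteq> 0" "\<bar>s\<bar> < r" for t x r s
    using quot[OF that, of t] deriv[OF that] by linarith
  have ptw: "((\<lambda>t. partial b (v t) x) \<longlongrightarrow> partial b w x) F" if x: "x \<in> S" for x
  proof (rule tendstoI)
    fix e :: real assume e: "e > 0"
    obtain r where r: "r > 0" "ball x r \<subseteq> S" using ballS[OF x] by blast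
    define s where "s = min (r / 2) (e / (4 * L + 4))"
    have "s > 0" using r(1) e L0 by (simp add: s_def)
    moreover have "s \<le> r / 2" unfolding s_def by (rule min.cobounded1)
    ultimately have s: "s \<noteq> 0" "\<bar>s\<bar> < r" "s > 0" using r(1) by auto
    have "s \<le> e / (4 * L + 4)" unfolding s_def by (rule min.cobounded2)
    then have "s * (4 * L + 4) \<le> e"
      by (rule pos_le_divide_eq[THEN iffD1, rotated]) (use L0 in simp)
    then have small: "2 * L * \<bar>s\<bar> < e / 2" using s(3) by (simp add: algebra_simps)
    have "\<forall>\<^sub>F t in F. dist (Q (v t) x s) (Q w x s) < e / 2"
      using tendstoD[OF Qlim[OF r(2) s(2)], of "e / 2"] e by simp
    then show "\<forall>\<^sub>F t in F. dist (partial b (v t) x) (partial b w x) < e"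
    proof eventually_elim
      case (elim t)
      then show ?case
        using near[OF r(2) s(1,2), of t] small unfolding dist_real_def by linarith
    qed
  qed
  have lipw: "\<bar>partial b w x - partial b w y\<bar> \<le> L * dist x y" if "x \<in> S" "y \<in> S" for x y
  proof (rule tendsto_upperbound[OF _ _ F])
    show "((\<lambda>t. \<bar>partial b (v t) x - partial b (v t) y\<bar>) \<longlongrightarrow> \<bar>partial b w x - partial b w y\<bar>) F"
      using that by (intro tendsto_intros ptw)
  qed (use lip[OF that] in simp)
  show "uniform_limit S (\<lambda>t. partial b (v t)) (partial b w) F"
  proof (rule uniform_limitI)
    fix e :: real assume e: "e > 0"
    \<comment> \<open>Moving inwards by \<open>\<delta>\<close> and replacing derivatives by quotients cost \<open>3 L \<delta>\<close>, the quotients \<open>2 \<eta> / s\<close>.\<close>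
    define \<delta> where "\<delta> = min (1 / 2) (e / (8 * L + 8))"
    have "\<delta> \<le> 1 / 2" unfolding \<delta>_def by (rule min.cobounded1)
    moreover have "0 < \<delta>" using e L0 by (simp add: \<delta>_def)
    ultimately have \<delta>: "0 < \<delta>" "\<delta> < 1" by auto
    have "\<delta> \<le> e / (8 * L + 8)" unfolding \<delta>_def by (rule min.cobounded2)
    then have "\<delta> * (8 * L + 8) \<le> e"
      by (rule pos_le_divide_eq[THEN iffD1, rotated]) (use L0 in simp)
    then have "8 * (L * \<delta>) + 8 * \<delta> \<le> e" by (simp add: algebra_simps)
    moreover have "0 \<le> L * \<delta>" using L0 \<delta>(1) by simp
    ultimately have small: "3 * (L * \<delta>) < e / 2" using \<delta>(1) by linarith
    define s where "s = \<delta> / 2"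
    define \<eta> where "\<eta> = e * s / 8"
    have \<eta>: "\<eta> > 0" using e \<delta> by (simp add: \<eta>_def s_def)
    show "\<forall>\<^sub>F t in F. \<forall>x\<in>S. dist (partial b (v t) x) (partial b w x) < e"
      using uniform_limitD[OF lim \<eta>]
    proof eventually_elim
      case (elim t)
      show ?case
      proof
        fix x assume x: "x \<in> S"
        obtain y where y: "dist x y \<le> \<delta>" "ball y \<delta> \<subseteq> S"
          using S(3) x \<delta> unfolding uniformly_thick_def by blast
        have s: "s \<noteq> 0" "\<bar>s\<bar> < \<delta>" "s > 0" using \<delta> by (auto simp: s_def)
        have yS: "y \<in> S" "y + s *\<^sub>R b \<in> S"
          using \<delta>(1) s nb by (intro subsetD[OF y(2)]; simp add: dist_norm)+
        have "\<bar>(v t (y + s *\<^sub>R b) - w (y + s *\<^sub>R b)) - (v t y - w y)\<bar> \<le> 2 * \<eta>"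
        proof -
          have "\<bar>v t y - w y\<bar> < \<eta>" "\<bar>v t (y + s *\<^sub>R b) - w (y + s *\<^sub>R b)\<bar> < \<eta>"
            using elim yS unfolding dist_real_def by blast+
          then show ?thesis by linarith
        qed
        then have "\<bar>(v t (y + s *\<^sub>R b) - w (y + s *\<^sub>R b)) - (v t y - w y)\<bar> / s \<le> e / 4"
          using s(3) by (simp add: \<eta>_def field_simps)
        moreover have "Q (v t) y s - Q w y s =
            ((v t (y + s *\<^sub>R b) - w (y + s *\<^sub>R b)) - (v t y - w y)) / s"
          by (simp add: Q_def diff_divide_distrib)
        ultimately have "\<bar>Q (v t) y s - Q w y s\<bar> \<le> e / 4"
          using s(3) by (simp add: abs_divide)
        then have "\<bar>partial b (v t) y - partial b w y\<bar> \<le> L * \<delta> + e / 4"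
          using near[OF y(2) s(1,2), of t] s(3) by (simp add: s_def)
        moreover have "\<bar>partial b (v t) x - partial b (v t) y\<bar> \<le> L * \<delta>"
          using lip[OF x yS(1), of t] mult_left_mono[OF y(1) L0] by linarith
        moreover have "\<bar>partial b w x - partial b w y\<bar> \<le> L * \<delta>"
          using lipw[OF x yS(1)] mult_left_mono[OF y(1) L0] by linarith
        ultimately show "dist (partial b (v t) x) (partial b w x) < e"
          using small e unfolding dist_real_def by linarith
      qed
    qed
  qed
qed

lemma uniform_limit_partials:
  fixes v :: "'i \<Rightarrow> 'a::euclidean_space \<Rightarrow> real"
  assumes S: "open S" "convex S" "uniformly_thick S" and F: "F \<noteq> bot"
    and "\<And>t. Ck_bounded (Suc k) S C (v t)" and "uniform_limit S v w F"
  shows "Ck_on k S w \<and> (\<forall>bs \<in> lists Basis. length bs \<le> k \<longrightarrow>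
           uniform_limit S (\<lambda>t. partials bs (v t)) (partials bs w) F)"
  using assms(5,6)
proof (induction k arbitrary: v w)
  case 0
  have "continuous_on S w"
    using 0 by (intro uniform_limit_theorem[OF _ _ F, of S v w]) (auto simp: Ck_bounded_Suc)
  then show ?case using 0 by (auto simp: partials_simps)
next
  case (Suc k)
  have w: "continuous_on S w"
    using Suc.prems by (intro uniform_limit_theorem[OF _ _ F, of S v w]) (auto simp: Ck_bounded_Suc)
  have bd2: "Ck_bounded (Suc (Suc 0)) S C (v t)" for t
    using Suc.prems(1)[of t] by (rule Ck_bounded_mono) auto
  note step = uniform_limit_partial[OF S bd2 Suc.prems(2) F]
  have IH: "Ck_on k S (partial b w) \<and> (\<forall>bs \<in> lists Basis. length bs \<le> k \<longrightarrow>
           uniform_limit S (\<lambda>t. partials bs (partial b (v t))) (partials bs (partial b w)) F)"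
    if b: "b \<in> Basis" for b
  proof (rule Suc.IH)
    show "Ck_bounded (Suc k) S C (partial b (v t))" for t
      using Suc.prems(1)[of t] b unfolding Ck_bounded_Suc[of "Suc k"] by simp
  qed (rule step(2)[OF b])
  have "uniform_limit S (\<lambda>t. partials bs (v t)) (partials bs w) F"
    if "bs \<in> lists Basis" "length bs \<le> Suc k" for bs
    using that IH Suc.prems(2) by (cases bs rule: rev_cases) (auto simp: partials_simps)
  then show ?case using w step(1) IH by (simp add: Ck_on_Suc)
qed

text \<open>
  This is an interpolation statement: bounds on \<open>k + 1\<close> derivatives turn uniform smallness into
  smallness of \<open>k\<close> derivatives.
\<close>

lemma uniform_limit_Ck_bounded:
  fixes v :: "'i \<Rightarrow> 'a::euclidean_space \<Rightarrow> real"
  assumes S: "open S" "convex S" "uniformly_thick S" and F: "F \<noteq> bot"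
    and v: "\<And>t. Ck_bounded (Suc k) S C (v t)" and lim: "uniform_limit S v w F"
  shows "Ck_bounded k S C w"
    and "e > 0 \<Longrightarrow> \<forall>\<^sub>F t in F. Ck_bounded k S e (\<lambda>x. v t x - w x)"
proof -
  note * = uniform_limit_partials[OF S F v lim]
  have v': "Ck_bounded k S C (v t)" for t
    using v[of t] by (rule Ck_bounded_mono) auto
  have "\<bar>partials bs w x\<bar> \<le> C" if "bs \<in> lists Basis" "length bs \<le> k" "x \<in> S" for bs x
  proof (rule tendsto_upperbound[OF _ _ F])
    show "((\<lambda>t. \<bar>partials bs (v t) x\<bar>) \<longlongrightarrow> \<bar>partials bs w x\<bar>) F"
      using * that by (intro tendsto_rabs tendsto_uniform_limitI[where S = S]) auto
    show "\<forall>\<^sub>F t in F. \<bar>partials bs (v t) x\<bar> \<le> C"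
      using v' that unfolding Ck_bounded_def by simp
  qed
  then show "Ck_bounded k S C w" using * by (auto simp: Ck_bounded_def)
  assume e: "e > 0"
  have fin: "finite {bs \<in> lists (Basis :: 'a set). length bs \<le> k}"
    using finite_lists_length_le[of "Basis :: 'a set" k] by (simp add: in_lists_conv_set subset_iff Ball_def)
  have "\<forall>\<^sub>F t in F. \<forall>x\<in>S. dist (partials bs (v t) x) (partials bs w x) < e"
    if "bs \<in> {bs \<in> lists (Basis :: 'a set). length bs \<le> k}" for bs
    using * that e by (auto intro: uniform_limitD)
  then have "\<forall>\<^sub>F t in F. \<forall>bs\<in>{bs \<in> lists (Basis :: 'a set). length bs \<le> k}.
      \<forall>x\<in>S. dist (partials bs (v t) x) (partials bs w x) < e"
    unfolding eventually_ball_finite_distrib[OF fin] by blast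
  then show "\<forall>\<^sub>F t in F. Ck_bounded k S e (\<lambda>x. v t x - w x)"
  proof eventually_elim
    case (elim t)
    have Ck: "Ck_on k S (v t)" "Ck_on k S w" using v' * by (auto simp: Ck_bounded_def)
    show ?case
      unfolding Ck_bounded_def
    proof (intro conjI ballI impI)
      show "Ck_on k S (\<lambda>x. v t x - w x)"
        using Ck_on_lincomb(1)[OF S(1) Ck, of "-1"] by simp
      fix bs :: "'a list" and x assume bs: "bs \<in> lists Basis" "length bs \<le> k" "x \<in> S"
      have "partials bs (\<lambda>x. v t x - w x) x = partials bs (v t) x - partials bs w x"
        using Ck_on_lincomb(2)[OF S(1) Ck bs, of "-1"] by simp
      then show "\<bar>partials bs (\<lambda>x. v t x - w x) x\<bar> \<le> e"
        using elim bs by (fastforce simp: dist_real_def)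
    qed
  qed
qed

section \<open>Hoelder norms\<close>

text \<open>
  One derivative more than \<open>\<lfloor>\<sigma>\<rfloor>\<close> controls the Hoelder quotient: at distance at most \<open>1\<close> by the Lipschitz
  bound, at larger distances by the supremum.
\<close>

lemma holder_norm_le_Ck_bounded:
  fixes f :: "'a::euclidean_space \<Rightarrow> real"
  assumes S: "open S" "convex S" and f: "Ck_bounded (Suc (nat \<lfloor>\<sigma>\<rfloor>)) S A f" and A: "A \<ge> 0"
  shows "holder_norm \<sigma> S f \<le> ennreal ((real DIM('a) + 3) * A)"
proof -
  define k where "k = nat \<lfloor>\<sigma>\<rfloor>"
  define D where "D = real DIM('a)"
  have D: "D \<ge> 0" by (simp add: D_def)
  have "sup_norm S (partials bs f) \<le> ennreal A" if "bs \<in> lists Basis" "length bs \<le> k" for bs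
    unfolding sup_norm_def using f that
    by (intro SUP_least ennreal_leI) (auto simp: Ck_bounded_def k_def)
  then have sup: "(SUP bs \<in> {bs \<in> lists Basis. length bs \<le> k}. sup_norm S (partials bs f)) \<le> ennreal A"
    by (intro SUP_least) auto
  have "holder_seminorm (frac \<sigma>) S (partials bs f) \<le> ennreal ((D + 2) * A)"
    if bs: "bs \<in> lists Basis" "length bs = k" for bs
    unfolding holder_seminorm_def
  proof (rule SUP_least, clarify)
    fix x y assume xy: "x \<in> S" "y \<in> S" "x \<noteq> y"
    define g where "g = partials bs f"
    have mu: "0 \<le> frac \<sigma>" "frac \<sigma> < 1" by (simp_all add: frac_lt_1)
    have "Ck_bounded (Suc 0) S A g"
      unfolding Ck_bounded_Suc Ck_bounded_0 g_def partials_simps(2)[symmetric]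
      using f bs unfolding Ck_bounded_def Ck_on_def k_def by auto
    note lip = Ck_bounded_lipschitz[OF S this xy(1,2)]
    have bd: "\<bar>g x - g y\<bar> \<le> 2 * A"
    proof -
      have "\<bar>g x\<bar> \<le> A" "\<bar>g y\<bar> \<le> A"
        using f bs xy unfolding Ck_bounded_def k_def g_def by auto
      then show ?thesis by linarith
    qed
    have d: "dist x y > 0" using xy by simp
    have "\<bar>g x - g y\<bar> \<le> (D + 2) * A * dist x y powr frac \<sigma>"
    proof (cases "dist x y \<le> 1")
      case True
      have "dist x y powr 1 \<le> dist x y powr frac \<sigma>"
        using True d mu by (intro powr_mono') auto
      then have "D * A * dist x y \<le> D * A * dist x y powr frac \<sigma>"
        using d A D by (intro mult_left_mono) auto
      also have "\<dots> \<le> (D + 2) * A * dist x y powr frac \<sigma>"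
        using A by (intro mult_right_mono) auto
      finally show ?thesis using lip by (simp add: D_def)
    next
      case False
      then have "1 \<le> dist x y powr frac \<sigma>" using mu by (intro ge_one_powr_ge_zero) auto
      then have "2 * A * 1 \<le> (D + 2) * A * dist x y powr frac \<sigma>"
        using A D by (intro mult_mono) auto
      then show ?thesis using bd by simp
    qed
    then show "ennreal (\<bar>partials bs f x - partials bs f y\<bar> / dist x y powr frac \<sigma>) \<le> ennreal ((D + 2) * A)"
      using d unfolding g_def by (intro ennreal_leI) (simp add: pos_divide_le_eq)
  qed
  then have "(SUP bs \<in> {bs \<in> lists Basis. length bs = k}. holder_seminorm (frac \<sigma>) S (partials bs f))
      \<le> ennreal ((D + 2) * A)"
    by (intro SUP_least) auto
  then have "(if frac \<sigma> = 0 then 0 else SUP bs \<in> {bs \<in> lists Basis. length bs = k}.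
      holder_seminorm (frac \<sigma>) S (partials bs f)) \<le> ennreal ((D + 2) * A)"
    by simp
  from add_mono[OF sup this] have "holder_norm \<sigma> S f \<le> ennreal A + ennreal ((D + 2) * A)"
    unfolding holder_norm_def k_def[symmetric] .
  also have "\<dots> = ennreal ((real DIM('a) + 3) * A)"
    using A D by (simp add: ennreal_plus[symmetric] D_def algebra_simps del: ennreal_plus)
  finally show ?thesis .
qed

lemma holder_class_of_Ck_bounded:
  fixes f :: "'a::euclidean_space \<Rightarrow> real"
  assumes "open S" "convex S" "Ck_bounded (Suc (nat \<lfloor>\<sigma>\<rfloor>)) S A f" "A \<ge> 0"
  shows "holder_class \<sigma> S f"
proof -
  have "holder_norm \<sigma> S f < \<infinity>"
    using le_less_trans[OF holder_norm_le_Ck_bounded[OF assms] ennreal_less_top] by simp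
  moreover have "Ck_on (nat \<lfloor>\<sigma>\<rfloor>) S f"
    using assms(3) Ck_on_mono unfolding Ck_bounded_def by (metis le_SucI order.refl)
  ultimately show ?thesis by (simp add: holder_class_def)
qed

lemma partials_le_holder_norm:
  assumes "bs \<in> lists Basis" "length bs \<le> nat \<lfloor>\<sigma>\<rfloor>" "x \<in> S"
  shows "ennreal \<bar>partials bs f x\<bar> \<le> holder_norm \<sigma> S f"
proof -
  have "ennreal \<bar>partials bs f x\<bar> \<le> sup_norm S (partials bs f)"
    unfolding sup_norm_def using assms(3) by (rule SUP_upper)
  also have "\<dots> \<le> (SUP bs \<in> {bs \<in> lists Basis. length bs \<le> nat \<lfloor>\<sigma>\<rfloor>}. sup_norm S (partials bs f))"
    using assms(1,2) by (intro SUP_upper) auto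
  also have "\<dots> \<le> holder_norm \<sigma> S f" by (simp add: holder_norm_def)
  finally show ?thesis .
qed

section \<open>The perturbation as a function of time\<close>

lemma axis_in_Basis: "axis i (1::real) \<in> Basis"
  by (auto simp: Basis_vec_def)

lemma Basis_vecE:
  assumes "c \<in> (Basis :: (real ^ 'n) set)"
  obtains i where "c = axis i 1"
  using assms by (auto simp: Basis_vec_def)

lemma q_in_Basis: "(axis i 1, 0) \<in> (Basis :: 'n::finite phase set)"
  by (auto simp: Basis_prod_def axis_in_Basis)

lemma phase_BasisE:
  assumes "d \<in> (Basis :: 'n::finite phase set)"
  obtains i where "d = (axis i 1, 0)" | i where "d = (0, axis i 1)"
  using assms by (auto simp: Basis_prod_def elim!: Basis_vecE)

lemma dq_eq: "(\<lambda>x. dq i f x t) = partial (axis i 1, 0) (\<lambda>x. f x t)"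
  and dp_eq: "(\<lambda>x. dp i f x t) = partial (0, axis i 1) (\<lambda>x. f x t)"
  by (simp_all add: fun_eq_iff dq_def dp_def)

lemma B_norm_bounds:
  assumes "B_norm B s a g \<le> ennreal \<epsilon>" "\<epsilon> \<ge> 0" "p \<in> B"
  shows "a \<noteq> 0 \<Longrightarrow> cs \<in> lists Basis \<Longrightarrow> length cs \<le> nat \<lfloor>s\<rfloor> \<Longrightarrow>
           \<bar>partials cs (\<lambda>q. g (q, p) t) q\<bar> \<le> \<epsilon> / (1 + \<bar>t\<bar> powr a)"
    and "a \<noteq> 1 \<Longrightarrow> \<bar>dp i g (q, p) t\<bar> \<le> \<epsilon> / (1 + \<bar>t\<bar> powr (a - 1))"
proof -
  have pos: "1 + \<bar>t\<bar> powr b > 0" for b by (simp add: add_pos_nonneg)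
  have divide: "x \<le> \<epsilon> / (1 + \<bar>t\<bar> powr b)" if "ennreal x * weight b t \<le> ennreal \<epsilon>" "b \<noteq> 0" "x \<ge> 0" for x b
  proof -
    have "ennreal x * weight b t = ennreal (x * (1 + \<bar>t\<bar> powr b))"
      using that pos[of b] by (simp add: weight_def ennreal_mult less_imp_le)
    then have "x * (1 + \<bar>t\<bar> powr b) \<le> \<epsilon>" using that(1) assms(2) by simp
    then show ?thesis using pos[of b] by (simp add: pos_le_divide_eq)
  qed
  show "\<bar>partials cs (\<lambda>q. g (q, p) t) q\<bar> \<le> \<epsilon> / (1 + \<bar>t\<bar> powr a)"
    if a: "a \<noteq> 0" and cs: "cs \<in> lists Basis" "length cs \<le> nat \<lfloor>s\<rfloor>"
  proof (rule divide[OF _ a])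
    have "ennreal \<bar>partials cs (\<lambda>q. g (q, p) t) q\<bar> * weight a t \<le>
        holder_norm s UNIV (\<lambda>q. g (q, p) t) * weight a t"
      by (intro mult_right_mono partials_le_holder_norm cs) auto
    also have "\<dots> \<le> (SUP (p, t) \<in> B \<times> UNIV. holder_norm s UNIV (\<lambda>q. g (q, p) t) * weight a t)"
      using assms(3) by (intro SUP_upper2[of "(p, t)"]) auto
    also have "\<dots> \<le> B_norm B s a g" by (simp add: B_norm_def)
    also have "\<dots> \<le> ennreal \<epsilon>" by fact
    finally show "ennreal \<bar>partials cs (\<lambda>q. g (q, p) t) q\<bar> * weight a t \<le> ennreal \<epsilon>" .
  qed simp
  show "\<bar>dp i g (q, p) t\<bar> \<le> \<epsilon> / (1 + \<bar>t\<bar> powr (a - 1))" if a: "a \<noteq> 1"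
  proof (rule divide)
    have "ennreal \<bar>dp i g (q, p) t\<bar> \<le> sup_norm UNIV (\<lambda>q. dp i g (q, p) t)"
      unfolding sup_norm_def by (intro SUP_upper) auto
    also have "\<dots> \<le> (SUP i. sup_norm UNIV (\<lambda>q. dp i g (q, p) t))"
      by (intro SUP_upper) auto
    finally have "ennreal \<bar>dp i g (q, p) t\<bar> * weight (a - 1) t \<le>
        (SUP i. sup_norm UNIV (\<lambda>q. dp i g (q, p) t)) * weight (a - 1) t"
      by (intro mult_right_mono) auto
    also have "\<dots> \<le> (SUP (p, t) \<in> B \<times> UNIV. (SUP i. sup_norm UNIV (\<lambda>q. dp i g (q, p) t)) * weight (a - 1) t)"
      using assms(3) by (intro SUP_upper2[of "(p, t)"]) auto
    also have "\<dots> \<le> B_norm B s a g" by (simp add: B_norm_def)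
    also have "\<dots> \<le> ennreal \<epsilon>" by fact
    finally show "ennreal \<bar>dp i g (q, p) t\<bar> * weight (a - 1) t \<le> ennreal \<epsilon>" .
  qed (use a in auto)
qed

lemma B_norm_le_Bbar_norm: "B_norm B (\<sigma> + real k) l g \<le> Bbar_norm B \<sigma> k l g"
  unfolding Bbar_norm_def by (rule SUP_upper2[of "[]"]) (auto simp: dqs_def)

definition decay :: "real \<Rightarrow> real \<Rightarrow> real \<Rightarrow> real" where
  "decay \<epsilon> a t = \<epsilon> / (1 + \<bar>t\<bar> powr a)"

lemma decay_le: "\<epsilon> \<ge> 0 \<Longrightarrow> decay \<epsilon> a t \<le> \<epsilon>"
  by (simp add: decay_def divide_le_eq add_pos_nonneg mult_le_cancel_left1)

lemma decay_tendsto_0: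
  assumes "a > 0" "\<epsilon> \<ge> 0"
  shows "(decay \<epsilon> a \<longlongrightarrow> 0) at_top" "(decay \<epsilon> a \<longlongrightarrow> 0) at_bot"
proof -
  have top: "((\<lambda>t. \<epsilon> * t powr - a) \<longlongrightarrow> 0) at_top"
    using assms by (intro tendsto_mult_right_zero tendsto_neg_powr filterlim_ident) auto
  have le: "norm (decay \<epsilon> a t) \<le> \<epsilon> * t powr - a" if "t > 0" for t
    using that assms unfolding decay_def powr_minus divide_inverse[symmetric]
    by (auto intro!: divide_left_mono simp: add_pos_nonneg)
  show 1: "(decay \<epsilon> a \<longlongrightarrow> 0) at_top"
    using eventually_gt_at_top[of 0] by (intro Lim_null_comparison[OF _ top] eventually_mono[OF _ le])
  have "((\<lambda>t. decay \<epsilon> a (- t)) \<longlongrightarrow> 0) at_top"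
    using 1 by (simp add: decay_def[abs_def])
  then show "(decay \<epsilon> a \<longlongrightarrow> 0) at_bot"
    by (simp add: filterlim_at_bot_mirror)
qed

locale decaying_perturbation =
  fixes \<sigma> \<Upsilon> l \<epsilon> :: real and h :: "real ^ 'n::finite \<Rightarrow> real" and f H :: "'n phase \<Rightarrow> real \<Rightarrow> real"
  assumes \<sigma>: "\<sigma> \<ge> 1" and \<Upsilon>: "\<Upsilon> \<ge> 1" and l: "l > 1" and \<epsilon>: "0 < \<epsilon>"
    and adm: "admissible \<sigma> \<Upsilon> l \<epsilon> h f H"
begin

definition N :: nat where "N = nat \<lfloor>\<sigma>\<rfloor>"

definition S :: "'n phase set" where "S = UNIV \<times> ball 0 1"

definition h' :: "'n phase \<Rightarrow> real \<Rightarrow> real" where "h' x t = h (snd x)"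

lemma S: "open S" "convex S" "uniformly_thick S"
  unfolding S_def by (auto intro: open_Times convex_Times uniformly_thick_cylinder)

lemma floor_\<sigma>: "nat (\<lfloor>\<sigma>\<rfloor> + 2) = Suc (Suc N)" "nat (\<lfloor>\<sigma>\<rfloor> + 1) = Suc N"
proof -
  have "0 \<le> \<lfloor>\<sigma>\<rfloor>" using \<sigma> by simp
  then show "nat (\<lfloor>\<sigma>\<rfloor> + 2) = Suc (Suc N)" "nat (\<lfloor>\<sigma>\<rfloor> + 1) = Suc N"
    by (simp_all add: N_def nat_add_distrib)
qed

lemma H_eq: "x \<in> S \<Longrightarrow> H x t = h' x t + f x t"
  using adm by (auto simp: admissible_def S_def h'_def)

lemma perturbation_in_B_space:
  "f \<in> B_space (ball 0 1) (\<sigma> + 2)" "dp j f \<in> B_space (ball 0 1) (\<sigma> + 2)"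
  "dq i f \<in> B_space (ball 0 1) (\<sigma> + 1)"
proof -
  have *: "dqs js g \<in> B_space (ball 0 1) (\<sigma> + real 2 - real (length js))"
    if "g \<in> Bbar_space (ball 0 1) \<sigma> 2" "length js \<le> 2" for g :: "'n phase \<Rightarrow> real \<Rightarrow> real" and js
    using that unfolding Bbar_space_def by blast
  have "f \<in> Bbar_space (ball 0 1) \<sigma> 2" "dp j f \<in> Bbar_space (ball 0 1) \<sigma> 2"
    using adm by (auto simp: admissible_def)
  from *[OF this(1), of "[]"] *[OF this(2), of "[]"] *[OF this(1), of "[i]"]
  show "f \<in> B_space (ball 0 1) (\<sigma> + 2)" "dp j f \<in> B_space (ball 0 1) (\<sigma> + 2)"
    "dq i f \<in> B_space (ball 0 1) (\<sigma> + 1)"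
    by (simp_all add: dqs_def add.commute)
qed

lemma perturbation_decay:
  assumes "p \<in> ball 0 1"
  shows "cs \<in> lists Basis \<Longrightarrow> length cs \<le> Suc N \<Longrightarrow>
           \<bar>partials cs (\<lambda>q. dq i f (q, p) t) q\<bar> \<le> decay \<epsilon> (l + 2) t"
    and "cs \<in> lists Basis \<Longrightarrow> length cs \<le> Suc (Suc N) \<Longrightarrow>
           \<bar>partials cs (\<lambda>q. dp i f (q, p) t) q\<bar> \<le> decay \<epsilon> (l + 1) t"
    and "\<bar>dp j (dp i f) (q, p) t\<bar> \<le> decay \<epsilon> l t"
proof -
  define X where "X = B_norm0 (ball 0 1) (\<sigma> + 2) f"
  define Y where "Y = (SUP i. Bbar_norm (ball 0 1) \<sigma> 1 (l + 2) (dq i f))"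
  define Z where "Z = (SUP i. Bbar_norm (ball 0 1) \<sigma> 2 (l + 1) (dp i f))"
  have sum: "X + Y + Z \<le> ennreal \<epsilon>"
    using adm by (simp add: admissible_def X_def Y_def Z_def less_imp_le)
  have "B_norm (ball 0 1) (\<sigma> + real 1) (l + 2) (dq i f) \<le> Y"
    unfolding Y_def by (rule order.trans[OF B_norm_le_Bbar_norm]) (rule SUP_upper, simp)
  also have "Y \<le> X + Y + Z" by (simp add: add.commute add.left_commute add_increasing2)
  also note sum
  finally have q: "B_norm (ball 0 1) (\<sigma> + 1) (l + 2) (dq i f) \<le> ennreal \<epsilon>" by simp
  have "B_norm (ball 0 1) (\<sigma> + real 2) (l + 1) (dp i f) \<le> Z"
    unfolding Z_def by (rule order.trans[OF B_norm_le_Bbar_norm]) (rule SUP_upper, simp)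
  also have "Z \<le> X + Y + Z" by (simp add: add_increasing)
  also note sum
  finally have p: "B_norm (ball 0 1) (\<sigma> + 2) (l + 1) (dp i f) \<le> ennreal \<epsilon>" by simp
  show "\<bar>partials cs (\<lambda>q. dq i f (q, p) t) q\<bar> \<le> decay \<epsilon> (l + 2) t"
    if "cs \<in> lists Basis" "length cs \<le> Suc N"
    using B_norm_bounds(1)[OF q _ assms, of cs t q] that l \<epsilon> by (simp add: decay_def floor_\<sigma>)
  show "\<bar>partials cs (\<lambda>q. dp i f (q, p) t) q\<bar> \<le> decay \<epsilon> (l + 1) t"
    if "cs \<in> lists Basis" "length cs \<le> Suc (Suc N)"
    using B_norm_bounds(1)[OF p _ assms, of cs t q] that l \<epsilon> by (simp add: decay_def floor_\<sigma>)
  show "\<bar>dp j (dp i f) (q, p) t\<bar> \<le> decay \<epsilon> l t"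
    using B_norm_bounds(2)[OF p _ assms, of j q t] l \<epsilon> by (simp add: decay_def)
qed

lemma hess_H: "Ck_bounded (Suc (Suc N)) S \<Upsilon> (\<lambda>x. dp i (dp j H) x t)"
  unfolding Ck_bounded_def
proof (intro conjI ballI impI)
  have "holder_class (\<sigma> + 2) S (\<lambda>x. dp i (dp j H) x t)"
    using adm unfolding admissible_def hess_regular_def S_def by blast
  then show "Ck_on (Suc (Suc N)) S (\<lambda>x. dp i (dp j H) x t)"
    by (simp add: holder_class_def floor_\<sigma>)
  fix bs :: "'n phase list" and x assume bs: "bs \<in> lists Basis" "length bs \<le> Suc (Suc N)" "x \<in> S"
  have "ennreal \<bar>partials bs (\<lambda>x. dp i (dp j H) x t) x\<bar> \<le> holder_norm (\<sigma> + 2) S (\<lambda>x. dp i (dp j H) x t)"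
    using bs by (intro partials_le_holder_norm) (auto simp: floor_\<sigma>)
  also have "\<dots> \<le> (SUP (i, j) \<in> UNIV. holder_norm (\<sigma> + 2) S (\<lambda>x. dp i (dp j H) x t))"
    by (rule SUP_upper2[of "(i, j)"]) auto
  also have "\<dots> \<le> (SUP t. SUP (i, j) \<in> UNIV. holder_norm (\<sigma> + 2) S (\<lambda>x. dp i (dp j H) x t))"
    by (rule SUP_upper) simp
  also have "\<dots> \<le> ennreal \<Upsilon>" using adm by (simp add: admissible_def S_def)
  finally show "\<bar>partials bs (\<lambda>x. dp i (dp j H) x t) x\<bar> \<le> \<Upsilon>" using \<Upsilon> by simp
qed

lemma has_p_partials:
  assumes "x \<in> S"
  shows "has_partial_at (0, axis i 1) (\<lambda>x. H x t) x" "has_partial_at (0, axis i 1) (\<lambda>x. dp j H x t) x"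
    "has_partial_at (0, axis i 1) (\<lambda>x. f x t) x" "has_partial_at (0, axis i 1) (\<lambda>x. dp j f x t) x"
    "has_partial_at (0, axis i 1) (\<lambda>x. dq j f x t) x"
proof -
  have *: "has_partial_at (0, axis i 1) (\<lambda>x. g x t) x"
    if "p_differentiable (ball 0 1) g" for g :: "'n phase \<Rightarrow> real \<Rightarrow> real"
    using that assms unfolding p_differentiable_def S_def by blast
  show "has_partial_at (0, axis i 1) (\<lambda>x. H x t) x" "has_partial_at (0, axis i 1) (\<lambda>x. dp j H x t) x"
    using adm by (auto simp: admissible_def hess_regular_def intro!: *)
  show "has_partial_at (0, axis i 1) (\<lambda>x. f x t) x" "has_partial_at (0, axis i 1) (\<lambda>x. dp j f x t) x"
    "has_partial_at (0, axis i 1) (\<lambda>x. dq j f x t) x"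
    using perturbation_in_B_space(1) perturbation_in_B_space(2)[of j] perturbation_in_B_space(3)[of j]
    by (auto simp: B_space_def intro!: *)
qed

lemma partial_h':
  assumes x: "x \<in> S"
  shows "has_partial_at (0, axis j 1) (\<lambda>x. h' x t) x" "dp j h' x t = dp j H x t - dp j f x t"
proof -
  have eq: "h' y t = H y t - f y t" if "y \<in> S" for y using H_eq[OF that] by simp
  have "has_partial_at (0, axis j 1) (\<lambda>x. H x t - f x t) x"
    "partial (0, axis j 1) (\<lambda>x. H x t - f x t) x = dp j H x t - dp j f x t"
    using partial_diff[OF has_p_partials(1,3)[OF x]] by (auto simp: dp_def)
  then show "has_partial_at (0, axis j 1) (\<lambda>x. h' x t) x" "dp j h' x t = dp j H x t - dp j f x t"
    using partial_cong_open[OF S(1) x, of "\<lambda>x. h' x t" "\<lambda>x. H x t - f x t"] eq by (auto simp: dp_def)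
qed

lemma partial_dp_h':
  assumes x: "x \<in> S"
  shows "has_partial_at (0, axis i 1) (\<lambda>x. dp j h' x t) x"
    "dp i (dp j h') x t = dp i (dp j H) x t - dp i (dp j f) x t"
proof -
  have "has_partial_at (0, axis i 1) (\<lambda>x. dp j H x t - dp j f x t) x"
    "partial (0, axis i 1) (\<lambda>x. dp j H x t - dp j f x t) x = dp i (dp j H) x t - dp i (dp j f) x t"
    using partial_diff[OF has_p_partials(2,4)[OF x]] by (auto simp: dp_def)
  then show "has_partial_at (0, axis i 1) (\<lambda>x. dp j h' x t) x"
    "dp i (dp j h') x t = dp i (dp j H) x t - dp i (dp j f) x t"
    using partial_cong_open[OF S(1) x, of "\<lambda>x. dp j h' x t" "\<lambda>x. dp j H x t - dp j f x t"] partial_h'(2)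
    by (auto simp: dp_def)
qed

text \<open>
  The time \<open>0\<close> is arbitrary, since \<open>h'\<close> does not depend on time.
\<close>

definition gradh :: "'n \<Rightarrow> 'n phase \<Rightarrow> real" where "gradh j x = dp j h' x 0"

definition hessh :: "'n \<Rightarrow> 'n \<Rightarrow> 'n phase \<Rightarrow> real" where "hessh i j x = dp i (dp j h') x 0"

lemma dp_h': "dp j h' x t = gradh j x"
  by (simp add: gradh_def dp_def h'_def)

lemma dp_dp_h': "dp i (dp j h') x t = hessh i j x"
  by (simp add: hessh_def dp_def h'_def)

lemma hessh_eq: "x \<in> S \<Longrightarrow> hessh i j x = dp i (dp j H) x t - dp i (dp j f) x t"
  using partial_dp_h'(2)[of x i j t] by (simp add: dp_dp_h')

lemma partial_gradh_p:
  "x \<in> S \<Longrightarrow> has_partial_at (0, axis i 1) (gradh j) x" "partial (0, axis i 1) (gradh j) = hessh i j"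
  using partial_dp_h'(1)[of x i j 0] by (auto simp: dp_h' hessh_def dp_def gradh_def[abs_def])

lemma gradh_snd: "gradh j (q, p) = gradh j (0, p)"
  by (simp add: gradh_def dp_def h'_def partial_def)

lemma partial_gradh_q: "has_partial_at (b, 0) (gradh j) x" "partial (b, 0) (gradh j) = (\<lambda>x. 0)"
proof -
  have eq: "(\<lambda>q. gradh j (q, p)) = (\<lambda>q. gradh j (0, p))" for p by (rule ext) (rule gradh_snd)
  show "has_partial_at (b, 0) (gradh j) x"
    by (cases x) (simp add: partial_slice eq partial_const)
  have "partial (b, 0) (gradh j) y = 0" for y
    by (cases y) (simp add: partial_slice eq partial_const)
  then show "partial (b, 0) (gradh j) = (\<lambda>x. 0)" by blast
qed

text \<open>
  No regularity of \<open>h\<close> is given directly. It comes from the decay of \<open>\<partial>\<^sub>p\<^sup>2 f\<close>, which exhibits the Hessian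
  of \<open>h\<close> as the uniform limit of functions with a common \<open>C\<^sup>N\<^sup>+\<^sup>2\<close> bound.
\<close>

lemma hess_H_tendsto:
  assumes "F = at_top \<or> F = at_bot"
  shows "uniform_limit S (\<lambda>t x. dp i (dp j H) x t) (hessh i j) F"
proof (rule uniform_limitI)
  fix e :: real assume e: "e > 0"
  have "(decay \<epsilon> l \<longlongrightarrow> 0) F" using assms decay_tendsto_0[of l \<epsilon>] l \<epsilon> by auto
  from order_tendstoD(2)[OF this e]
  show "\<forall>\<^sub>F t in F. \<forall>x\<in>S. dist (dp i (dp j H) x t) (hessh i j x) < e"
  proof eventually_elim
    case (elim t)
    show ?case
    proof
      fix x assume x: "x \<in> S"
      then have "\<bar>dp i (dp j f) x t\<bar> \<le> decay \<epsilon> l t"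
        using perturbation_decay(3)[of "snd x" i j "fst x" t] by (auto simp: S_def)
      then show "dist (dp i (dp j H) x t) (hessh i j x) < e"
        using elim hessh_eq[OF x, of i j t] by (simp add: dist_real_def)
    qed
  qed
qed

lemma hessh_bounded: "Ck_bounded (Suc N) S \<Upsilon> (hessh i j)"
  using uniform_limit_Ck_bounded(1)[OF S _ hess_H hess_H_tendsto, of at_top] by simp

lemma hess_f_bounded: "Ck_bounded (Suc N) S (2 * \<Upsilon>) (\<lambda>x. dp i (dp j f) x t)"
proof -
  have "Ck_bounded (Suc N) S \<Upsilon> (\<lambda>x. dp i (dp j H) x t)"
    using hess_H by (rule Ck_bounded_mono) auto
  from Ck_bounded_lincomb[OF S(1) this hessh_bounded, of "-1" i j]
  have "Ck_bounded (Suc N) S (2 * \<Upsilon>) (\<lambda>x. dp i (dp j H) x t - hessh i j x)" by simp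
  then show ?thesis
    using Ck_bounded_cong_open[OF S(1), of "\<lambda>x. dp i (dp j H) x t - hessh i j x" "\<lambda>x. dp i (dp j f) x t"]
      hessh_eq[of _ i j t] by simp
qed

lemma hess_f_small:
  assumes "F = at_top \<or> F = at_bot" "e > 0"
  shows "\<forall>\<^sub>F t in F. \<forall>i j. Ck_bounded (Suc N) S e (\<lambda>x. dp i (dp j f) x t)"
proof -
  have F: "F \<noteq> bot"
    using assms(1) by (elim disjE) (simp_all add: trivial_limit_at_top_linorder trivial_limit_at_bot_linorder)
  have "\<forall>\<^sub>F t in F. Ck_bounded (Suc N) S e (\<lambda>x. dp i (dp j f) x t)" for i j
    using uniform_limit_Ck_bounded(2)[OF S F hess_H hess_H_tendsto[OF assms(1)] assms(2), of i j]
  proof eventually_elim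
    case (elim t)
    then show ?case
      using Ck_bounded_cong_open[OF S(1), of "\<lambda>x. dp i (dp j H) x t - hessh i j x" "\<lambda>x. dp i (dp j f) x t"]
        hessh_eq[of _ i j t] by simp
  qed
  then show ?thesis by (simp add: eventually_all_finite)
qed

text \<open>
  The Hessian is of class \<open>C\<^sup>N\<^sup>+\<^sup>1\<close> only, but the gradient has no other derivatives than the Hessian, and
  is therefore one order better.
\<close>

lemma gradh_Ck: "Ck_on (Suc (Suc N)) S (gradh j)"
  unfolding Ck_on_Suc[of "Suc N"]
proof (intro conjI ballI)
  have hess: "Ck_on (Suc N) S (hessh i j)" for i using hessh_bounded by (simp add: Ck_bounded_def)
  show "continuous_on S (gradh j)"
    unfolding S_def
  proof (rule continuous_on_of_slices)
    fix p :: "real ^ 'n"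
    have "continuous_on UNIV (\<lambda>q. gradh j (q, p)) \<longleftrightarrow> continuous_on UNIV (\<lambda>q :: real ^ 'n. gradh j (0, p))"
      by (intro continuous_on_cong refl gradh_snd)
    then show "continuous_on UNIV (\<lambda>q. gradh j (q, p))" using continuous_on_const by blast
  next
    fix c :: "real ^ 'n" assume "c \<in> Basis"
    then obtain i where i: "c = axis i 1" by (rule Basis_vecE)
    show "has_partial_at (0, c) (gradh j) x" if "x \<in> UNIV \<times> ball 0 1" for x
      using partial_gradh_p(1) that by (simp add: i S_def)
    show "continuous_on (UNIV \<times> ball 0 1) (partial (0, c) (gradh j))"
      using Ck_on_continuous[OF hess] by (simp add: i partial_gradh_p(2) S_def)
  qed simp
  fix d :: "'n phase" assume d: "d \<in> Basis"
  then show "has_partial_at d (gradh j) x" if "x \<in> S" for x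
    using that by (cases rule: phase_BasisE) (auto simp: partial_gradh_q partial_gradh_p)
  show "Ck_on (Suc N) S (partial d (gradh j))"
    using d by (cases rule: phase_BasisE) (auto simp: partial_gradh_q partial_gradh_p hess Ck_on_const)
qed

lemma gradh_lipschitz:
  assumes "x \<in> S" "y \<in> S"
  shows "\<bar>gradh j x - gradh j y\<bar> \<le> real DIM('n phase) * \<Upsilon> * dist x y"
proof (rule lipschitz_of_bounded_partials[OF S(1,2) assms])
  fix d :: "'n phase" assume d: "d \<in> Basis"
  show "has_partial_at d (gradh j) x" if "x \<in> S" for x
    using gradh_Ck[of j] d that by (simp add: Ck_on_Suc)
  show "continuous_on S (partial d (gradh j))"
    using gradh_Ck[of j] d by (simp add: Ck_on_Suc)
  have "\<bar>hessh i j x\<bar> \<le> \<Upsilon>" if "x \<in> S" for x i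
    using hessh_bounded[of i j] that by (simp add: Ck_bounded_Suc)
  then show "\<bar>partial d (gradh j) x\<bar> \<le> \<Upsilon>" if "x \<in> S" for x
    using phase_BasisE[OF d] that \<Upsilon> by (metis abs_zero partial_gradh_p(2) partial_gradh_q(2) order.trans zero_le_one)
qed

text \<open>
  The gradient is bounded because the Hessian is and \<open>p\<close> ranges over a bounded convex set.
\<close>

lemma gradh_bounded: "\<exists>A\<ge>0. \<forall>j. Ck_bounded (Suc N) S A (gradh j)"
proof -
  define A where "A = real DIM('n phase) * \<Upsilon> + \<Upsilon> + (\<Sum>j\<in>UNIV. \<bar>gradh j 0\<bar>)"
  have A: "\<Upsilon> \<le> A" "0 \<le> A" using \<Upsilon> by (auto simp: A_def sum_nonneg)
  have bd: "\<bar>gradh j x\<bar> \<le> A" if "x \<in> S" for j x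
  proof -
    have x: "(0, snd x) \<in> S" "0 \<in> S" "dist (0, snd x) (0 :: 'n phase) \<le> 1"
      using that by (auto simp: S_def zero_prod_def dist_Pair_Pair)
    have "real DIM('n phase) * \<Upsilon> * dist (0, snd x) (0 :: 'n phase) \<le> real DIM('n phase) * \<Upsilon>"
      using x(3) \<Upsilon> by (intro mult_left_le) auto
    then have "\<bar>gradh j (0, snd x) - gradh j 0\<bar> \<le> real DIM('n phase) * \<Upsilon>"
      using gradh_lipschitz[OF x(1,2), of j] by linarith
    moreover have "\<bar>gradh j 0\<bar> \<le> (\<Sum>j\<in>UNIV. \<bar>gradh j 0\<bar>)" by (rule member_le_sum) auto
    moreover have "gradh j x = gradh j (0, snd x)" using gradh_snd[of j "fst x" "snd x"] by simp
    ultimately show ?thesis using \<Upsilon> by (simp add: A_def)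
  qed
  have "Ck_bounded (Suc N) S A (gradh j)" for j
    unfolding Ck_bounded_Suc
  proof (intro conjI ballI)
    show "continuous_on S (gradh j)" using gradh_Ck Ck_on_continuous by blast
    fix d :: "'n phase" assume d: "d \<in> Basis"
    show "has_partial_at d (gradh j) x" if "x \<in> S" for x
      using gradh_Ck[of j] d that by (simp add: Ck_on_Suc)
    have hess: "Ck_bounded N S A (hessh i j)" for i
      using hessh_bounded by (rule Ck_bounded_mono) (use A in auto)
    have zero: "Ck_bounded N S A (\<lambda>x. 0)"
      using A by (intro Ck_bounded_const) simp
    show "Ck_bounded N S A (partial d (gradh j))"
    proof (rule phase_BasisE[OF d], goal_cases)
      case (1 i)
      then show ?case using zero by (simp add: partial_gradh_q(2))
    next
      case (2 i)
      then show ?case using hess by (simp add: partial_gradh_p(2))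
    qed
  qed (rule bd)
  then show ?thesis using A by blast
qed

lemma slices_Ck:
  assumes "p \<in> ball 0 1"
  shows "Ck_on (Suc (Suc N)) UNIV (\<lambda>q. f (q, p) t)" "Ck_on (Suc (Suc N)) UNIV (\<lambda>q. dp j f (q, p) t)"
    "Ck_on (Suc N) UNIV (\<lambda>q. dq i f (q, p) t)"
  using perturbation_in_B_space assms by (auto simp: B_space_def holder_class_def floor_\<sigma>)

text \<open>
  The detour through \<open>\<partial>\<^sub>p H\<close> is essential for the order: the Hessian of \<open>H\<close> is of class \<open>C\<^sup>N\<^sup>+\<^sup>2\<close>, while
  that of \<open>f\<close>, which also involves the Hessian of \<open>h\<close>, is at this point only known to be of class
  \<open>C\<^sup>N\<^sup>+\<^sup>1\<close>. The derivative \<open>\<partial>\<^sub>q f\<close> then inherits its regularity from \<open>\<partial>\<^sub>q \<partial>\<^sub>p f\<close>.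
\<close>

lemma dp_f_Ck: "Ck_on (Suc (Suc N)) S (\<lambda>x. dp j f x t)"
proof -
  have "Ck_on (Suc (Suc N)) S (\<lambda>x. dp j H x t)"
    unfolding S_def
  proof (rule Ck_on_of_slices)
    fix p :: "real ^ 'n" assume p: "p \<in> ball 0 1"
    have "(\<lambda>q. dp j H (q, p) t) = (\<lambda>q. gradh j (0, p) + 1 * dp j f (q, p) t)"
    proof
      fix q
      show "dp j H (q, p) t = gradh j (0, p) + 1 * dp j f (q, p) t"
        using partial_h'(2)[of "(q, p)" j t] p unfolding dp_h' gradh_snd[of j q p] by (simp add: S_def)
    qed
    then show "Ck_on (Suc (Suc N)) UNIV (\<lambda>q. dp j H (q, p) t)"
      using Ck_on_lincomb(1)[OF open_UNIV Ck_on_const slices_Ck(2)[OF p]] by metis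
  next
    fix c :: "real ^ 'n" assume "c \<in> Basis"
    then obtain i where i: "c = axis i 1" by (rule Basis_vecE)
    show "has_partial_at (0, c) (\<lambda>x. dp j H x t) x" if "x \<in> UNIV \<times> ball 0 1" for x
      using has_p_partials(2) that by (simp add: i S_def)
    show "Ck_on (Suc (Suc N)) (UNIV \<times> ball 0 1) (partial (0, c) (\<lambda>x. dp j H x t))"
      using hess_H[of i j t] by (simp add: i dp_eq Ck_bounded_def S_def)
  qed simp
  from Ck_on_lincomb(1)[OF S(1) this gradh_Ck, of "-1" j]
  have "Ck_on (Suc (Suc N)) S (\<lambda>x. dp j H x t - gradh j x)" by simp
  then show ?thesis
    using Ck_on_cong_open[OF S(1), of "\<lambda>x. dp j H x t - gradh j x" "\<lambda>x. dp j f x t"] partial_h'(2)[of _ j t]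
    by (simp add: dp_h')
qed

lemma dp_dq_f:
  assumes "x \<in> S"
  shows "partial (0, axis j 1) (\<lambda>x. dq i f x t) x = partial (axis i 1, 0) (\<lambda>x. dp j f x t) x"
  unfolding dq_eq dp_eq
proof (rule mixed_partials(2)[OF S(1) assms])
  fix y assume y: "y \<in> S"
  show "has_partial_at (0, axis j 1) (\<lambda>x. f x t) y" by (rule has_p_partials(3)[OF y])
  show "has_partial_at (axis i 1, 0) (\<lambda>x. f x t) y"
    using slices_Ck(1)[of "snd y" t] y
    by (cases y) (auto simp: S_def partial_slice Ck_on_Suc axis_in_Basis)
  show "has_partial_at (axis i 1, 0) (partial (0, axis j 1) (\<lambda>x. f x t)) y"
    using dp_f_Ck[of j t] y q_in_Basis[of i] by (auto simp: dp_eq Ck_on_Suc)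
next
  show "continuous_on S (partial (axis i 1, 0) (partial (0, axis j 1) (\<lambda>x. f x t)))"
    using dp_f_Ck[of j t] q_in_Basis[of i] by (auto simp: dp_eq Ck_on_Suc)
qed

lemma dq_f_Ck: "Ck_on (Suc N) S (\<lambda>x. dq i f x t)"
  unfolding S_def
proof (rule Ck_on_of_slices)
  fix p :: "real ^ 'n" assume p: "p \<in> ball 0 1"
  then show "Ck_on (Suc N) UNIV (\<lambda>q. dq i f (q, p) t)" by (rule slices_Ck(3))
next
  fix c :: "real ^ 'n" assume "c \<in> Basis"
  then obtain j where j: "c = axis j 1" by (rule Basis_vecE)
  show "has_partial_at (0, c) (\<lambda>x. dq i f x t) x" if "x \<in> UNIV \<times> ball 0 1" for x
    using has_p_partials(5) that by (simp add: j S_def)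
  have "Ck_on (Suc N) S (partial (axis i 1, 0) (\<lambda>x. dp j f x t))"
    using dp_f_Ck[of j t] q_in_Basis[of i] unfolding Ck_on_Suc[of "Suc N"] by blast
  then show "Ck_on (Suc N) (UNIV \<times> ball 0 1) (partial (0, c) (\<lambda>x. dq i f x t))"
    using Ck_on_cong_open[OF S(1) dp_dq_f[of _ j i t]] by (simp add: j S_def)
qed simp

text \<open>
  Derivatives of \<open>f\<close> with at most one \<open>p\<close>-derivative are controlled by the weighted norms, and all others
  are derivatives of \<open>\<partial>\<^sub>p\<^sup>2 f\<close>.
\<close>

lemma perturbation_bounded:
  assumes "\<And>i j. Ck_bounded (Suc N) S A (\<lambda>x. dp i (dp j f) x t)"
    and "decay \<epsilon> (l + 1) t \<le> A" "decay \<epsilon> (l + 2) t \<le> A"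
  shows "Ck_bounded (Suc N) S A (\<lambda>x. dp j f x t)" "Ck_bounded (Suc N) S A (\<lambda>x. dq i f x t)"
proof -
  have dp: "Ck_bounded (Suc (Suc N)) S A (\<lambda>x. dp j f x t)" for j
    unfolding S_def
  proof (rule Ck_bounded_of_slices)
    show "Ck_on (Suc (Suc N)) (UNIV \<times> ball 0 1) (\<lambda>x. dp j f x t)"
      using dp_f_Ck by (simp add: S_def)
  next
    fix cs :: "(real ^ 'n) list" and p q :: "real ^ 'n"
    assume "cs \<in> lists Basis" "length cs \<le> Suc (Suc N)" "p \<in> ball 0 1"
    then show "\<bar>partials cs (\<lambda>q. dp j f (q, p) t) q\<bar> \<le> A"
      using perturbation_decay(2)[of p cs j t q] assms(2) by linarith
  next
    fix bs :: "'n phase list" and c :: "real ^ 'n" and x :: "'n phase"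
    assume bs: "bs \<in> lists Basis" "length bs < Suc (Suc N)" "x \<in> UNIV \<times> ball 0 1" and "c \<in> Basis"
    then obtain i where i: "c = axis i 1" using Basis_vecE by blast
    show "\<bar>partials bs (partial (0, c) (\<lambda>x. dp j f x t)) x\<bar> \<le> A"
      using assms(1)[of i j] bs unfolding i dp_eq Ck_bounded_def S_def less_Suc_eq_le by blast
  qed simp
  then show "Ck_bounded (Suc N) S A (\<lambda>x. dp j f x t)" by (rule Ck_bounded_mono) auto
  show "Ck_bounded (Suc N) S A (\<lambda>x. dq i f x t)"
    unfolding S_def
  proof (rule Ck_bounded_of_slices)
    show "Ck_on (Suc N) (UNIV \<times> ball 0 1) (\<lambda>x. dq i f x t)"
      using dq_f_Ck by (simp add: S_def)
  next
    fix cs :: "(real ^ 'n) list" and p q :: "real ^ 'n"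
    assume "cs \<in> lists Basis" "length cs \<le> Suc N" "p \<in> ball 0 1"
    then show "\<bar>partials cs (\<lambda>q. dq i f (q, p) t) q\<bar> \<le> A"
      using perturbation_decay(1)[of p cs i t q] assms(3) by linarith
  next
    fix bs :: "'n phase list" and c :: "real ^ 'n" and x :: "'n phase"
    assume bs: "bs \<in> lists Basis" "length bs < Suc N" and x: "x \<in> UNIV \<times> ball 0 1" and "c \<in> Basis"
    then obtain j where j: "c = axis j 1" using Basis_vecE by blast
    have "partials bs (partial (0, c) (\<lambda>x. dq i f x t)) x =
        partials (bs @ [(axis i 1, 0)]) (\<lambda>x. dp j f x t) x"
      unfolding j partials_simps
      using x by (intro partials_cong_open[OF S(1)] dp_dq_f) (auto simp: S_def)
    moreover have "bs @ [(axis i 1, 0)] \<in> lists Basis" using bs q_in_Basis[of i] by auto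
    moreover have "length (bs @ [(axis i 1, 0)]) \<le> Suc (Suc N)" using bs by simp
    ultimately show "\<bar>partials bs (partial (0, c) (\<lambda>x. dq i f x t)) x\<bar> \<le> A"
      using dp[of j] x unfolding Ck_bounded_def S_def by metis
  qed simp
qed

lemma perturbation_bounded_all_times:
  "Ck_bounded (Suc N) S (2 * \<Upsilon> + \<epsilon>) (\<lambda>x. dp j f x t)"
  "Ck_bounded (Suc N) S (2 * \<Upsilon> + \<epsilon>) (\<lambda>x. dq i f x t)"
proof -
  have "Ck_bounded (Suc N) S (2 * \<Upsilon> + \<epsilon>) (\<lambda>x. dp i (dp j f) x t)" for i j
    using hess_f_bounded by (rule Ck_bounded_mono) (use \<epsilon> in auto)
  moreover have "decay \<epsilon> a t \<le> 2 * \<Upsilon> + \<epsilon>" for a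
    using decay_le[of \<epsilon> a t] \<epsilon> \<Upsilon> by simp
  ultimately show "Ck_bounded (Suc N) S (2 * \<Upsilon> + \<epsilon>) (\<lambda>x. dp j f x t)"
    "Ck_bounded (Suc N) S (2 * \<Upsilon> + \<epsilon>) (\<lambda>x. dq i f x t)"
    using perturbation_bounded by blast+
qed

lemma perturbation_small:
  assumes F: "F = at_top \<or> F = at_bot" and e: "e > 0"
  shows "\<forall>\<^sub>F t in F. \<forall>j. Ck_bounded (Suc N) S e (\<lambda>x. dp j f x t) \<and> Ck_bounded (Suc N) S e (\<lambda>x. dq j f x t)"
proof -
  have "\<forall>\<^sub>F t in F. decay \<epsilon> a t < e" if "a > 0" for a
    using F decay_tendsto_0[of a \<epsilon>] that \<epsilon> e by (auto intro: order_tendstoD(2))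
  then have "\<forall>\<^sub>F t in F. decay \<epsilon> (l + 1) t < e" "\<forall>\<^sub>F t in F. decay \<epsilon> (l + 2) t < e" using l by auto
  with hess_f_small[OF F e] show ?thesis
    by eventually_elim (use perturbation_bounded in \<open>simp add: less_imp_le\<close>)
qed

end

section \<open>Ordinary differential equations\<close>

lemma exists_antiderivative:
  fixes F :: "real \<Rightarrow> 'a::euclidean_space"
  assumes "continuous_on UNIV F"
  shows "\<exists>G. G 0 = 0 \<and> (\<forall>t. (G has_vector_derivative F t) (at t))"
proof -
  define G where "G = (\<lambda>u::real. LBINT y=0..u. F y)"
  have "(G has_vector_derivative F t) (at t)" for t
  proof -
    have t: "t \<in> {- \<bar>t\<bar> - 1<..<\<bar>t\<bar> + 1}" by auto
    have "(G has_vector_derivative F t) (at t within {- \<bar>t\<bar> - 1..\<bar>t\<bar> + 1})"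
      unfolding G_def
      using interval_integral_FTC2[of "- \<bar>t\<bar> - 1" 0 "\<bar>t\<bar> + 1" F t] continuous_on_subset[OF assms] by (simp add: zero_ereal_def)
    then have "(G has_vector_derivative F t) (at t within {- \<bar>t\<bar> - 1<..<\<bar>t\<bar> + 1})"
      by (rule has_vector_derivative_within_subset) auto
    then show ?thesis
      by (rule iffD1[OF has_vector_derivative_within_open[OF t open_greaterThanLessThan]])
  qed
  moreover have "G 0 = 0" by (simp add: G_def zero_ereal_def[symmetric])
  ultimately show ?thesis by blast
qed

lemma increment_bound:
  fixes g :: "real \<Rightarrow> 'a::real_normed_vector"
  assumes "a \<le> b"
    and g: "\<And>t. a \<le> t \<Longrightarrow> t \<le> b \<Longrightarrow> (g has_vector_derivative g' t) (at t)"
    and \<psi>: "\<And>t. a \<le> t \<Longrightarrow> t \<le> b \<Longrightarrow> (\<psi> has_real_derivative \<psi>' t) (at t)"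
    and le: "\<And>t. a \<le> t \<Longrightarrow> t \<le> b \<Longrightarrow> norm (g' t) \<le> \<psi>' t"
  shows "norm (g b - g a) \<le> \<psi> b - \<psi> a"
proof (cases "a = b")
  case False
  then have ab: "a < b" using assms(1) by simp
  show ?thesis
  proof (rule differentiable_bound_general[OF ab, where f' = g' and \<phi>' = \<psi>'])
    show "continuous_on {a..b} g"
      by (rule continuous_on_vector_derivative) (auto intro: has_vector_derivative_at_within g)
    show "continuous_on {a..b} \<psi>"
      by (rule DERIV_continuous_on) (auto intro: has_field_derivative_at_within \<psi>)
  qed (use g \<psi> le in \<open>auto simp: has_real_derivative_iff_has_vector_derivative\<close>)
qed simp

lemma reversed_has_vector_derivative:
  assumes "\<And>t. (g has_vector_derivative g' t) (at t)"
  shows "((\<lambda>t. g (- t)) has_vector_derivative - g' (- t)) (at t)"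
proof -
  have "((\<lambda>t::real. - t) has_vector_derivative - 1) (at t)"
    by (auto intro!: derivative_eq_intros)
  from vector_diff_chain_at[OF this assms] show ?thesis by (simp add: o_def)
qed

lemma increment_bound_symmetric:
  fixes g :: "real \<Rightarrow> 'a::real_normed_vector"
  assumes g: "\<And>t. (g has_vector_derivative g' t) (at t)"
    and \<psi>: "\<And>t. t \<ge> 0 \<Longrightarrow> (\<psi> has_real_derivative \<psi>' t) (at t)"
    and le: "\<And>t. norm (g' t) \<le> \<psi>' \<bar>t\<bar>"
  shows "norm (g t - g 0) \<le> \<psi> \<bar>t\<bar> - \<psi> 0"
proof (cases "t \<ge> 0")
  case True
  then have "norm (g t - g 0) \<le> \<psi> t - \<psi> 0"
    using le by (intro increment_bound[where g' = g' and \<psi>' = \<psi>'] g \<psi>) (auto, metis abs_of_nonneg)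
  then show ?thesis using True by simp
next
  case False
  have "norm (g (- (- t)) - g (- 0)) \<le> \<psi> (- t) - \<psi> 0"
  proof (rule increment_bound[where g = "\<lambda>s. g (- s)" and g' = "\<lambda>s. - g' (- s)" and \<psi>' = \<psi>'])
    show "norm (- g' (- s)) \<le> \<psi>' s" if "0 \<le> s" for s using le[of "- s"] that by simp
  qed (use False in \<open>auto intro: reversed_has_vector_derivative g \<psi>\<close>)
  then show ?thesis using False by simp
qed

text \<open>
  Picard's operator acts on the functions \<open>y t = exp (- \<kappa>\<bar>t\<bar>) (g t - x0)\<close>. The weight turns it into
  a contraction on the whole line at once, so that no solutions on short intervals need to be glued.
\<close>

theorem global_solution:
  fixes Y :: "'a::euclidean_space \<Rightarrow> real \<Rightarrow> 'a"
  assumes cont: "continuous_on UNIV (\<lambda>(x, t). Y x t)"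
    and bd: "\<And>x t. norm (Y x t) \<le> K"
    and lip: "\<And>x y t. norm (Y x t - Y y t) \<le> L * norm (x - y)"
  shows "\<exists>g. g 0 = x0 \<and> (\<forall>t. (g has_vector_derivative Y (g t) t) (at t))"
proof -
  define \<Lambda> where "\<Lambda> = \<bar>L\<bar> + 1"
  have \<Lambda>: "\<Lambda> > 0" "L \<le> \<Lambda>" by (auto simp: \<Lambda>_def)
  \<comment> \<open>Integrating \<open>\<Lambda> exp (\<kappa>\<bar>t\<bar>)\<close> produces the factor \<open>\<Lambda> / \<kappa> = 1 / 2\<close> of the contraction.\<close>
  define \<kappa> where "\<kappa> = 2 * \<Lambda>"
  have \<kappa>: "\<kappa> > 0" using \<Lambda> by (simp add: \<kappa>_def)
  have K: "K \<ge> 0" using bd norm_ge_zero order.trans by blast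
  define x where "x = (\<lambda>(y :: real \<Rightarrow>\<^sub>C 'a) t. x0 + exp (\<kappa> * \<bar>t\<bar>) *\<^sub>R y t)"
  define G where "G = (\<lambda>y. SOME G. G 0 = 0 \<and> (\<forall>t. (G has_vector_derivative Y (x y t) t) (at t)))"
  have G: "G y 0 = 0" "(G y has_vector_derivative Y (x y t) t) (at t)" for y t
  proof -
    have "continuous_on UNIV (\<lambda>t. (x y t, t))" unfolding x_def by (intro continuous_intros) auto
    then have "continuous_on UNIV (\<lambda>t. Y (x y t) t)"
      using continuous_on_compose2[OF cont, of UNIV "\<lambda>t. (x y t, t)"] by simp
    from someI_ex[OF exists_antiderivative[OF this]]
    show "G y 0 = 0" "(G y has_vector_derivative Y (x y t) t) (at t)"
      unfolding G_def by auto
  qed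
  have contG: "continuous_on UNIV (G y)" for y
    by (rule continuous_on_vector_derivative) (auto intro: has_vector_derivative_at_within G)
  have G_le: "norm (G y t) \<le> K * \<bar>t\<bar>" for y t
  proof -
    have "norm (G y t - G y 0) \<le> K * \<bar>t\<bar> - K * 0"
      by (rule increment_bound_symmetric[OF G(2), where \<psi>' = "\<lambda>t. K"])
        (auto intro!: derivative_eq_intros bd)
    then show ?thesis by (simp add: G(1))
  qed
  define T where "T = (\<lambda>y. Bcontfun (\<lambda>t. exp (- \<kappa> * \<bar>t\<bar>) *\<^sub>R G y t))"
  have T: "T y t = exp (- \<kappa> * \<bar>t\<bar>) *\<^sub>R G y t" for y t
  proof -
    have "(\<lambda>t. exp (- \<kappa> * \<bar>t\<bar>) *\<^sub>R G y t) \<in> bcontfun"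
    proof (rule bcontfun_normI)
      show "continuous_on UNIV (\<lambda>t. exp (- \<kappa> * \<bar>t\<bar>) *\<^sub>R G y t)"
        by (intro continuous_intros contG)
      fix t
      have "\<kappa> * \<bar>t\<bar> \<le> exp (\<kappa> * \<bar>t\<bar>)" using exp_ge_add_one_self[of "\<kappa> * \<bar>t\<bar>"] by linarith
      then have "exp (- \<kappa> * \<bar>t\<bar>) * \<bar>t\<bar> \<le> 1 / \<kappa>"
        using \<kappa> by (simp add: exp_minus field_simps)
      from mult_left_mono[OF this K] have "exp (- \<kappa> * \<bar>t\<bar>) * (K * \<bar>t\<bar>) \<le> K * (1 / \<kappa>)"
        by (simp only: mult_ac)
      moreover have "exp (- \<kappa> * \<bar>t\<bar>) * norm (G y t) \<le> exp (- \<kappa> * \<bar>t\<bar>) * (K * \<bar>t\<bar>)"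
        by (intro mult_left_mono G_le) simp
      ultimately have "exp (- \<kappa> * \<bar>t\<bar>) * norm (G y t) \<le> K * (1 / \<kappa>)" by linarith
      then show "norm (exp (- \<kappa> * \<bar>t\<bar>) *\<^sub>R G y t) \<le> K * (1 / \<kappa>)" by simp
    qed
    then show ?thesis by (simp add: T_def Bcontfun_inverse)
  qed
  have contraction: "dist (T y) (T z) \<le> (1 / 2) * dist y z" for y z
  proof (rule dist_bound)
    fix t
    define d where "d = dist y z"
    define c where "c = \<Lambda> * d / \<kappa>"
    have c: "c = d / 2" "c \<ge> 0" using \<Lambda> by (auto simp: c_def \<kappa>_def d_def)
    have diff: "norm (Y (x y s) s - Y (x z s) s) \<le> c * (exp (\<kappa> * \<bar>s\<bar>) * \<kappa>)" for s
    proof -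
      have "norm (Y (x y s) s - Y (x z s) s) \<le> L * norm (x y s - x z s)" by (rule lip)
      also have "\<dots> \<le> \<Lambda> * norm (x y s - x z s)" using \<Lambda> by (intro mult_right_mono) auto
      also have "x y s - x z s = exp (\<kappa> * \<bar>s\<bar>) *\<^sub>R (y s - z s)" by (simp add: x_def scaleR_diff_right)
      also have "norm \<dots> = exp (\<kappa> * \<bar>s\<bar>) * dist (y s) (z s)" by (simp add: dist_norm)
      also have "\<Lambda> * \<dots> \<le> \<Lambda> * (exp (\<kappa> * \<bar>s\<bar>) * d)"
        using \<Lambda> unfolding d_def by (intro mult_left_mono dist_bounded) auto
      also have "\<dots> = c * (exp (\<kappa> * \<bar>s\<bar>) * \<kappa>)" using \<kappa> by (simp add: c_def)
      finally show ?thesis .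
    qed
    have "norm ((G y t - G z t) - (G y 0 - G z 0)) \<le> c * exp (\<kappa> * \<bar>t\<bar>) - c * exp (\<kappa> * 0)"
    proof (rule increment_bound_symmetric[where g = "\<lambda>t. G y t - G z t"])
      show "((\<lambda>t. G y t - G z t) has_vector_derivative Y (x y s) s - Y (x z s) s) (at s)" for s
        by (intro has_vector_derivative_diff G)
      show "((\<lambda>t. c * exp (\<kappa> * t)) has_real_derivative c * (exp (\<kappa> * s) * \<kappa>)) (at s)" for s
        by (auto intro!: derivative_eq_intros)
    qed (rule diff)
    then have "norm (G y t - G z t) \<le> c * exp (\<kappa> * \<bar>t\<bar>)" using c(2) by (simp add: G(1))
    then have "exp (- \<kappa> * \<bar>t\<bar>) * norm (G y t - G z t) \<le> exp (- \<kappa> * \<bar>t\<bar>) * (c * exp (\<kappa> * \<bar>t\<bar>))"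
      by (intro mult_left_mono) auto
    also have "\<dots> = c" by (simp add: exp_minus field_simps)
    finally show "dist (T y t) (T z t) \<le> (1 / 2) * dist y z"
      by (simp add: T dist_norm c(1) d_def flip: scaleR_diff_right)
  qed
  obtain y where y: "T y = y"
    using banach_fix_type[of "1 / 2" T] contraction by auto
  have "x y = (\<lambda>t. x0 + G y t)"
  proof
    fix t
    have "y t = exp (- \<kappa> * \<bar>t\<bar>) *\<^sub>R G y t" using T[of y t] y by simp
    then show "x y t = x0 + G y t" by (simp add: x_def exp_minus)
  qed
  then have "(x y has_vector_derivative Y (x y t) t) (at t)" "x y 0 = x0" for t
    using G[of y] by (auto intro!: derivative_eq_intros)
  then show ?thesis by blast
qed

section \<open>Asymptotics of curves\<close>

text \<open>
  The function \<open>\<psi>\<close> is the tail integral of a bound for the speed, and so it bounds the distance that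
  the curve can still travel.
\<close>

lemma convergent_curve:
  fixes g :: "real \<Rightarrow> 'a::banach"
  assumes g: "\<And>t. t \<ge> 1 \<Longrightarrow> (g has_vector_derivative g' t) (at t)"
    and \<psi>: "\<And>t. t \<ge> 1 \<Longrightarrow> (\<psi> has_real_derivative - \<psi>' t) (at t)"
    and le: "\<And>t. t \<ge> 1 \<Longrightarrow> norm (g' t) \<le> \<psi>' t"
    and lim: "(\<psi> \<longlongrightarrow> 0) at_top" and pos: "\<And>t. t \<ge> 1 \<Longrightarrow> \<psi> t \<ge> 0"
  obtains z where "(g \<longlongrightarrow> z) at_top" "\<And>t. t \<ge> 1 \<Longrightarrow> norm (g t - z) \<le> \<psi> t"
proof -
  have incr: "norm (g t - g s) \<le> \<psi> s" if "1 \<le> s" "s \<le> t" for s t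
  proof -
    have "((\<lambda>t. - \<psi> t) has_real_derivative \<psi>' t) (at t)" if "t \<ge> 1" for t
      using DERIV_minus[OF \<psi>[OF that]] by simp
    then have "norm (g t - g s) \<le> - \<psi> t - - \<psi> s"
      using that g le by (intro increment_bound[where g' = g' and \<psi>' = \<psi>' and \<psi> = "\<lambda>t. - \<psi> t"]) auto
    then show ?thesis using pos[of t] that by simp
  qed
  define X where "X = (\<lambda>n. g (real (Suc n)))"
  have sub: "filterlim (\<lambda>n. real (Suc n)) at_top sequentially"
    using filterlim_compose[OF filterlim_real_sequentially filterlim_Suc] .
  have "Cauchy X"
  proof (rule metric_CauchyI)
    fix e :: real assume "e > 0"
    then have "\<forall>\<^sub>F n in sequentially. \<psi> (real (Suc n)) < e / 2"
      using order_tendstoD(2)[OF filterlim_compose[OF lim sub], of "e / 2"] by simp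
    then obtain M where M: "\<psi> (real (Suc M)) < e / 2" by (auto simp: eventually_sequentially)
    have "dist (X m) (X n) < e" if "m \<ge> M" "n \<ge> M" for m n
    proof -
      have "dist (X m) (X M) \<le> \<psi> (real (Suc M))" "dist (X n) (X M) \<le> \<psi> (real (Suc M))"
        using incr[of "real (Suc M)"] that by (auto simp: X_def dist_norm)
      then show ?thesis using M dist_triangle2[of "X m" "X n" "X M"] by linarith
    qed
    then show "\<exists>M. \<forall>m\<ge>M. \<forall>n\<ge>M. dist (X m) (X n) < e" by blast
  qed
  then obtain z where z: "X \<longlonglongrightarrow> z" using Cauchy_convergent convergent_def by blast
  have near: "norm (g t - z) \<le> \<psi> t" if t: "t \<ge> 1" for t
  proof (rule tendsto_upperbound)
    show "((\<lambda>n. norm (g t - X n)) \<longlongrightarrow> norm (g t - z)) sequentially"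
      by (intro tendsto_intros z)
    show "\<forall>\<^sub>F n in sequentially. norm (g t - X n) \<le> \<psi> t"
      using filterlim_at_top[THEN iffD1, OF sub, rule_format, of t]
      by eventually_elim (use incr t in \<open>simp add: X_def norm_minus_commute\<close>)
  qed simp
  have "((\<lambda>t. g t - z) \<longlongrightarrow> 0) at_top"
    using eventually_ge_at_top[of 1] by (intro Lim_null_comparison[OF _ lim] eventually_mono[OF _ near])
  then have "(g \<longlongrightarrow> z) at_top" by (simp add: LIM_zero_iff)
  then show ?thesis using near that by blast
qed

text \<open>
  A force that decays like \<open>t\<^sup>-\<^sup>3\<close> makes \<open>p\<close> converge at the rate \<open>t\<^sup>-\<^sup>2\<close>. This is still integrable, and
  the difference between \<open>q\<close> and the uniform motion with the limiting velocity converges as well.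
\<close>

lemma asymptotic_line:
  fixes q p :: "real \<Rightarrow> 'a::euclidean_space"
  assumes q: "\<And>t. (q has_vector_derivative W (p t) + r t) (at t)"
    and p: "\<And>t. (p has_vector_derivative p' t) (at t)"
    and p': "\<And>t. t \<ge> 1 \<Longrightarrow> norm (p' t) \<le> C / t ^ 3"
    and r: "\<And>t. t \<ge> 1 \<Longrightarrow> norm (r t) \<le> C / t\<^sup>2"
    and W: "\<And>a b. a \<in> cball 0 R \<Longrightarrow> b \<in> cball 0 R \<Longrightarrow> norm (W a - W b) \<le> L * norm (a - b)"
    and R: "\<And>t. p t \<in> cball 0 R" and "C \<ge> 0" "L \<ge> 0"
  obtains p1 q1 where "p1 \<in> cball 0 R" "(p \<longlongrightarrow> p1) at_top"
    "((\<lambda>t. q t - t *\<^sub>R W p1) \<longlongrightarrow> q1) at_top"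
proof -
  have lim2: "((\<lambda>t::real. C / (2 * t\<^sup>2)) \<longlongrightarrow> 0) at_top"
    by (intro tendsto_divide_0[OF tendsto_const] filterlim_at_top_imp_at_infinity
        filterlim_tendsto_pos_mult_at_top[OF tendsto_const] filterlim_pow_at_top filterlim_ident) auto
  obtain p1 where p1: "(p \<longlongrightarrow> p1) at_top" "\<And>t. t \<ge> 1 \<Longrightarrow> norm (p t - p1) \<le> C / (2 * t\<^sup>2)"
  proof (rule convergent_curve[of p p' "\<lambda>t. C / (2 * t\<^sup>2)" "\<lambda>t. C / t ^ 3"])
    show "((\<lambda>t. C / (2 * t\<^sup>2)) has_real_derivative - (C / t ^ 3)) (at t)" if "t \<ge> 1" for t
      using that by (auto intro!: derivative_eq_intros simp: power2_eq_square power3_eq_cube field_simps)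
  qed (use p p' lim2 \<open>C \<ge> 0\<close> in auto)
  have p1R: "p1 \<in> cball 0 R"
    using tendsto_upperbound[OF tendsto_norm[OF p1(1)], of R] R
    by (simp add: trivial_limit_at_top_linorder)
  define C' where "C' = L * C + C"
  have lim1: "((\<lambda>t::real. C' / t) \<longlongrightarrow> 0) at_top"
    by (intro tendsto_divide_0[OF tendsto_const] filterlim_at_top_imp_at_infinity filterlim_ident)
  have C': "C' \<ge> 0" using assms by (simp add: C'_def)
  obtain q1 where "((\<lambda>t. q t - t *\<^sub>R W p1) \<longlongrightarrow> q1) at_top"
  proof (rule convergent_curve[of "\<lambda>t. q t - t *\<^sub>R W p1" "\<lambda>t. W (p t) + r t - W p1"
        "\<lambda>t. C' / t" "\<lambda>t. C' / t\<^sup>2"])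
    show "((\<lambda>t. q t - t *\<^sub>R W p1) has_vector_derivative W (p t) + r t - W p1) (at t)" for t
      using q[of t] by (auto intro!: derivative_eq_intros)
    show "((\<lambda>t. C' / t) has_real_derivative - (C' / t\<^sup>2)) (at t)" if "t \<ge> 1" for t
      using that by (auto intro!: derivative_eq_intros simp: power2_eq_square field_simps)
    fix t :: real assume t: "t \<ge> 1"
    have "norm (W (p t) - W p1) \<le> L * (C / (2 * t\<^sup>2))"
      using W[OF R p1R, of t] mult_left_mono[OF p1(2)[OF t] \<open>L \<ge> 0\<close>] by linarith
    also have "\<dots> \<le> L * C / t\<^sup>2"
      using t assms by (simp add: field_simps)
    finally have "norm ((W (p t) - W p1) + r t) \<le> L * C / t\<^sup>2 + C / t\<^sup>2"
      using r[OF t] norm_triangle_ineq[of "W (p t) - W p1" "r t"] by linarith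
    then show "norm (W (p t) + r t - W p1) \<le> C' / t\<^sup>2"
      by (simp add: C'_def add_divide_distrib algebra_simps)
    show "0 \<le> C' / t" using C' t by simp
  qed (use lim1 in auto)
  then show ?thesis using that p1(1) p1R by blast
qed

section \<open>The flow of the perturbed Hamiltonian\<close>

lemma decay_le_inverse_power:
  assumes "1 \<le> \<bar>t\<bar>" "real k \<le> a" "\<epsilon> \<ge> 0"
  shows "decay \<epsilon> a t \<le> \<epsilon> / \<bar>t\<bar> ^ k"
proof -
  have "\<bar>t\<bar> ^ k = \<bar>t\<bar> powr real k" using assms(1) by (simp add: powr_realpow)
  also have "\<dots> \<le> \<bar>t\<bar> powr a" using assms by (intro powr_mono) auto
  finally have "\<bar>t\<bar> ^ k \<le> 1 + \<bar>t\<bar> powr a" by simp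
  then show ?thesis
    unfolding decay_def using assms by (intro divide_left_mono) (auto simp: add_pos_nonneg)
qed

text \<open>
  The right-hand side is integrable over the whole line, with the explicit primitive \<open>2 \<epsilon> arctan\<close>.
\<close>

lemma decay_le_arctan_derivative:
  assumes "2 \<le> a" "\<epsilon> \<ge> 0"
  shows "decay \<epsilon> a t \<le> 2 * \<epsilon> / (1 + t\<^sup>2)"
proof -
  have "t\<^sup>2 \<le> 1 + 2 * \<bar>t\<bar> powr a"
  proof (cases "\<bar>t\<bar> \<le> 1")
    case True
    then have "t\<^sup>2 \<le> 1" by (simp add: abs_square_le_1)
    then show ?thesis using powr_ge_zero[of "\<bar>t\<bar>" a] by linarith
  next
    case False
    have "t\<^sup>2 = \<bar>t\<bar> powr 2" using False by simp
    also have "\<dots> \<le> \<bar>t\<bar> powr a" using False assms by (intro powr_mono) auto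
    finally show ?thesis using powr_ge_zero[of "\<bar>t\<bar>" a] by linarith
  qed
  then have le: "1 + t\<^sup>2 \<le> 2 * (1 + \<bar>t\<bar> powr a)" by simp
  have "decay \<epsilon> a t = 2 * \<epsilon> / (2 * (1 + \<bar>t\<bar> powr a))"
    using mult_divide_mult_cancel_left[of 2 \<epsilon> "1 + \<bar>t\<bar> powr a"] by (simp add: decay_def)
  also have "\<dots> \<le> 2 * \<epsilon> / (1 + t\<^sup>2)"
    using le assms(2) by (intro divide_left_mono) (auto simp: add_pos_nonneg)
  finally show ?thesis .
qed

lemma norm_vec_le: "(\<And>i. \<bar>(x :: real ^ 'n::finite) $ i\<bar> \<le> c) \<Longrightarrow> norm x \<le> real CARD('n) * c"
  using norm_le_l1_cart[of x] sum_bounded_above[of UNIV "\<lambda>i. \<bar>x $ i\<bar>" c] by simp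

lemma Ck_bounded_coordinate:
  fixes b :: "'a::euclidean_space"
  assumes b: "b \<in> Basis" and r: "r > 0"
  shows "Ck_bounded k (ball 0 r) (r + 1) (\<lambda>x. x \<bullet> b)"
proof -
  have part: "has_partial_at c (\<lambda>x. x \<bullet> b) x" "partial c (\<lambda>x. x \<bullet> b) x = c \<bullet> b" for c x :: 'a
  proof -
    have "((\<lambda>s. (x + s *\<^sub>R c) \<bullet> b) has_real_derivative c \<bullet> b) (at 0)"
      by (auto intro!: derivative_eq_intros simp: inner_left_distrib)
    from partial_eqI[of "\<lambda>x. x \<bullet> b", OF this]
    show "has_partial_at c (\<lambda>x. x \<bullet> b) x" "partial c (\<lambda>x. x \<bullet> b) x = c \<bullet> b" by auto
  qed
  then have eq: "partial c (\<lambda>x. x \<bullet> b) = (\<lambda>x. c \<bullet> b)" for c by blast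
  have bd: "\<bar>x \<bullet> b\<bar> \<le> r + 1" if "x \<in> ball 0 r" for x
    using Basis_le_norm[OF b, of x] that by simp
  show ?thesis
  proof (cases k)
    case 0
    then show ?thesis using bd by (auto simp: Ck_bounded_0 intro!: continuous_intros)
  next
    case (Suc j)
    have "Ck_bounded j (ball 0 r) (r + 1) (\<lambda>x::'a. c \<bullet> b)" if "c \<in> Basis" for c
      using r b that by (intro Ck_bounded_const) (simp add: inner_Basis)
    then show ?thesis
      using bd part(1) unfolding Suc Ck_bounded_Suc eq by (auto intro!: continuous_intros)
  qed
qed

lemma has_derivative_trivial_embedding:
  "(trivial_embedding p has_derivative (\<lambda>v. (v, 0))) (at q)"
  unfolding trivial_embedding_def by (auto intro!: derivative_eq_intros)

lemma frechet_derivative_trivial_embedding: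
  "frechet_derivative (trivial_embedding p) (at q) = (\<lambda>v. (v, 0))"
  by (rule frechet_derivative_at[OF has_derivative_trivial_embedding, symmetric])

lemma torus_embedding_trivial:
  fixes p :: "real ^ 'n::finite"
  assumes "p \<in> B"
  shows "torus_embedding B \<sigma> (trivial_embedding p)"
proof -
  have "holder_class \<sigma> (ball 0 r) (\<lambda>q. trivial_embedding p q \<bullet> d)"
    if r: "r > 0" and d: "d \<in> Basis" for r :: real and d :: "'n phase"
  proof -
    define A where "A = r + 1 + norm p"
    have "Ck_bounded (Suc (nat \<lfloor>\<sigma>\<rfloor>)) (ball 0 r) A (\<lambda>q. trivial_embedding p q \<bullet> d)"
    proof (rule phase_BasisE[OF d], goal_cases)
      case (1 i)
      show ?case
        using Ck_bounded_mono[OF Ck_bounded_coordinate[OF axis_in_Basis r] order.refl, of A _ i]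
        by (simp add: 1 A_def trivial_embedding_def)
    next
      case (2 i)
      have "\<bar>p \<bullet> axis i 1\<bar> \<le> A"
        using Basis_le_norm[OF axis_in_Basis, of p i] r by (simp add: A_def)
      then show ?case
        by (simp add: 2 trivial_embedding_def Ck_bounded_const)
    qed
    then show ?thesis
      using r by (intro holder_class_of_Ck_bounded) (auto simp: A_def)
  qed
  moreover have "trivial_embedding p differentiable at q" for q
    using has_derivative_trivial_embedding by (auto simp: differentiable_def)
  ultimately show ?thesis
    using assms frechet_derivative_trivial_embedding[of p]
    by (auto simp: torus_embedding_def holder_class_vec_def trivial_embedding_def inj_def)
qed

lemma phase_dist_le_dist: "0 \<le> phase_dist x y" "phase_dist x y \<le> dist x y"
proof -
  have "0 \<in> lattice" by (simp add: lattice_def)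
  then show "0 \<le> phase_dist x y"
    unfolding phase_dist_def by (intro cINF_greatest) auto
  have "bdd_below ((\<lambda>z. dist (x + (z, 0)) y) ` lattice)"
    by (rule bdd_belowI2[of _ 0]) simp
  from cINF_lower[OF this \<open>0 \<in> lattice\<close>] show "phase_dist x y \<le> dist x y"
    by (simp add: phase_dist_def flip: zero_prod_def)
qed

text \<open>
  The lifts themselves get close, and their distance dominates the one on the torus.
\<close>

lemma phase_dist_tendsto_0:
  assumes "((\<lambda>t. fst (g t) - t *\<^sub>R \<omega>) \<longlongrightarrow> q) F" "((\<lambda>t. snd (g t)) \<longlongrightarrow> p) F"
  shows "((\<lambda>t. phase_dist (g t) (trivial_embedding p (q + t *\<^sub>R \<omega>))) \<longlongrightarrow> 0) F"
proof (rule Lim_null_comparison)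
  have "dist (g t) (trivial_embedding p (q + t *\<^sub>R \<omega>)) =
      dist (fst (g t) - t *\<^sub>R \<omega>, snd (g t)) (q, p)" for t
    by (cases "g t") (simp add: trivial_embedding_def dist_Pair_Pair dist_norm algebra_simps)
  then have "norm (phase_dist (g t) (trivial_embedding p (q + t *\<^sub>R \<omega>))) \<le>
      dist (fst (g t) - t *\<^sub>R \<omega>, snd (g t)) (q, p)" for t
    using phase_dist_le_dist[of "g t" "trivial_embedding p (q + t *\<^sub>R \<omega>)"] by simp
  then show "\<forall>\<^sub>F t in F. norm (phase_dist (g t) (trivial_embedding p (q + t *\<^sub>R \<omega>))) \<le>
      dist (fst (g t) - t *\<^sub>R \<omega>, snd (g t)) (q, p)"
    by simp
  show "((\<lambda>t. dist (fst (g t) - t *\<^sub>R \<omega>, snd (g t)) (q, p)) \<longlongrightarrow> 0) F"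
    using tendsto_dist[OF tendsto_Pair[OF assms] tendsto_const, of "(q, p)"] by simp
qed

lemma Ck_bounded_minus:
  assumes "open S" "Ck_bounded k S A f"
  shows "Ck_bounded k S A (\<lambda>x. - f x)"
  using Ck_bounded_lincomb[OF assms(1) Ck_bounded_const[of 0 0] assms(2), of "-1"] by simp

context decaying_perturbation
begin

lemma ham_vf_h': "ham_vf h' x t = ((\<chi> i. gradh i x), 0)"
proof -
  have "dq i h' x t = 0" for i
    by (simp add: dq_def partial_def h'_def)
  then show ?thesis by (simp add: ham_vf_def dp_h' vec_eq_iff)
qed

lemma ham_vf_H:
  assumes x: "x \<in> S"
  shows "ham_vf H x t = ((\<chi> i. gradh i x + dp i f x t), (\<chi> i. - dq i f x t))"
proof -
  have "dp i H x t = gradh i x + dp i f x t" for i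
    using partial_h'(2)[OF x, of i t] by (simp add: dp_h')
  moreover have "dq i H x t = dq i f x t" for i
  proof -
    have f: "has_partial_at (axis i 1, 0) (\<lambda>x. f x t) x"
      using slices_Ck(1)[of "snd x" t] x
      by (cases x) (auto simp: S_def partial_slice Ck_on_Suc axis_in_Basis)
    have "(\<lambda>q. h' (q, p) t) = (\<lambda>q. h p)" for p by (simp add: h'_def)
    then have h: "has_partial_at (axis i 1, 0) (\<lambda>x. h' x t) x" "partial (axis i 1, 0) (\<lambda>x. h' x t) x = 0"
      by (cases x; simp add: partial_slice partial_const)+
    have "partial (axis i 1, 0) (\<lambda>x. H x t) x = partial (axis i 1, 0) (\<lambda>x. h' x t + 1 * f x t) x"
      using H_eq by (intro partial_cong_open(2)[OF S(1) x]) simp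
    also have "\<dots> = dq i f x t"
      using partial_lincomb(2)[OF h(1) f, of 1] h(2) by (simp add: dq_def)
    finally show ?thesis by (simp add: dq_def)
  qed
  ultimately show ?thesis by (simp add: ham_vf_def)
qed

lemma ham_vf_bounded:
  obtains A where "A \<ge> 0" "\<And>d t. d \<in> Basis \<Longrightarrow> Ck_bounded (Suc N) S A (\<lambda>x. ham_vf H x t \<bullet> d)"
    "\<And>d t. d \<in> Basis \<Longrightarrow> Ck_bounded (Suc N) S A (\<lambda>x. ham_vf h' x t \<bullet> d)"
proof -
  obtain C where C: "C \<ge> 0" "\<And>j. Ck_bounded (Suc N) S C (gradh j)" using gradh_bounded by blast
  define A where "A = C + (2 * \<Upsilon> + \<epsilon>)"
  have A: "A \<ge> 0" "2 * \<Upsilon> + \<epsilon> \<le> A" "C \<le> A" using C \<Upsilon> \<epsilon> by (auto simp: A_def)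
  have H: "Ck_bounded (Suc N) S A (\<lambda>x. ham_vf H x t \<bullet> d)" if d: "d \<in> Basis" for d t
  proof (rule phase_BasisE[OF d], goal_cases)
    case (1 i)
    have "Ck_bounded (Suc N) S A (\<lambda>x. gradh i x + 1 * dp i f x t)"
      using Ck_bounded_lincomb[OF S(1) C(2) perturbation_bounded_all_times(1), of 1 i] by (simp add: A_def)
    then show ?case
      using Ck_bounded_cong_open[OF S(1), of "\<lambda>x. ham_vf H x t \<bullet> d" "\<lambda>x. gradh i x + 1 * dp i f x t"]
      by (simp add: ham_vf_H 1 inner_axis)
  next
    case (2 i)
    have "Ck_bounded (Suc N) S A (\<lambda>x. - dq i f x t)"
      using Ck_bounded_mono[OF perturbation_bounded_all_times(2) order.refl A(2)]
      by (rule Ck_bounded_minus[OF S(1)])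
    then show ?case
      using Ck_bounded_cong_open[OF S(1), of "\<lambda>x. ham_vf H x t \<bullet> d" "\<lambda>x. - dq i f x t"]
      by (simp add: ham_vf_H 2 inner_axis)
  qed
  have h: "Ck_bounded (Suc N) S A (\<lambda>x. ham_vf h' x t \<bullet> d)" if d: "d \<in> Basis" for d t
  proof (rule phase_BasisE[OF d], goal_cases)
    case (1 i)
    then show ?case
      using Ck_bounded_mono[OF C(2)[of i] order.refl A(3)] by (simp add: ham_vf_h' inner_axis)
  next
    case (2 i)
    then show ?case using A(1) by (simp add: ham_vf_h' Ck_bounded_const)
  qed
  show ?thesis using A(1) H h that by blast
qed

lemma ham_vf_diff_small:
  assumes F: "F = at_top \<or> F = at_bot" and e: "e > 0"
  shows "\<forall>\<^sub>F t in F. \<forall>d\<in>Basis. Ck_bounded (Suc N) S e (\<lambda>x. (ham_vf H x t - ham_vf h' x t) \<bullet> d)"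
  using perturbation_small[OF F e]
proof eventually_elim
  case (elim t)
  show ?case
  proof
    fix d :: "'n phase" assume d: "d \<in> Basis"
    show "Ck_bounded (Suc N) S e (\<lambda>x. (ham_vf H x t - ham_vf h' x t) \<bullet> d)"
    proof (rule phase_BasisE[OF d], goal_cases)
      case (1 i)
      then show ?case
        using elim Ck_bounded_cong_open[OF S(1), of "\<lambda>x. (ham_vf H x t - ham_vf h' x t) \<bullet> d" "\<lambda>x. dp i f x t"]
        by (simp add: ham_vf_H ham_vf_h' inner_axis)
    next
      case (2 i)
      then show ?case
        using elim Ck_bounded_minus[OF S(1), of "Suc N" e "\<lambda>x. dq i f x t"]
          Ck_bounded_cong_open[OF S(1), of "\<lambda>x. (ham_vf H x t - ham_vf h' x t) \<bullet> d" "\<lambda>x. - dq i f x t"]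
        by (simp add: ham_vf_H ham_vf_h' inner_axis)
    qed
  qed
qed

lemma holder_norm_vec_tendsto_0:
  assumes F: "F = at_top \<or> F = at_bot"
  shows "((\<lambda>t. holder_norm_vec \<sigma> S (\<lambda>x. ham_vf H x t - ham_vf h' x t)) \<longlongrightarrow> 0) F"
proof (rule order_tendstoI)
  fix a :: ennreal assume "0 < a"
  then obtain b where b: "0 < b" "b < a" using dense by blast
  then obtain r where r: "b = ennreal r" "r \<ge> 0"
    by (metis ennreal_cases less_top not_less_iff_gr_or_eq top_greatest order.strict_trans)
  have r0: "r > 0" using b(1) r by (simp add: ennreal_less_zero_iff)
  define K where "K = real DIM('n phase) + 3"
  have K: "K > 0" by (simp add: K_def)
  have "r / K > 0" using r0 K by simp
  from ham_vf_diff_small[OF F this]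
  show "\<forall>\<^sub>F t in F. holder_norm_vec \<sigma> S (\<lambda>x. ham_vf H x t - ham_vf h' x t) < a"
  proof eventually_elim
    case (elim t)
    have "holder_norm_vec \<sigma> S (\<lambda>x. ham_vf H x t - ham_vf h' x t) \<le> ennreal (K * (r / K))"
      unfolding holder_norm_vec_def K_def
      using elim r0 K by (intro SUP_least holder_norm_le_Ck_bounded S) (auto simp: N_def K_def)
    also have "\<dots> < a" using b r K by simp
    finally show ?case .
  qed
qed simp

lemma perturbation_periodic:
  assumes "p \<in> ball 0 1" "z \<in> lattice"
  shows "dp i f (q + z, p) t = dp i f (q, p) t" "dq i f (q + z, p) t = dq i f (q, p) t"
  using perturbation_in_B_space(2)[of i] perturbation_in_B_space(3)[of i] assms
  by (auto simp: B_space_def periodic_in_q_def)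

lemma td_vector_field_H: "td_vector_field (ball 0 1) \<sigma> (ham_vf H)"
  and td_vector_field_h': "td_vector_field (ball 0 1) \<sigma> (ham_vf h')"
proof -
  obtain A where A: "A \<ge> 0" "\<And>d t. d \<in> Basis \<Longrightarrow> Ck_bounded (Suc N) S A (\<lambda>x. ham_vf H x t \<bullet> d)"
    "\<And>d t. d \<in> Basis \<Longrightarrow> Ck_bounded (Suc N) S A (\<lambda>x. ham_vf h' x t \<bullet> d)"
    using ham_vf_bounded by blast
  have gradh: "gradh i (q + z, p) = gradh i (q, p)" for i q p z
    unfolding gradh_snd[of i "q + z" p] gradh_snd[of i q p] ..
  have "periodic_in_q (ball 0 1) (\<lambda>x. ham_vf H x t)" for t
    unfolding periodic_in_q_def
    by (auto simp: ham_vf_H S_def gradh perturbation_periodic)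
  then show "td_vector_field (ball 0 1) \<sigma> (ham_vf H)"
    using holder_class_of_Ck_bounded[OF S(1,2) A(2)[unfolded N_def] A(1)]
    by (auto simp: td_vector_field_def holder_class_vec_def S_def)
  have "periodic_in_q (ball 0 1) (\<lambda>x. ham_vf h' x t)" for t
    unfolding periodic_in_q_def by (auto simp: ham_vf_h' gradh)
  then show "td_vector_field (ball 0 1) \<sigma> (ham_vf h')"
    using holder_class_of_Ck_bounded[OF S(1,2) A(3)[unfolded N_def] A(1)]
    by (auto simp: td_vector_field_def holder_class_vec_def S_def)
qed

lemma td_hamiltonian_h': "td_hamiltonian (ball 0 1) h'"
proof -
  have p: "has_partial_at (0, axis i 1) (\<lambda>x. h' x t) x" if "x \<in> S" for i t x
    using partial_h'(1)[OF that] .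
  have pp: "partial (0, axis i 1) (\<lambda>x. h' x t) = gradh i" for i t
    using dp_h' by (simp add: fun_eq_iff dp_def)
  have slice: "(\<lambda>q. h' (q, p) t) = (\<lambda>q. h p)" for p t by (simp add: h'_def)
  have grad: "continuous_on S (gradh i)" for i using gradh_Ck Ck_on_continuous by blast
  have cont: "continuous_on S (\<lambda>x. h' x t)" for t
    unfolding S_def
  proof (rule continuous_on_of_slices)
    show "continuous_on UNIV (\<lambda>q. h' (q, p) t)" for p by (simp add: h'_def)
    fix c :: "real ^ 'n" assume "c \<in> Basis"
    then obtain i where i: "c = axis i 1" by (rule Basis_vecE)
    show "has_partial_at (0, c) (\<lambda>x. h' x t) x" if "x \<in> UNIV \<times> ball 0 1" for x
      using p that by (simp add: i S_def)
    show "continuous_on (UNIV \<times> ball 0 1) (partial (0, c) (\<lambda>x. h' x t))"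
      using grad by (simp add: i pp S_def)
  qed simp
  have q: "has_partial_at (b, 0) (\<lambda>x. h' x t) x" "partial (b, 0) (\<lambda>x. h' x t) x = 0" for b t x
    by (cases x; simp add: partial_slice slice partial_const)+
  have q0: "partial (b, 0) (\<lambda>x. h' x t) = (\<lambda>x. 0)" for b t using q(2) by blast
  have "Ck_on 1 S (\<lambda>x. h' x t)" for t
    unfolding One_nat_def Ck_on_Suc
  proof (intro conjI ballI)
    fix d :: "'n phase" assume d: "d \<in> Basis"
    show "has_partial_at d (\<lambda>x. h' x t) x" if "x \<in> S" for x
      by (rule phase_BasisE[OF d]) (use p q that in auto)
    show "Ck_on 0 S (partial d (\<lambda>x. h' x t))"
      by (rule phase_BasisE[OF d]) (use grad pp q0 in auto)
  qed (rule cont)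
  then show ?thesis
    by (auto simp: td_hamiltonian_def S_def periodic_in_q_def h'_def)
qed

definition frequency :: "real ^ 'n \<Rightarrow> real ^ 'n" where "frequency p = (\<chi> i. gradh i (0, p))"

lemma biasymptotic_setting:
  assumes "pp \<in> ball 0 1" "pm \<in> ball 0 1"
  shows "biasymptotic_setting (ball 0 1) \<sigma> 0 (ham_vf H) (ham_vf h') (ham_vf h')
    (trivial_embedding pp) (trivial_embedding pm) (frequency pp) (frequency pm)"
proof -
  have "ham_vf h' (trivial_embedding p q) t = (frequency p, 0)" for p q t
    unfolding ham_vf_h' frequency_def trivial_embedding_def using gradh_snd[of _ q p] by simp
  then show ?thesis
    unfolding biasymptotic_setting_def frechet_derivative_trivial_embedding of_nat_0 add_0_right
    using assms td_vector_field_H td_vector_field_h' torus_embedding_trivial[OF assms(1), of \<sigma>] torus_embedding_trivial[OF assms(2), of \<sigma>]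
      holder_norm_vec_tendsto_0[of at_top] holder_norm_vec_tendsto_0[of at_bot]
    unfolding S_def by simp
qed

lemma ham_vf_lipschitz:
  obtains L where "\<And>x y t. x \<in> S \<Longrightarrow> y \<in> S \<Longrightarrow> norm (ham_vf H x t - ham_vf H y t) \<le> L * norm (x - y)"
    and "\<And>x t. x \<in> S \<Longrightarrow> norm (ham_vf H x t) \<le> L" and "L \<ge> 0"
proof -
  obtain A where A: "A \<ge> 0" "\<And>d t. d \<in> Basis \<Longrightarrow> Ck_bounded (Suc N) S A (\<lambda>x. ham_vf H x t \<bullet> d)"
    and "\<And>d t. d \<in> Basis \<Longrightarrow> Ck_bounded (Suc N) S A (\<lambda>x. ham_vf h' x t \<bullet> d)"
    using ham_vf_bounded by blast
  define D where "D = real DIM('n phase)"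
  have D: "D \<ge> 1" unfolding D_def real_of_nat_ge_one_iff by (metis DIM_ge_Suc0 One_nat_def)
  define L where "L = D * (D * A)"
  have "norm (ham_vf H x t - ham_vf H y t) \<le> L * norm (x - y)" if "x \<in> S" "y \<in> S" for x y t
  proof -
    have "norm (ham_vf H x t - ham_vf H y t) \<le> (\<Sum>d\<in>Basis. \<bar>(ham_vf H x t - ham_vf H y t) \<bullet> d\<bar>)"
      by (rule norm_le_l1)
    also have "\<dots> \<le> real (card (Basis :: 'n phase set)) * (D * A * dist x y)"
      using Ck_bounded_lipschitz[OF S(1,2) A(2) that]
      by (intro sum_bounded_above) (simp add: inner_diff_left D_def)
    finally show ?thesis by (simp add: L_def D_def dist_norm mult.assoc)
  qed
  moreover have "norm (ham_vf H x t) \<le> L" if "x \<in> S" for x t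
  proof -
    have "norm (ham_vf H x t) \<le> (\<Sum>d\<in>Basis. \<bar>ham_vf H x t \<bullet> d\<bar>)"
      by (rule norm_le_l1)
    also have "\<dots> \<le> real (card (Basis :: 'n phase set)) * A"
      using A(2) that by (intro sum_bounded_above) (simp add: Ck_bounded_Suc)
    also have "\<dots> = D * A" by (simp only: D_def)
    also have "\<dots> \<le> L"
      unfolding L_def using mult_right_mono[OF D A(1)] D by (intro mult_left_mono) auto
    finally show ?thesis .
  qed
  moreover have "L \<ge> 0" using D A(1) by (simp add: L_def)
  ultimately show ?thesis using that by blast
qed

lemma ham_vf_continuous: "continuous_on (S \<times> UNIV) (\<lambda>(x, t). ham_vf H x t)"
proof -
  have dp: "continuous_on (S \<times> UNIV) (\<lambda>(x, t). dp i f x t)" for i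
    using perturbation_in_B_space(2)[of i] by (simp add: B_space_def jointly_continuous_def S_def)
  have dq: "continuous_on (S \<times> UNIV) (\<lambda>(x, t). dq i f x t)" for i
    using perturbation_in_B_space(3)[of i] by (simp add: B_space_def jointly_continuous_def S_def)
  have gradh: "continuous_on (S \<times> UNIV) (\<lambda>z :: 'n phase \<times> real. gradh i (fst z))" for i
    by (rule continuous_on_compose2[of S "gradh i"])
      (use gradh_Ck Ck_on_continuous in \<open>auto intro!: continuous_intros\<close>)
  have "continuous_on (S \<times> UNIV) (\<lambda>z. ((\<chi> i. gradh i (fst z) + dp i f (fst z) (snd z)),
      (\<chi> i. - dq i f (fst z) (snd z))))"
    using dp dq by (intro continuous_intros gradh) (simp_all add: case_prod_beta)
  then show ?thesis
    by (rule continuous_on_eq) (auto simp: ham_vf_H)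
qed

lemma momentum_speed:
  assumes "x \<in> S"
  shows "norm (snd (ham_vf H x t)) \<le> real CARD('n) * decay \<epsilon> (l + 2) t"
proof (rule norm_vec_le)
  fix i
  have "\<bar>dq i f (fst x, snd x) t\<bar> \<le> decay \<epsilon> (l + 2) t"
    using perturbation_decay(1)[of "snd x" "[]" i t "fst x"] assms
    by (auto simp: S_def partials_simps)
  then show "\<bar>snd (ham_vf H x t) $ i\<bar> \<le> decay \<epsilon> (l + 2) t"
    by (simp add: ham_vf_H[OF assms])
qed

lemma frequency_lipschitz:
  assumes "a \<in> ball 0 1" "b \<in> ball 0 1"
  shows "norm (frequency a - frequency b) \<le> real CARD('n) * (real DIM('n phase) * \<Upsilon>) * norm (a - b)"
proof -
  have "norm (frequency a - frequency b) \<le> real CARD('n) * (real DIM('n phase) * \<Upsilon> * dist (0 :: real ^ 'n, a) (0, b))"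
    using gradh_lipschitz[of "(0, a)" "(0, b)"] assms
    by (intro norm_vec_le) (auto simp: frequency_def S_def)
  then show ?thesis by (simp add: dist_Pair_Pair dist_norm mult_ac)
qed

text \<open>
  Outside \<open>\<bar>p\<bar> \<le> 3/4\<close> the field is replaced by its value at the nearest point of that ball, which makes
  it globally Lipschitz. Along a solution, \<open>p\<close> departs from its initial value by at most
  \<open>4 n \<epsilon> \<le> 1/4\<close>, so that a solution starting in \<open>\<bar>p\<bar> < 1/2\<close> never meets the modified part.
\<close>

lemma integral_curve_exists:
  assumes small: "\<epsilon> \<le> 1 / (16 * real CARD('n))" and p0: "p0 \<in> ball 0 (1 / 2)"
  obtains g where "g 0 = (q0, p0)" "\<And>t. snd (g t) \<in> cball 0 (3 / 4)"
    "\<And>t. (g has_vector_derivative ham_vf H (g t) t) (at t)"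
proof -
  define proj where "proj = closest_point (cball 0 (3 / 4) :: (real ^ 'n) set)"
  have proj: "proj p \<in> cball 0 (3 / 4)" for p
    unfolding proj_def by (rule closest_point_in_set) auto
  have proj_lip: "dist (proj p) (proj p') \<le> dist p p'" for p p'
    unfolding proj_def by (rule closest_point_lipschitz) auto
  have proj_id: "proj p = p" if "p \<in> cball 0 (3 / 4)" for p
    unfolding proj_def using that by (rule closest_point_self)
  define cl where "cl = (\<lambda>x :: 'n phase. (fst x, proj (snd x)))"
  have clS: "cl x \<in> S" for x
    using proj[of "snd x"] by (simp add: cl_def S_def)
  have cl_lip: "norm (cl x - cl y) \<le> norm (x - y)" for x y
    unfolding cl_def using proj_lip[of "snd x" "snd y"]
    by (cases x; cases y) (simp add: dist_norm norm_Pair power_mono)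
  obtain L where L: "\<And>x y t. x \<in> S \<Longrightarrow> y \<in> S \<Longrightarrow> norm (ham_vf H x t - ham_vf H y t) \<le> L * norm (x - y)"
    "\<And>x t. x \<in> S \<Longrightarrow> norm (ham_vf H x t) \<le> L" "L \<ge> 0"
    using ham_vf_lipschitz by blast
  define Y where "Y = (\<lambda>x t. ham_vf H (cl x) t)"
  have "\<exists>g. g 0 = (q0, p0) \<and> (\<forall>t. (g has_vector_derivative Y (g t) t) (at t))"
  proof (rule global_solution)
    have "continuous_on UNIV proj"
      unfolding proj_def by (rule continuous_on_closest_point) auto
    then have "continuous_on UNIV (\<lambda>z :: 'n phase \<times> real. proj (snd (fst z)))"
      by (rule continuous_on_compose2) (auto intro!: continuous_intros)
    then have cl: "continuous_on UNIV (\<lambda>z :: 'n phase \<times> real. (cl (fst z), snd z))"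
      unfolding cl_def by (intro continuous_intros) auto
    have sub: "range (\<lambda>z :: 'n phase \<times> real. (cl (fst z), snd z)) \<subseteq> S \<times> UNIV"
      using clS by blast
    show "continuous_on UNIV (\<lambda>(x, t). Y x t)"
      using continuous_on_compose2[OF ham_vf_continuous cl sub] by (simp add: Y_def case_prod_beta)
    show "norm (Y x t) \<le> L" for x t
      unfolding Y_def by (rule L(2)[OF clS])
    show "norm (Y x t - Y y t) \<le> L * norm (x - y)" for x y t
      unfolding Y_def using L(1)[OF clS clS, of x t y] mult_left_mono[OF cl_lip L(3), of x y] by linarith
  qed
  then obtain g where g: "g 0 = (q0, p0)" "\<And>t. (g has_vector_derivative Y (g t) t) (at t)"
    by blast
  define n where "n = real CARD('n)"
  have n: "n > 0" by (simp add: n_def)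
  have p: "snd (g t) \<in> cball 0 (3 / 4)" for t
  proof -
    define \<psi> where "\<psi> = (\<lambda>t. 2 * n * \<epsilon> * arctan t)"
    have "norm (snd (g t) - snd (g 0)) \<le> \<psi> \<bar>t\<bar> - \<psi> 0"
    proof (rule increment_bound_symmetric[where g = "\<lambda>t. snd (g t)"])
      show "((\<lambda>t. snd (g t)) has_vector_derivative snd (Y (g t) t)) (at t)" for t
        by (rule bounded_linear.has_vector_derivative[OF bounded_linear_snd g(2)])
      show "(\<psi> has_real_derivative 2 * n * \<epsilon> / (1 + t\<^sup>2)) (at t)" for t
        unfolding \<psi>_def by (auto intro!: derivative_eq_intros simp: divide_inverse)
      show "norm (snd (Y (g t) t)) \<le> 2 * n * \<epsilon> / (1 + \<bar>t\<bar>\<^sup>2)" for t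
      proof -
        have "norm (snd (Y (g t) t)) \<le> n * decay \<epsilon> (l + 2) t"
          unfolding Y_def n_def by (rule momentum_speed[OF clS])
        also have "\<dots> \<le> n * (2 * \<epsilon> / (1 + t\<^sup>2))"
          using l \<epsilon> n by (intro mult_left_mono decay_le_arctan_derivative) auto
        finally show ?thesis by (simp add: mult_ac)
      qed
    qed
    also have "\<psi> \<bar>t\<bar> - \<psi> 0 \<le> 2 * n * \<epsilon> * 2"
      unfolding \<psi>_def using arctan_ubound[of "\<bar>t\<bar>"] pi_half_less_two n \<epsilon> by simp
    also have "\<dots> \<le> 1 / 4" using small n by (simp add: n_def[symmetric] field_simps)
    finally have "norm (snd (g t) - p0) \<le> 1 / 4" by (simp add: g(1))
    moreover have "norm (snd (g t)) \<le> norm (snd (g t) - p0) + norm p0"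
      using norm_triangle_ineq[of "snd (g t) - p0" p0] by simp
    ultimately show ?thesis using p0 by simp
  qed
  then have "cl (g t) = g t" for t using proj_id by (simp add: cl_def)
  then show ?thesis using that[of g] g p by (simp add: Y_def)
qed

text \<open>
  The behaviour as \<open>t \<rightarrow> -\<infinity>\<close> is that of the reversed curve as \<open>t \<rightarrow> \<infinity>\<close>, for which force, velocity and
  frequency change sign.
\<close>

lemma biasymptotically_quasiperiodic_solution:
  assumes small: "\<epsilon> \<le> 1 / (16 * real CARD('n))" and p0: "p0 \<in> ball 0 (1 / 2)"
  shows "\<exists>pm \<in> ball 0 1. \<exists>pp \<in> ball 0 1. \<exists>g.
    biasymptotically_quasiperiodic (ball 0 1) \<sigma> 0 (ham_vf H) (ham_vf h') (ham_vf h')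
      (trivial_embedding pp) (trivial_embedding pm) g \<and> g 0 = (q0, p0)"
proof -
  obtain g where g: "g 0 = (q0, p0)" "\<And>t. snd (g t) \<in> cball 0 (3 / 4)"
    "\<And>t. (g has_vector_derivative ham_vf H (g t) t) (at t)"
    using integral_curve_exists[OF small p0] by blast
  have gS: "g t \<in> S" for t
    using g(2)[of t] by (cases "g t") (simp add: S_def)
  define q where "q = (\<lambda>t. fst (g t))"
  define p where "p = (\<lambda>t. snd (g t))"
  define r where "r = (\<lambda>t. \<chi> i. dp i f (g t) t)"
  define p' where "p' = (\<lambda>t. snd (ham_vf H (g t) t))"
  define n where "n = real CARD('n)"
  define C where "C = n * \<epsilon>"
  define L where "L = n * (real DIM('n phase) * \<Upsilon>)"
  have C: "C \<ge> 0" and L: "L \<ge> 0" and n: "n > 0" using \<epsilon> \<Upsilon> by (auto simp: C_def L_def n_def)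
  have q: "(q has_vector_derivative frequency (p t) + r t) (at t)" for t
  proof -
    have "gradh i (g t) = gradh i (0, snd (g t))" for i
      using gradh_snd[of i "fst (g t)" "snd (g t)"] by simp
    then have "fst (ham_vf H (g t) t) = frequency (p t) + r t"
      by (simp add: ham_vf_H[OF gS] vec_eq_iff frequency_def p_def r_def)
    then show ?thesis
      using bounded_linear.has_vector_derivative[OF bounded_linear_fst g(3)[of t]] by (simp add: q_def)
  qed
  have p: "(p has_vector_derivative p' t) (at t)" for t
    using bounded_linear.has_vector_derivative[OF bounded_linear_snd g(3)] by (simp add: p_def p'_def)
  have p'_le: "norm (p' t) \<le> C / \<bar>t\<bar> ^ 3" if "1 \<le> \<bar>t\<bar>" for t
  proof -
    have "n * decay \<epsilon> (l + 2) t \<le> n * (\<epsilon> / \<bar>t\<bar> ^ 3)"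
      using that l \<epsilon> n by (intro mult_left_mono decay_le_inverse_power) auto
    then show ?thesis
      using momentum_speed[OF gS, of t t] unfolding p'_def n_def[symmetric] by (simp add: C_def)
  qed
  have r_le: "norm (r t) \<le> C / \<bar>t\<bar>\<^sup>2" if "1 \<le> \<bar>t\<bar>" for t
  proof -
    have "\<bar>dp i f (fst (g t), snd (g t)) t\<bar> \<le> decay \<epsilon> (l + 1) t" for i
      using perturbation_decay(2)[of "snd (g t)" "[]" i t "fst (g t)"] g(2)[of t]
      by (auto simp: partials_simps)
    then have "norm (r t) \<le> n * decay \<epsilon> (l + 1) t"
      unfolding n_def by (intro norm_vec_le) (simp add: r_def)
    also have "\<dots> \<le> n * (\<epsilon> / \<bar>t\<bar>\<^sup>2)"
      using that l \<epsilon> n by (intro mult_left_mono decay_le_inverse_power) auto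
    finally show ?thesis by (simp add: C_def)
  qed
  have W: "norm (frequency a - frequency b) \<le> L * norm (a - b)"
    if "a \<in> cball 0 (3 / 4)" "b \<in> cball 0 (3 / 4)" for a b
    using frequency_lipschitz[of a b] that unfolding L_def n_def by auto
  have pR: "p t \<in> cball 0 (3 / 4)" for t using g(2) by (simp add: p_def)
  obtain pp qp where plus: "pp \<in> cball 0 (3 / 4)" "(p \<longlongrightarrow> pp) at_top"
    "((\<lambda>t. q t - t *\<^sub>R frequency pp) \<longlongrightarrow> qp) at_top"
  proof (rule asymptotic_line[where W = frequency, OF q p _ _ W pR C L])
    show "norm (p' t) \<le> C / t ^ 3" "norm (r t) \<le> C / t\<^sup>2" if "t \<ge> 1" for t
      using p'_le[of t] r_le[of t] that by auto
  qed auto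
  obtain pm qm where minus: "pm \<in> cball 0 (3 / 4)" "((\<lambda>t. p (- t)) \<longlongrightarrow> pm) at_top"
    "((\<lambda>t. q (- t) - t *\<^sub>R - frequency pm) \<longlongrightarrow> qm) at_top"
  proof (rule asymptotic_line[where W = "\<lambda>a. - frequency a" and q = "\<lambda>t. q (- t)" and p = "\<lambda>t. p (- t)"
        and r = "\<lambda>t. - r (- t)" and p' = "\<lambda>t. - p' (- t)", OF _ _ _ _ _ pR C L])
    show "((\<lambda>t. q (- t)) has_vector_derivative - frequency (p (- t)) + - r (- t)) (at t)" for t
      using reversed_has_vector_derivative[OF q] by simp
    show "((\<lambda>t. p (- t)) has_vector_derivative - p' (- t)) (at t)" for t
      by (rule reversed_has_vector_derivative[OF p])
    show "norm (- p' (- t)) \<le> C / t ^ 3" "norm (- r (- t)) \<le> C / t\<^sup>2" if "t \<ge> 1" for t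
      using p'_le[of "- t"] r_le[of "- t"] that by auto
    show "norm (- frequency a - - frequency b) \<le> L * norm (a - b)"
      if "a \<in> cball 0 (3 / 4)" "b \<in> cball 0 (3 / 4)" for a b
      using W[OF that] by (simp add: norm_minus_commute)
  qed auto
  have ball: "pp \<in> ball 0 1" "pm \<in> ball 0 1" using plus(1) minus(1) by auto
  have "((\<lambda>t. phase_dist (g t) (trivial_embedding pp (qp + t *\<^sub>R frequency pp))) \<longlongrightarrow> 0) at_top"
    using plus by (intro phase_dist_tendsto_0) (auto simp: q_def p_def)
  moreover have "((\<lambda>t. phase_dist (g t) (trivial_embedding pm (qm + t *\<^sub>R frequency pm))) \<longlongrightarrow> 0) at_bot"
    using minus by (intro phase_dist_tendsto_0) (auto simp: q_def p_def filterlim_at_bot_mirror)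
  moreover have "integral_curve (ball 0 1) (ham_vf H) g"
    using g(3) gS by (simp add: integral_curve_def S_def)
  ultimately have "biasymptotically_quasiperiodic (ball 0 1) \<sigma> 0 (ham_vf H) (ham_vf h') (ham_vf h')
      (trivial_embedding pp) (trivial_embedding pm) g"
    unfolding biasymptotically_quasiperiodic_def using biasymptotic_setting[OF ball] by blast
  then show ?thesis using ball g(1) by blast
qed

end

theorem theorem1:
  fixes \<sigma> \<Upsilon> l :: real and M :: ennreal
  assumes "\<sigma> \<ge> 1" and "\<Upsilon> \<ge> 1" and "l > 1"
  shows "\<exists>\<epsilon>0 > 0. \<forall>\<epsilon> (h :: real ^ 'n::finite \<Rightarrow> real) f H.
           0 < \<epsilon> \<and> \<epsilon> < 1 \<and> admissible \<sigma> \<Upsilon> l \<epsilon> h f H \<and> grad_C1_norm h = M \<longrightarrow>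
           (\<exists>h' k. td_hamiltonian (ball 0 1) h' \<and>
              (\<epsilon> \<le> \<epsilon>0 \<longrightarrow>
                (\<forall>q. \<forall>p \<in> ball 0 (1 / 2).
                   \<exists>pm \<in> ball 0 1. \<exists>pp \<in> ball 0 1. \<exists>g.
                     biasymptotically_quasiperiodic (ball 0 1) \<sigma> k
                       (ham_vf H) (ham_vf h') (ham_vf h')
                       (trivial_embedding pp) (trivial_embedding pm) g \<and>
                     g 0 = (q, p))))"
proof (intro exI[of _ "1 / (16 * real CARD('n))"] conjI allI impI)
  fix \<epsilon> and h :: "real ^ 'n \<Rightarrow> real" and f H
  assume "0 < \<epsilon> \<and> \<epsilon> < 1 \<and> admissible \<sigma> \<Upsilon> l \<epsilon> h f H \<and> grad_C1_norm h = M"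
  then interpret decaying_perturbation \<sigma> \<Upsilon> l \<epsilon> h f H
    using assms by unfold_locales auto
  show "\<exists>h' k. td_hamiltonian (ball 0 1) h' \<and>
              (\<epsilon> \<le> 1 / (16 * real CARD('n)) \<longrightarrow>
                (\<forall>q. \<forall>p \<in> ball 0 (1 / 2).
                   \<exists>pm \<in> ball 0 1. \<exists>pp \<in> ball 0 1. \<exists>g.
                     biasymptotically_quasiperiodic (ball 0 1) \<sigma> k
                       (ham_vf H) (ham_vf h') (ham_vf h')
                       (trivial_embedding pp) (trivial_embedding pm) g \<and>
                     g 0 = (q, p)))"
    using td_hamiltonian_h' biasymptotically_quasiperiodic_solution
    by (intro exI[of _ h'] exI[of _ 0] conjI impI allI ballI) auto
qed simp

end
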